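(* Let $l\ge 2$ be an even integer, let $\hat{\mathfrak g}$ be the affine Lie algebra of type $A_l^{(1)}$ and let $L(-\tfrac12(l+1),0)$ be the simple vertex operator algebra associated to $\hat{\mathfrak g}$ at level $-\tfrac12(l+1)$. Let $M$ be a weak $L(-\tfrac12(l+1),0)$-module from the category $\mathcal O$. Then $M$ is completely reducible.
   Context: $\mathfrak g$ is the simple complex Lie algebra of type $A_l$ with highest root $\theta$ and invariant form $(\cdot,\cdot)$ normalized by $(\theta,\theta)=2$. The affine Lie algebra is $\hat{\mathfrak g}=\mathfrak g\otimes\mathbb C[t,t^{-1}]\oplus\mathbb Cc$ with $c$ central and $[x\otimes t^m,y\otimes t^n]=[x,y]\otimes t^{m+n}+m\delta_{m+n,0}(x,y)c$; its dual Coxeter number is $h^\vee=l+1$. Write $x(n)$ for the action of $x\otimes t^n$. For $k\in\mathbb C$, $N(k,0)=U(\hat{\mathfrak g})\otimes_{U(\mathfrak g\oplus\mathbb Cc\oplus\mathfrak g\otimes t\mathbb C[t])}\mathbb C$, where $\mathfrak g\otimes\mathbb C[t]$ acts trivially on $\mathbb C$ and $c$ acts as $k$; $L(k,0)$ is the quotient of $N(k,0)$ by its maximal proper submodule. For $k\neq -h^\vee$, $N(k,0)$ is a vertex operator algebra with vacuum $\mathbf 1=1\otimes 1$, $Y(x(-1)\mathbf 1,z)=\sum_{n\in\mathbb Z}x(n)z^{-n-1}$ for $x\in\mathfrak g$, and conformal vector $\frac{1}{2(k+h^\vee)}\sum_i x^i(-1)^2\mathbf 1$, where $\{x^i\}$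 is an orthonormal basis of $\mathfrak g$; $L(k,0)$ is its simple quotient vertex operator algebra. A weak module for a vertex operator algebra is a module in the sense of vertex operators (truncation, vacuum axiom, Jacobi identity) with no grading assumption. A weak $L(k,0)$-module is a $\hat{\mathfrak g}$-module of level $k$; it is "from the category $\mathcal O$" if it is in category $\mathcal O$ as a $\hat{\mathfrak g}$-module. Here weights and category $\mathcal O$ for $\hat{\mathfrak g}$ are taken in the usual sense with the derivation $d$ adjoined to the Cartan subalgebra, $d$ acting as $-L(0)$ on weak modules: the extended Cartan subalgebra acts semisimply with finite-dimensional weight spaces, and all weights lie in a finite union of sets $\nu-\hat Q_+$, where $\hat Q_+$ is the $\mathbb Z_{\ge 0}$-span of the simple roots of $\hat{\mathfrak g}$. Completely reducible means being a direct sum of irreducible submodules. *)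

theory Defs
  imports
    "HOL-Algebra.Module"
    "HOL-Algebra.QuotRing"
    "HOL-Algebra.Algebraic_Closure_Type"
    "HOL-Library.Poly_Mapping"
    "Jordan_Normal_Form.Matrix"
begin

section \<open>Complex vector spaces\<close>

text \<open>A complex vector space is a module in the sense of \<^theory>\<open>HOL-Algebra.Module\<close> over the
  ring of complex numbers. The ring multiplication and unit of the underlying record are
  used for associative algebras only.\<close>

abbreviation CC :: "complex ring"
  where "CC \<equiv> ring_of_type_algebra"

definition span_in :: "(complex, 'b, 'm) module_scheme \<Rightarrow> 'b set \<Rightarrow> 'b set"
  where "span_in V S = \<Inter>{W. submodule W CC V \<and> S \<subseteq> W}"

definition fin_dim_in :: "(complex, 'b, 'm) module_scheme \<Rightarrow> 'b set \<Rightarrow> bool"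
  where "fin_dim_in V W \<longleftrightarrow> (\<exists>S. finite S \<and> S \<subseteq> W \<and> W \<subseteq> span_in V S)"

definition linear_on ::
  "(complex, 'b, 'm) module_scheme \<Rightarrow> (complex, 'c, 'n) module_scheme \<Rightarrow> ('b \<Rightarrow> 'c) \<Rightarrow> bool"
  where "linear_on V W f \<longleftrightarrow>
    f \<in> carrier V \<rightarrow> carrier W \<and>
    (\<forall>x\<in>carrier V. \<forall>y\<in>carrier V. f (x \<oplus>\<^bsub>V\<^esub> y) = f x \<oplus>\<^bsub>W\<^esub> f y) \<and>
    (\<forall>c. \<forall>x\<in>carrier V. f (c \<odot>\<^bsub>V\<^esub> x) = c \<odot>\<^bsub>W\<^esub> f x)"

text \<open>The map of cosets of \<open>W\<close> induced by a map \<open>f\<close> of representatives.\<close>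

definition coset_map :: "('b, 'm) ring_scheme \<Rightarrow> 'b set \<Rightarrow> ('c \<Rightarrow> 'b) \<Rightarrow> 'c set \<Rightarrow> 'b set"
  where "coset_map V W f A = (\<Union>a\<in>A. W +>\<^bsub>V\<^esub> f a)"

text \<open>Quotient of a vector space by a subspace; it is also the quotient algebra if \<open>V\<close> is an
  associative algebra and \<open>W\<close> a two-sided ideal.\<close>

definition quot_module ::
  "(complex, 'b, 'm) module_scheme \<Rightarrow> 'b set \<Rightarrow> (complex, 'b set) module"
  where "quot_module V W =
    ring.extend (V Quot W) (module.fields (\<lambda>c. coset_map V W (\<lambda>a. c \<odot>\<^bsub>V\<^esub> a)))"

subsection \<open>Subspaces stable under a set of operators\<close>

definition stable_submodule ::
  "(complex, 'b, 'm) module_scheme \<Rightarrow> ('b \<Rightarrow> 'b) set \<Rightarrow> 'b set \<Rightarrow> bool"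
  where "stable_submodule V F W \<longleftrightarrow> submodule W CC V \<and> (\<forall>f\<in>F. f ` W \<subseteq> W)"

definition max_proper_submodule ::
  "(complex, 'b, 'm) module_scheme \<Rightarrow> ('b \<Rightarrow> 'b) set \<Rightarrow> 'b set"
  where "max_proper_submodule V F =
    (THE J. stable_submodule V F J \<and> J \<noteq> carrier V \<and>
       (\<forall>W. stable_submodule V F W \<longrightarrow> W \<noteq> carrier V \<longrightarrow> W \<subseteq> J))"

definition irreducible_submodule ::
  "(complex, 'b, 'm) module_scheme \<Rightarrow> ('b \<Rightarrow> 'b) set \<Rightarrow> 'b set \<Rightarrow> bool"
  where "irreducible_submodule V F W \<longleftrightarrow>
    stable_submodule V F W \<and> W \<noteq> {\<zero>\<^bsub>V\<^esub>} \<and>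
    (\<forall>W'. stable_submodule V F W' \<longrightarrow> W' \<subseteq> W \<longrightarrow> W' = {\<zero>\<^bsub>V\<^esub>} \<or> W' = W)"

definition internal_direct_sum ::
  "(complex, 'b, 'm) module_scheme \<Rightarrow> 'b set set \<Rightarrow> bool"
  where "internal_direct_sum V \<W> \<longleftrightarrow>
    span_in V (\<Union>\<W>) = carrier V \<and>
    (\<forall>W\<in>\<W>. W \<inter> span_in V (\<Union>(\<W> - {W})) = {\<zero>\<^bsub>V\<^esub>})"

definition completely_reducible ::
  "(complex, 'b, 'm) module_scheme \<Rightarrow> ('b \<Rightarrow> 'b) set \<Rightarrow> bool"
  where "completely_reducible V F \<longleftrightarrow>
    (\<exists>\<W>. (\<forall>W\<in>\<W>. irreducible_submodule V F W) \<and> internal_direct_sum V \<W>)"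


section \<open>Lie algebras, enveloping algebras, induced modules\<close>

record ('a, 'b) lie_algebra = "('a, 'b) module" +
  lie_bracket :: "'b \<Rightarrow> 'b \<Rightarrow> 'b"

text \<open>The free associative algebra on the underlying set of a Lie algebra: finitely supported
  functions on words.\<close>

definition free_algebra ::
  "(complex, 'b, 'm) module_scheme \<Rightarrow> (complex, 'b list \<Rightarrow>\<^sub>0 complex) module"
  where "free_algebra L =
    \<lparr> carrier = {p. Poly_Mapping.keys p \<subseteq> lists (carrier L)},
      monoid.mult = (\<lambda>p q. \<Sum>u\<in>Poly_Mapping.keys p. \<Sum>v\<in>Poly_Mapping.keys q.
         Poly_Mapping.single (u @ v) (Poly_Mapping.lookup p u * Poly_Mapping.lookup q v)),
      one = Poly_Mapping.single [] 1,
      ring.zero = 0,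
      add = (+),
      module.smult = (\<lambda>c. Poly_Mapping.map (\<lambda>a. c * a)) \<rparr>"

definition letter :: "'b \<Rightarrow> ('b list \<Rightarrow>\<^sub>0 complex)"
  where "letter x = Poly_Mapping.single [x] 1"

text \<open>The first two families of relations turn the free algebra into the tensor algebra of \<open>L\<close>.\<close>

definition uea_relations ::
  "(complex, 'b, 'm) lie_algebra_scheme \<Rightarrow> ('b list \<Rightarrow>\<^sub>0 complex) set"
  where "uea_relations L =
    (let F = free_algebra L in
      {letter (x \<oplus>\<^bsub>L\<^esub> y) - (letter x + letter y) | x y. x \<in> carrier L \<and> y \<in> carrier L} \<union>
      {letter (c \<odot>\<^bsub>L\<^esub> x) - c \<odot>\<^bsub>F\<^esub> letter x | c x. x \<in> carrier L} \<union>
      {letter x \<otimes>\<^bsub>F\<^esub> letter y - letter y \<otimes>\<^bsub>F\<^esub> letter x - letter (lie_bracket L x y) | x y.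
         x \<in> carrier L \<and> y \<in> carrier L})"

definition uea_ideal ::
  "(complex, 'b, 'm) lie_algebra_scheme \<Rightarrow> ('b list \<Rightarrow>\<^sub>0 complex) set"
  where "uea_ideal L = Idl\<^bsub>free_algebra L\<^esub> (uea_relations L)"

definition uea ::
  "(complex, 'b, 'm) lie_algebra_scheme \<Rightarrow> (complex, ('b list \<Rightarrow>\<^sub>0 complex) set) module"
  where "uea L = quot_module (free_algebra L) (uea_ideal L)"

definition uea_inj ::
  "(complex, 'b, 'm) lie_algebra_scheme \<Rightarrow> 'b \<Rightarrow> ('b list \<Rightarrow>\<^sub>0 complex) set"
  where "uea_inj L x = uea_ideal L +>\<^bsub>free_algebra L\<^esub> letter x"

text \<open>For a subalgebra \<open>P\<close> of \<open>L\<close> with a one-dimensional representation \<open>\<chi>\<close>, the induced module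
  \<open>U(L) \<otimes>\<^bsub>U(P)\<^esub> \<complex>\<close> is the quotient of \<open>U(L) \<otimes> \<complex> = U(L)\<close> by the span of the balancing relations
  \<open>u a \<otimes> 1 - u \<otimes> \<chi>(a)\<close>; it is enough to let \<open>a\<close> run through \<open>P\<close>, which generates \<open>U(P)\<close>.\<close>

definition balancing ::
  "(complex, 'b, 'm) lie_algebra_scheme \<Rightarrow> 'b set \<Rightarrow> ('b \<Rightarrow> complex) \<Rightarrow>
    ('b list \<Rightarrow>\<^sub>0 complex) set set"
  where "balancing L P \<chi> =
    (let U = uea L in
      span_in U {u \<otimes>\<^bsub>U\<^esub> uea_inj L a \<ominus>\<^bsub>U\<^esub> \<chi> a \<odot>\<^bsub>U\<^esub> u | u a. u \<in> carrier U \<and> a \<in> P})"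


section \<open>Affine Lie algebras and the modules \<open>N(k,0)\<close>, \<open>L(k,0)\<close>\<close>

text \<open>An element of \<open>g \<otimes> \<complex>[t,t\<^sup>-\<^sup>1] \<oplus> \<complex>c\<close> is a pair \<open>(f, a)\<close> standing for
  \<open>(\<Sum>n. f n \<otimes> t\<^sup>n) + a c\<close>. The parameter \<open>\<kappa>\<close> is the invariant form.\<close>

type_synonym 'b aff = "(int \<Rightarrow> 'b) \<times> complex"

definition affine_lie ::
  "(complex, 'b, 'm) lie_algebra_scheme \<Rightarrow> ('b \<Rightarrow> 'b \<Rightarrow> complex) \<Rightarrow> (complex, 'b aff) lie_algebra"
  where "affine_lie g \<kappa> =
    \<lparr> carrier = {(f, a). (\<forall>n. f n \<in> carrier g) \<and> finite {n. f n \<noteq> \<zero>\<^bsub>g\<^esub>}},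
      monoid.mult = undefined,
      one = undefined,
      ring.zero = (\<lambda>n. \<zero>\<^bsub>g\<^esub>, 0),
      add = (\<lambda>(f, a) (h, b). (\<lambda>n. f n \<oplus>\<^bsub>g\<^esub> h n, a + b)),
      module.smult = (\<lambda>s (f, a). (\<lambda>n. s \<odot>\<^bsub>g\<^esub> f n, s * a)),
      lie_bracket = (\<lambda>(f, a) (h, b).
        (\<lambda>n. \<Oplus>\<^bsub>g\<^esub>m\<in>{m. f m \<noteq> \<zero>\<^bsub>g\<^esub>}. lie_bracket g (f m) (h (n - m)),
         \<Sum>m\<in>{m. f m \<noteq> \<zero>\<^bsub>g\<^esub>}. of_int m * \<kappa> (f m) (h (- m)))) \<rparr>"

definition loop :: "(complex, 'b, 'm) lie_algebra_scheme \<Rightarrow> 'b \<Rightarrow> int \<Rightarrow> 'b aff"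
  where "loop g x n = (\<lambda>m. if m = n then x else \<zero>\<^bsub>g\<^esub>, 0)"

text \<open>\<open>g \<oplus> \<complex>c \<oplus> g \<otimes> t\<complex>[t]\<close>, with \<open>g \<otimes> \<complex>[t]\<close> acting trivially and \<open>c\<close> as \<open>k\<close>.\<close>

definition affine_nonneg ::
  "(complex, 'b, 'm) lie_algebra_scheme \<Rightarrow> ('b \<Rightarrow> 'b \<Rightarrow> complex) \<Rightarrow> 'b aff set"
  where "affine_nonneg g \<kappa> = {(f, a) \<in> carrier (affine_lie g \<kappa>). \<forall>n<0. f n = \<zero>\<^bsub>g\<^esub>}"

type_synonym 'b Ncarr = "('b aff list \<Rightarrow>\<^sub>0 complex) set set"
type_synonym 'b Lcarr = "'b Ncarr set"

definition N_rel ::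
  "(complex, 'b, 'm) lie_algebra_scheme \<Rightarrow> ('b \<Rightarrow> 'b \<Rightarrow> complex) \<Rightarrow> complex \<Rightarrow> 'b Ncarr"
  where "N_rel g \<kappa> k = balancing (affine_lie g \<kappa>) (affine_nonneg g \<kappa>) (\<lambda>(f, a). k * a)"

definition N_mod ::
  "(complex, 'b, 'm) lie_algebra_scheme \<Rightarrow> ('b \<Rightarrow> 'b \<Rightarrow> complex) \<Rightarrow> complex \<Rightarrow>
    (complex, 'b Ncarr) module"
  where "N_mod g \<kappa> k = quot_module (uea (affine_lie g \<kappa>)) (N_rel g \<kappa> k)"

definition N_act ::
  "(complex, 'b, 'm) lie_algebra_scheme \<Rightarrow> ('b \<Rightarrow> 'b \<Rightarrow> complex) \<Rightarrow> complex \<Rightarrow>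
    'b aff \<Rightarrow> 'b Ncarr \<Rightarrow> 'b Ncarr"
  where "N_act g \<kappa> k z =
    (let U = uea (affine_lie g \<kappa>) in
      coset_map U (N_rel g \<kappa> k) (\<lambda>u. uea_inj (affine_lie g \<kappa>) z \<otimes>\<^bsub>U\<^esub> u))"

definition N_vac ::
  "(complex, 'b, 'm) lie_algebra_scheme \<Rightarrow> ('b \<Rightarrow> 'b \<Rightarrow> complex) \<Rightarrow> complex \<Rightarrow> 'b Ncarr"
  where "N_vac g \<kappa> k =
    (let U = uea (affine_lie g \<kappa>) in N_rel g \<kappa> k +>\<^bsub>U\<^esub> \<one>\<^bsub>U\<^esub>)"

definition N_max ::
  "(complex, 'b, 'm) lie_algebra_scheme \<Rightarrow> ('b \<Rightarrow> 'b \<Rightarrow> complex) \<Rightarrow> complex \<Rightarrow> 'b Ncarr set"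
  where "N_max g \<kappa> k =
    max_proper_submodule (N_mod g \<kappa> k) (N_act g \<kappa> k ` carrier (affine_lie g \<kappa>))"

definition L_mod ::
  "(complex, 'b, 'm) lie_algebra_scheme \<Rightarrow> ('b \<Rightarrow> 'b \<Rightarrow> complex) \<Rightarrow> complex \<Rightarrow>
    (complex, 'b Lcarr) module"
  where "L_mod g \<kappa> k = quot_module (N_mod g \<kappa> k) (N_max g \<kappa> k)"

definition L_proj ::
  "(complex, 'b, 'm) lie_algebra_scheme \<Rightarrow> ('b \<Rightarrow> 'b \<Rightarrow> complex) \<Rightarrow> complex \<Rightarrow> 'b Ncarr \<Rightarrow> 'b Lcarr"
  where "L_proj g \<kappa> k v = N_max g \<kappa> k +>\<^bsub>N_mod g \<kappa> k\<^esub> v"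


section \<open>Vertex operator algebras and weak modules\<close>

text \<open>\<open>Y v n w\<close> is \<open>v\<^sub>n w\<close>, where \<open>Y(v,z) = \<Sum>n. v\<^sub>n z\<^bsup>-n-1\<^esup>\<close>. In the sums below almost all terms
  vanish, by truncation.\<close>

definition fin_supp_sum :: "('b, 'm) ring_scheme \<Rightarrow> (nat \<Rightarrow> 'b) \<Rightarrow> 'b"
  where "fin_supp_sum M f = finsum M f {j. f j \<noteq> \<zero>\<^bsub>M\<^esub>}"

text \<open>Coefficient of \<open>z\<^sub>0\<^bsup>-p-1\<^esup> z\<^sub>1\<^bsup>-r-1\<^esup> z\<^sub>2\<^bsup>-q-1\<^esup>\<close> in the Jacobi identity
  \<open>z\<^sub>2\<^sup>-\<^sup>1 \<delta>((z\<^sub>1-z\<^sub>0)/z\<^sub>2) Y(Y(u,z\<^sub>0)v,z\<^sub>2) =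
   z\<^sub>0\<^sup>-\<^sup>1 \<delta>((z\<^sub>1-z\<^sub>2)/z\<^sub>0) Y(u,z\<^sub>1)Y(v,z\<^sub>2) - z\<^sub>0\<^sup>-\<^sup>1 \<delta>((z\<^sub>2-z\<^sub>1)/(-z\<^sub>0)) Y(v,z\<^sub>2)Y(u,z\<^sub>1)\<close>.\<close>

definition jacobi_identity ::
  "(complex, 'v, 'p) module_scheme \<Rightarrow> ('v \<Rightarrow> int \<Rightarrow> 'v \<Rightarrow> 'v) \<Rightarrow>
   (complex, 'm, 'q) module_scheme \<Rightarrow> ('v \<Rightarrow> int \<Rightarrow> 'm \<Rightarrow> 'm) \<Rightarrow> bool"
  where "jacobi_identity V Y M YM \<longleftrightarrow>
    (\<forall>u\<in>carrier V. \<forall>v\<in>carrier V. \<forall>w\<in>carrier M. \<forall>p q r.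
      fin_supp_sum M (\<lambda>j. ((of_int r :: complex) gchoose j) \<odot>\<^bsub>M\<^esub>
          YM (Y u (p + int j) v) (r + q - int j) w) =
      fin_supp_sum M (\<lambda>j. ((-1) ^ j * ((of_int p :: complex) gchoose j)) \<odot>\<^bsub>M\<^esub>
          (YM u (p + r - int j) (YM v (q + int j) w) \<ominus>\<^bsub>M\<^esub>
           ((-1) powi p) \<odot>\<^bsub>M\<^esub> YM v (p + q - int j) (YM u (r + int j) w))))"

definition weak_module ::
  "(complex, 'v, 'p) module_scheme \<Rightarrow> 'v \<Rightarrow> ('v \<Rightarrow> int \<Rightarrow> 'v \<Rightarrow> 'v) \<Rightarrow>
   (complex, 'm, 'q) module_scheme \<Rightarrow> ('v \<Rightarrow> int \<Rightarrow> 'm \<Rightarrow> 'm) \<Rightarrow> bool"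
  where "weak_module V vac Y M YM \<longleftrightarrow>
    module CC M \<and>
    (\<forall>v\<in>carrier V. \<forall>n. linear_on M M (YM v n)) \<and>
    (\<forall>n. \<forall>w\<in>carrier M. linear_on V M (\<lambda>v. YM v n w)) \<and>
    (\<forall>v\<in>carrier V. \<forall>w\<in>carrier M. \<exists>n0. \<forall>n\<ge>n0. YM v n w = \<zero>\<^bsub>M\<^esub>) \<and>
    (\<forall>n. \<forall>w\<in>carrier M. YM vac n w = (if n = -1 then w else \<zero>\<^bsub>M\<^esub>)) \<and>
    jacobi_identity V Y M YM"

definition L0_eigenspace ::
  "(complex, 'v, 'p) module_scheme \<Rightarrow> ('v \<Rightarrow> int \<Rightarrow> 'v \<Rightarrow> 'v) \<Rightarrow> 'v \<Rightarrow> int \<Rightarrow> 'v set"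
  where "L0_eigenspace V Y \<omega> n = {v \<in> carrier V. Y \<omega> 1 v = of_int n \<odot>\<^bsub>V\<^esub> v}"

text \<open>The modes of the conformal vector are \<open>L(n) = \<omega>\<^bsub>n+1\<^esub>\<close>.\<close>

definition vertex_operator_algebra ::
  "(complex, 'v, 'p) module_scheme \<Rightarrow> 'v \<Rightarrow> ('v \<Rightarrow> int \<Rightarrow> 'v \<Rightarrow> 'v) \<Rightarrow> 'v \<Rightarrow> bool"
  where "vertex_operator_algebra V vac Y \<omega> \<longleftrightarrow>
    vac \<in> carrier V \<and> \<omega> \<in> carrier V \<and>
    weak_module V vac Y V Y \<and>
    (\<forall>v\<in>carrier V. Y v (-1) vac = v \<and> (\<forall>n\<ge>0. Y v n vac = \<zero>\<^bsub>V\<^esub>)) \<and>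
    (\<exists>cc. \<forall>m n. \<forall>v\<in>carrier V.
       Y \<omega> (m + 1) (Y \<omega> (n + 1) v) \<ominus>\<^bsub>V\<^esub> Y \<omega> (n + 1) (Y \<omega> (m + 1) v) =
       of_int (m - n) \<odot>\<^bsub>V\<^esub> Y \<omega> (m + n + 1) v \<oplus>\<^bsub>V\<^esub>
       (if m + n = 0 then of_int (m ^ 3 - m) / 12 * cc else 0) \<odot>\<^bsub>V\<^esub> v) \<and>
    (\<forall>u\<in>carrier V. \<forall>v\<in>carrier V. \<forall>n. Y (Y \<omega> 0 u) n v = (- of_int n) \<odot>\<^bsub>V\<^esub> Y u (n - 1) v) \<and>
    span_in V (\<Union>n. L0_eigenspace V Y \<omega> n) = carrier V \<and>
    (\<forall>n. fin_dim_in V (L0_eigenspace V Y \<omega> n)) \<and>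
    (\<exists>n0. \<forall>n<n0. L0_eigenspace V Y \<omega> n = {\<zero>\<^bsub>V\<^esub>})"


section \<open>The vertex operator algebras \<open>N(k,0)\<close> and \<open>L(k,0)\<close>\<close>

definition orthonormal_basis ::
  "(complex, 'b, 'm) lie_algebra_scheme \<Rightarrow> ('b \<Rightarrow> 'b \<Rightarrow> complex) \<Rightarrow> 'b list \<Rightarrow> bool"
  where "orthonormal_basis g \<kappa> xs \<longleftrightarrow>
    set xs \<subseteq> carrier g \<and> span_in g (set xs) = carrier g \<and>
    (\<forall>i<length xs. \<forall>j<length xs. \<kappa> (xs ! i) (xs ! j) = (if i = j then 1 else 0))"

definition N_conformal ::
  "(complex, 'b, 'm) lie_algebra_scheme \<Rightarrow> ('b \<Rightarrow> 'b \<Rightarrow> complex) \<Rightarrow> complex \<Rightarrow> complex \<Rightarrow>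
    'b list \<Rightarrow> 'b Ncarr"
  where "N_conformal g \<kappa> hdual k xs =
    (1 / (2 * (k + hdual))) \<odot>\<^bsub>N_mod g \<kappa> k\<^esub>
    (\<Oplus>\<^bsub>N_mod g \<kappa> k\<^esub>i\<in>{..<length xs}.
       N_act g \<kappa> k (loop g (xs ! i) (-1)) (N_act g \<kappa> k (loop g (xs ! i) (-1)) (N_vac g \<kappa> k)))"

text \<open>\<open>Y\<close> is the vertex operator map of the vertex operator algebra \<open>N(k,0)\<close>. Being determined
  on the generators \<open>x(-1)\<one>\<close>, it is unique on the carrier.\<close>

definition is_N_vertex_operators ::
  "(complex, 'b, 'm) lie_algebra_scheme \<Rightarrow> ('b \<Rightarrow> 'b \<Rightarrow> complex) \<Rightarrow> complex \<Rightarrow> complex \<Rightarrow>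
    'b list \<Rightarrow> ('b Ncarr \<Rightarrow> int \<Rightarrow> 'b Ncarr \<Rightarrow> 'b Ncarr) \<Rightarrow> bool"
  where "is_N_vertex_operators g \<kappa> hdual k xs Y \<longleftrightarrow>
    vertex_operator_algebra (N_mod g \<kappa> k) (N_vac g \<kappa> k) Y (N_conformal g \<kappa> hdual k xs) \<and>
    (\<forall>x\<in>carrier g. \<forall>n. \<forall>v\<in>carrier (N_mod g \<kappa> k).
       Y (N_act g \<kappa> k (loop g x (-1)) (N_vac g \<kappa> k)) n v = N_act g \<kappa> k (loop g x n) v)"

text \<open>The induced vertex operators of the quotient \<open>L(k,0)\<close> of \<open>N(k,0)\<close>.\<close>

definition L_vertex ::
  "(complex, 'b, 'm) lie_algebra_scheme \<Rightarrow> ('b \<Rightarrow> 'b \<Rightarrow> complex) \<Rightarrow> complex \<Rightarrow>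
    ('b Ncarr \<Rightarrow> int \<Rightarrow> 'b Ncarr \<Rightarrow> 'b Ncarr) \<Rightarrow> 'b Lcarr \<Rightarrow> int \<Rightarrow> 'b Lcarr \<Rightarrow> 'b Lcarr"
  where "L_vertex g \<kappa> k Y A n B = (\<Union>a\<in>A. \<Union>b\<in>B. L_proj g \<kappa> k (Y a n b))"

text \<open>On a weak \<open>L(k,0)\<close>-module, \<open>x \<otimes> t\<^sup>n\<close> acts as the mode \<open>x(n)\<close> of the image of \<open>x(-1)\<one>\<close>.\<close>

definition current_mode ::
  "(complex, 'b, 'm) lie_algebra_scheme \<Rightarrow> ('b \<Rightarrow> 'b \<Rightarrow> complex) \<Rightarrow> complex \<Rightarrow>
    ('b Lcarr \<Rightarrow> int \<Rightarrow> 'w \<Rightarrow> 'w) \<Rightarrow> 'b \<Rightarrow> int \<Rightarrow> 'w \<Rightarrow> 'w"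
  where "current_mode g \<kappa> k YM x n =
    YM (L_proj g \<kappa> k (N_act g \<kappa> k (loop g x (-1)) (N_vac g \<kappa> k))) n"


section \<open>Type \<open>A\<^sub>l\<close>, weights and category \<open>O\<close>\<close>

definition sl :: "nat \<Rightarrow> (complex, complex mat) lie_algebra"
  where "sl l =
    module.extend
      ((module_mat TYPE(complex) (l + 1) (l + 1))
        \<lparr> carrier := {A \<in> carrier_mat (l + 1) (l + 1). (\<Sum>i<l + 1. A $$ (i, i)) = 0} \<rparr>)
      (lie_algebra.fields (\<lambda>A B. A * B - B * A))"

text \<open>The trace form is the invariant form on \<open>sl\<^bsub>l+1\<^esub>\<close> with \<open>(\<theta>,\<theta>) = 2\<close>.\<close>

definition trace_form :: "nat \<Rightarrow> complex mat \<Rightarrow> complex mat \<Rightarrow> complex"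
  where "trace_form l A B = (\<Sum>i<l + 1. (A * B) $$ (i, i))"

text \<open>\<open>(H, a, b)\<close> stands for the element \<open>H + a c + b d\<close> of the extended Cartan subalgebra. In this
  section a functional on the extended Cartan subalgebra is represented by any function that
  restricts to it.\<close>

type_synonym ext = "complex mat \<times> complex \<times> complex"

definition ext_cartan :: "nat \<Rightarrow> ext set"
  where "ext_cartan l = {(H, a, b). H \<in> carrier (sl l) \<and> diagonal_mat H}"

text \<open>The simple roots of type \<open>A\<^sub>l\<^sup>(\<^sup>1\<^sup>)\<close>; \<open>i = 0\<close> gives \<open>\<delta> - \<theta>\<close>.\<close>

definition simple_root :: "nat \<Rightarrow> nat \<Rightarrow> ext \<Rightarrow> complex"
  where "simple_root l i = (\<lambda>(H, a, b).
    if i = 0 then b - (H $$ (0, 0) - H $$ (l, l)) else H $$ (i - 1, i - 1) - H $$ (i, i))"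

definition Q_plus :: "nat \<Rightarrow> (ext \<Rightarrow> complex) set"
  where "Q_plus l = {\<lambda>h. \<Sum>i\<le>l. of_nat (m i) * simple_root l i h | m :: nat \<Rightarrow> nat. True}"

definition weight_space ::
  "nat \<Rightarrow> (complex, 'w, 'q) module_scheme \<Rightarrow> (ext \<Rightarrow> 'w \<Rightarrow> 'w) \<Rightarrow> (ext \<Rightarrow> complex) \<Rightarrow> 'w set"
  where "weight_space l M \<rho> \<nu> =
    {w \<in> carrier M. \<forall>h\<in>ext_cartan l. \<rho> h w = \<nu> h \<odot>\<^bsub>M\<^esub> w}"

definition category_O ::
  "nat \<Rightarrow> (complex, 'w, 'q) module_scheme \<Rightarrow> (ext \<Rightarrow> 'w \<Rightarrow> 'w) \<Rightarrow> bool"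
  where "category_O l M \<rho> \<longleftrightarrow>
    span_in M (\<Union>\<nu>. weight_space l M \<rho> \<nu>) = carrier M \<and>
    (\<forall>\<nu>. fin_dim_in M (weight_space l M \<rho> \<nu>)) \<and>
    (\<exists>S. finite S \<and>
      (\<forall>\<nu>. weight_space l M \<rho> \<nu> \<noteq> {\<zero>\<^bsub>M\<^esub>} \<longrightarrow>
        (\<exists>\<nu>0\<in>S. \<exists>\<beta>\<in>Q_plus l. \<forall>h\<in>ext_cartan l. \<nu> h = \<nu>0 h - \<beta> h)))"

text \<open>Here \<open>\<omega>\<close> is the conformal vector of \<open>L(k,0)\<close>; \<open>c\<close> acts as \<open>k\<close> and \<open>d\<close> as \<open>-L(0)\<close>.\<close>

definition ext_cartan_act ::
  "nat \<Rightarrow> complex \<Rightarrow> complex mat Lcarr \<Rightarrow> (complex, 'w, 'q) module_scheme \<Rightarrow>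
    (complex mat Lcarr \<Rightarrow> int \<Rightarrow> 'w \<Rightarrow> 'w) \<Rightarrow> ext \<Rightarrow> 'w \<Rightarrow> 'w"
  where "ext_cartan_act l k \<omega> M YM = (\<lambda>(H, a, b) w.
    current_mode (sl l) (trace_form l) k YM H 0 w \<oplus>\<^bsub>M\<^esub> (a * k) \<odot>\<^bsub>M\<^esub> w \<ominus>\<^bsub>M\<^esub> b \<odot>\<^bsub>M\<^esub> YM \<omega> 1 w)"

text \<open>The vertex operator algebra \<open>L(k,0)\<close> of type \<open>A\<^sub>l\<^sup>(\<^sup>1\<^sup>)\<close>, given the vertex operators \<open>Y\<close> of \<open>N(k,0)\<close>
  and an orthonormal basis \<open>xs\<close> of \<open>sl\<^bsub>l+1\<^esub>\<close>; the dual Coxeter number is \<open>l + 1\<close>.\<close>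

definition weak_L_module ::
  "nat \<Rightarrow> complex \<Rightarrow> (complex mat Ncarr \<Rightarrow> int \<Rightarrow> complex mat Ncarr \<Rightarrow> complex mat Ncarr) \<Rightarrow>
    (complex, 'w, 'q) module_scheme \<Rightarrow> (complex mat Lcarr \<Rightarrow> int \<Rightarrow> 'w \<Rightarrow> 'w) \<Rightarrow> bool"
  where "weak_L_module l k Y M YM \<longleftrightarrow>
    weak_module (L_mod (sl l) (trace_form l) k)
      (L_proj (sl l) (trace_form l) k (N_vac (sl l) (trace_form l) k))
      (L_vertex (sl l) (trace_form l) k Y) M YM"

definition L_conformal :: "nat \<Rightarrow> complex \<Rightarrow> complex mat list \<Rightarrow> complex mat Lcarr"
  where "L_conformal l k xs =
    L_proj (sl l) (trace_form l) k (N_conformal (sl l) (trace_form l) (of_nat (l + 1)) k xs)"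

definition from_category_O ::
  "nat \<Rightarrow> complex \<Rightarrow> complex mat list \<Rightarrow> (complex, 'w, 'q) module_scheme \<Rightarrow>
    (complex mat Lcarr \<Rightarrow> int \<Rightarrow> 'w \<Rightarrow> 'w) \<Rightarrow> bool"
  where "from_category_O l k xs M YM \<longleftrightarrow>
    category_O l M (ext_cartan_act l k (L_conformal l k xs) M YM)"

text \<open>The operators \<open>v\<^sub>n\<close>, \<open>v \<in> L(k,0)\<close>, on a weak module; the stable subspaces are its submodules.\<close>

definition L_module_operators ::
  "nat \<Rightarrow> complex \<Rightarrow> (complex mat Lcarr \<Rightarrow> int \<Rightarrow> 'w \<Rightarrow> 'w) \<Rightarrow> ('w \<Rightarrow> 'w) set"
  where "L_module_operators l k YM =
    {YM v n | v n. v \<in> carrier (L_mod (sl l) (trace_form l) k)}"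

end

theory Submission
  imports Defs
begin

text \<open>Put \<open>N = l + 1\<close> and let \<open>E(z)\<close> be the \<open>N \<times> N\<close> matrix of currents \<open>E\<^sub>i\<^sub>j(z)\<close>, projected to trace zero.
  At level \<open>-N/2\<close> the symmetrized square of \<open>E\<close>, minus its trace part, spans a copy of the adjoint
  representation in \<open>N(k,0)\<close> that consists of singular vectors of conformal weight 2. It therefore
  vanishes in \<open>L(k,0)\<close>, and its trace part is the conformal vector.

  On a highest weight vector of weight \<open>\<lambda>\<close> of a weak \<open>L(k,0)\<close>-module, the zero modes of the diagonal
  entries give \<open>\<lambda>\<^sub>i\<^sup>2 + (\<Sum>m<i. \<lambda>\<^sub>m - \<lambda>\<^sub>i) + (N/2) \<lambda>\<^sub>i = \<Delta>\<close> for every \<open>i\<close>, where \<open>\<Delta>\<close> is the conformal weight.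
  Hence for each \<open>i\<close> either \<open>\<lambda>\<^sub>i = \<lambda>\<^bsub>i+1\<^esub>\<close> or \<open>\<lambda>\<^sub>i + \<lambda>\<^bsub>i+1\<^esub> = i + 1 - N/2\<close> (counting from 0). As \<open>N\<close> is odd, two
  solutions that differ by an integral vector coincide. So all singular vectors in one class of
  weights modulo the root lattice have the same weight. This also holds modulo a submodule; there
  is then no room for extensions, every singular vector generates an irreducible module, and these
  modules span.\<close>

section \<open>Joint eigenvectors and direct sums\<close>

text \<open>Modules are given as records with a carrier. Each one is copied into a type that is a
  vector space as a whole (\<open>embedded_module\<close>), and the representation theory is carried
  out there with subspaces, spans and bases of that type.

  Quotients shape the argument: excluding extensions is a statement about \<open>V / T\<close> for a
  submodule \<open>T\<close>. Instead of forming the quotient, everything is stated relative to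
  \<open>T\<close>: a vector is singular modulo \<open>T\<close> if raising operators send it into
  \<open>T\<close>, and the quadratic relation is asserted modulo \<open>T\<close>. The case
  \<open>T = {0}\<close> then gives irreducibility, and the case where \<open>T\<close> is the sum
  of all highest weight modules gives spanning.

  Category O provides the decomposition into weight vectors and one real bound: the value of a
  weight at the Cartan element where all simple roots equal 1 is bounded above, while every raising
  operator increases it by at least 1. Hence any search for a singular vector ends.

  The vertex operators are arbitrary data subject to axioms, so submodules for the affine algebra
  and for the vertex algebra are matched through the Jacobi identity, starting from the currents,
  which generate.\<close>

locale complex_space = vector_space scale
  for scale :: "complex \<Rightarrow> 'b::ab_group_add \<Rightarrow> 'b"  (infixr \<open>*c\<close> 75)
begin

abbreviation endo :: "('b \<Rightarrow> 'b) \<Rightarrow> bool"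
  where "endo \<equiv> Vector_Spaces.linear scale scale"

lemma endoI:
  assumes "\<And>u v. f (u + v) = f u + f v" and "\<And>c v. f (scale c v) = scale c (f v)"
  shows "endo f"
  by (simp add: Vector_Spaces.linear_iff assms vector_space_axioms)

lemma endo_add: "endo f \<Longrightarrow> f (u + v) = f u + f v"
  and endo_scale: "endo f \<Longrightarrow> f (scale c v) = scale c (f v)"
  by (simp_all add: Vector_Spaces.linear_iff)

lemma endo_module_hom: "endo f \<Longrightarrow> module_hom scale scale f"
  by (simp add: module_hom_iff_linear)

lemma endo_sum: "endo f \<Longrightarrow> f (\<Sum>x\<in>A. g x) = (\<Sum>x\<in>A. f (g x))"
  and endo_diff: "endo f \<Longrightarrow> f (u - v) = f u - f v"
  and endo_zero: "endo f \<Longrightarrow> f 0 = 0"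
  and endo_neg: "endo f \<Longrightarrow> f (- u) = - f u"
  by (simp_all add: module_hom.sum[OF endo_module_hom] module_hom.diff[OF endo_module_hom]
      module_hom.zero[OF endo_module_hom] module_hom.neg[OF endo_module_hom])

lemma endo_span:
  assumes "endo f" and "\<And>v. v \<in> S \<Longrightarrow> f v \<in> W" and "subspace W" and "v \<in> span S"
  shows "f v \<in> W"
  using assms(4)
  by (rule span_induct_alt)
    (simp_all add: endo_zero endo_add endo_scale subspace_0 subspace_add subspace_scale assms)

text \<open>The index type is free: it is \<open>nat\<close> for the weights of a module and
  \<open>unit\<close> when only the conformal weight is decomposed.\<close>

definition eigen :: "('h \<Rightarrow> 'b \<Rightarrow> 'b) \<Rightarrow> ('h \<Rightarrow> complex) \<Rightarrow> 'b set"
  where "eigen D \<nu> = {v. \<forall>h. D h v = scale (\<nu> h) v}"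

lemma subspace_eigen: "(\<And>h. endo (D h)) \<Longrightarrow> subspace (eigen D \<nu>)"
  by (auto simp: subspace_def eigen_def endo_zero endo_add endo_scale scale_right_distrib mult.commute)

text \<open>A subspace stable under a commuting diagonal family is graded by the joint eigenvalues.
  With \<open>W = {0}\<close> this is the independence of joint eigenvectors.\<close>

lemma eigen_components:
  assumes lin: "\<And>h. endo (D h)"
    and W: "subspace W" "\<And>h v. v \<in> W \<Longrightarrow> D h v \<in> W"
    and F: "finite F"
    and ev: "\<And>\<nu>. \<nu> \<in> F \<Longrightarrow> w \<nu> \<in> eigen D \<nu>"
    and s: "(\<Sum>\<nu>\<in>F. w \<nu>) \<in> W"
    and mem: "\<nu> \<in> F"
  shows "w \<nu> \<in> W"
proof -
  have "\<forall>w. (\<forall>\<nu>\<in>F. w \<nu> \<in> eigen D \<nu>) \<longrightarrow> (\<Sum>\<nu>\<in>F. w \<nu>) \<in> W \<longrightarrow> (\<forall>\<nu>\<in>F. w \<nu> \<in> W)"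
    using F
  proof (induction F)
    case empty
    then show ?case by simp
  next
    case (insert \<mu> F)
    show ?case
    proof (intro allI impI)
      fix w assume ev: "\<forall>\<nu>\<in>insert \<mu> F. w \<nu> \<in> eigen D \<nu>" and s: "sum w (insert \<mu> F) \<in> W"
      have in_W: "w \<nu> \<in> W" if \<nu>: "\<nu> \<in> F" for \<nu>
      proof -
        have ne: "\<nu> \<noteq> \<mu>" using \<nu> insert.hyps by auto
        then obtain h where h: "\<nu> h \<noteq> \<mu> h" by blast
        \<comment> \<open>\<open>D h - \<mu> h\<close> removes the summand at \<open>\<mu>\<close>,
          so the induction hypothesis applies to the rescaled family on \<open>F\<close>; the factor
          at the chosen \<open>\<nu>\<close> is nonzero and can be divided out.\<close>
        have "D h (sum w (insert \<mu> F)) - scale (\<mu> h) (sum w (insert \<mu> F)) \<in> W"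
          by (intro subspace_diff subspace_scale W s)
        also have "D h (sum w (insert \<mu> F)) = (\<Sum>\<nu>\<in>insert \<mu> F. scale (\<nu> h) (w \<nu>))"
          using ev by (auto simp: endo_sum[OF lin] eigen_def intro!: sum.cong simp del: sum.insert)
        also have "\<dots> - scale (\<mu> h) (sum w (insert \<mu> F)) = (\<Sum>\<nu>\<in>F. scale (\<nu> h - \<mu> h) (w \<nu>))"
          using insert.hyps by (simp add: scale_right_distrib scale_sum_right sum_subtractf scale_left_diff_distrib)
        finally have sW: "(\<Sum>\<nu>\<in>F. scale (\<nu> h - \<mu> h) (w \<nu>)) \<in> W" .
        have "\<forall>\<nu>\<in>F. scale (\<nu> h - \<mu> h) (w \<nu>) \<in> eigen D \<nu>"
          using ev by (auto intro!: subspace_scale subspace_eigen lin)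
        then have "\<forall>\<nu>\<in>F. scale (\<nu> h - \<mu> h) (w \<nu>) \<in> W"
          using insert.IH[rule_format, of "\<lambda>\<nu>. (\<nu> h - \<mu> h) *c w \<nu>"] sW by blast
        with \<nu> have "scale (\<nu> h - \<mu> h) (w \<nu>) \<in> W" by blast
        then have "scale (inverse (\<nu> h - \<mu> h)) (scale (\<nu> h - \<mu> h) (w \<nu>)) \<in> W"
          by (rule subspace_scale[OF W(1)])
        then show ?thesis using h by simp
      qed
      have "sum w (insert \<mu> F) - sum w F \<in> W"
        by (intro subspace_diff subspace_sum W s in_W)
      then have "w \<mu> \<in> W" using insert.hyps by simp
      then show "\<forall>\<nu>\<in>insert \<mu> F. w \<nu> \<in> W" using in_W by blast
    qed
  qed
  then show ?thesis using ev s mem by blast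
qed

lemma span_Union_sum:
  assumes "\<And>\<nu>. \<nu> \<in> I \<Longrightarrow> subspace (E \<nu>)" and "x \<in> span (\<Union>\<nu>\<in>I. E \<nu>)"
  obtains F w where "finite F" "F \<subseteq> I" "\<And>\<nu>. \<nu> \<in> F \<Longrightarrow> w \<nu> \<in> E \<nu>" "x = (\<Sum>\<nu>\<in>F. w \<nu>)"
proof -
  have "\<exists>F w. finite F \<and> F \<subseteq> I \<and> (\<forall>\<nu>\<in>F. w \<nu> \<in> E \<nu>) \<and> x = (\<Sum>\<nu>\<in>F. w \<nu>)"
    using assms(2)
  proof (induction rule: span_induct_alt)
    case base
    show ?case by (rule exI[of _ "{}"]) simp
  next
    case (step c y x)
    from step(2) obtain F w where F: "finite F" "F \<subseteq> I" "\<forall>\<nu>\<in>F. w \<nu> \<in> E \<nu>" "x = (\<Sum>\<nu>\<in>F. w \<nu>)"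
      by blast
    from step(1) obtain \<mu> where \<mu>: "\<mu> \<in> I" "y \<in> E \<mu>" by blast
    have cy: "scale c y \<in> E \<mu>" using \<mu> assms(1) by (auto intro: subspace_scale)
    let ?w = "w(\<mu> := scale c y + (if \<mu> \<in> F then w \<mu> else 0))"
    have "scale c y + x = (\<Sum>\<nu>\<in>insert \<mu> F. ?w \<nu>)"
    proof (cases "\<mu> \<in> F")
      case True
      have "sum ?w (insert \<mu> F) = ?w \<mu> + sum ?w (F - {\<mu>})" by (rule sum.insert_remove[OF F(1)])
      moreover have "sum ?w (F - {\<mu>}) = sum w (F - {\<mu>})" by (rule sum.cong) auto
      moreover have "x = w \<mu> + sum w (F - {\<mu>})" using True F by (simp add: sum.remove)
      ultimately show ?thesis using True by (simp add: add.assoc)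
    next
      case False
      then have "sum ?w F = sum w F" by (intro sum.cong) auto
      then show ?thesis using False F by simp
    qed
    moreover have "\<forall>\<nu>\<in>insert \<mu> F. ?w \<nu> \<in> E \<nu>"
      using F \<mu> cy assms(1) by (auto intro: subspace_add)
    ultimately show ?case using F \<mu> by (intro exI[of _ "insert \<mu> F"] exI[of _ ?w]) auto
  qed
  then show ?thesis using that by blast
qed

lemma eigen_Int_span:
  assumes lin: "\<And>h. endo (D h)" and \<nu>: "\<nu> \<notin> I"
    and x: "x \<in> eigen D \<nu>" "x \<in> span (\<Union>\<mu>\<in>I. eigen D \<mu>)"
  shows "x = 0"
proof -
  obtain F w where F: "finite F" "F \<subseteq> I" "\<And>\<nu>. \<nu> \<in> F \<Longrightarrow> w \<nu> \<in> eigen D \<nu>" "x = (\<Sum>\<nu>\<in>F. w \<nu>)"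
    by (rule span_Union_sum[OF subspace_eigen[OF lin] x(2)]) (rule that)
  have \<nu>F: "\<nu> \<notin> F" using F \<nu> by auto
  \<comment> \<open>Moving \<open>x\<close> to the other side gives a family on
    \<open>insert \<nu> F\<close> with sum zero, to which \<open>eigen_components\<close> with the
    zero subspace applies.\<close>
  let ?w = "w(\<nu> := - x)"
  have "sum ?w F = sum w F" using \<nu>F by (intro sum.cong) auto
  then have s: "sum ?w (insert \<nu> F) \<in> {0}" using F \<nu>F by simp
  have ev: "?w \<mu> \<in> eigen D \<mu>" if "\<mu> \<in> insert \<nu> F" for \<mu>
    using that F(3) x(1) by (auto intro: subspace_neg subspace_eigen lin)
  have "?w \<nu> \<in> {0}"
    by (rule eigen_components[of D "{0}" "insert \<nu> F" ?w \<nu>, OF lin subspace_single_0 _ _ ev s])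
      (use F(1) endo_zero[OF lin] in \<open>simp_all del: fun_upd_apply\<close>)
  then show ?thesis by simp
qed

text \<open>The starting point for finding a singular vector inside a given nonzero submodule: one
  of the weight components of any element will do.\<close>

lemma eigen_components_ex:
  assumes lin: "\<And>h. endo (D h)"
    and W: "subspace W" "\<And>h v. v \<in> W \<Longrightarrow> D h v \<in> W"
    and x: "x \<in> W" "x \<noteq> 0" "x \<in> span (\<Union>\<mu>\<in>I. eigen D \<mu>)"
  obtains \<mu> w where "\<mu> \<in> I" "w \<in> eigen D \<mu>" "w \<in> W" "w \<noteq> 0"
proof -
  obtain F w where F: "finite F" "F \<subseteq> I" "\<And>\<nu>. \<nu> \<in> F \<Longrightarrow> w \<nu> \<in> eigen D \<nu>" "x = (\<Sum>\<nu>\<in>F. w \<nu>)"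
    by (rule span_Union_sum[OF subspace_eigen[OF lin] x(3)]) (rule that)
  have "\<exists>\<nu>\<in>F. w \<nu> \<noteq> 0" using F(4) x(2) by (metis sum.neutral)
  then obtain \<nu> where \<nu>: "\<nu> \<in> F" "w \<nu> \<noteq> 0" by blast
  have "w \<nu> \<in> W"
    by (rule eigen_components[of D W F w \<nu>, OF lin]) (use W F x \<nu> in auto)
  then show ?thesis using that \<nu> F by blast
qed

text \<open>Zorn's lemma for independent subfamilies. Irreducibility enters as the dichotomy
  \<open>irr\<close>, which every notion of stable subspace closed under sums and intersections
  supplies.\<close>

lemma direct_sum_of_irreducibles:
  assumes sub: "\<And>W. W \<in> I \<Longrightarrow> subspace W"
    and irr: "\<And>W \<W>. W \<in> I \<Longrightarrow> \<W> \<subseteq> I \<Longrightarrow> W \<inter> span (\<Union>\<W>) = {0} \<or> W \<subseteq> span (\<Union>\<W>)"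
    and nz: "{0} \<notin> I"
  obtains \<W> where "\<W> \<subseteq> I" "span (\<Union>\<W>) = span (\<Union>I)"
    "\<And>W. W \<in> \<W> \<Longrightarrow> W \<inter> span (\<Union>(\<W> - {W})) = {0}"
proof -
  define indep where "indep \<W> \<longleftrightarrow> \<W> \<subseteq> I \<and> (\<forall>W\<in>\<W>. W \<inter> span (\<Union>(\<W> - {W})) = {0})" for \<W>
  have "\<exists>\<W>\<in>{\<W>. indep \<W>}. \<forall>\<V>\<in>{\<W>. indep \<W>}. \<W> \<subseteq> \<V> \<longrightarrow> \<V> = \<W>"
  proof (rule subset_Zorn)
    fix C assume C: "subset.chain {\<W>. indep \<W>} C"
    show "\<exists>\<U>\<in>{\<W>. indep \<W>}. \<forall>\<V>\<in>C. \<V> \<subseteq> \<U>"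
    proof (intro bexI[of _ "\<Union>C"])
      have CI: "\<V> \<subseteq> I" if "\<V> \<in> C" for \<V>
        using C that by (auto simp: subset_chain_def indep_def)
      have "W \<inter> span (\<Union>(\<Union>C - {W})) = {0}" if W: "W \<in> \<V>0" "\<V>0 \<in> C" for W \<V>0
      proof -
        have "x = 0" if x: "x \<in> W" "x \<in> span (\<Union>(\<Union>C - {W}))" for x
        proof -
          \<comment> \<open>A linear combination involves finitely many members of the chain, and
            the largest of them already contains the whole dependence.\<close>
          have "\<exists>\<V>\<in>C. W \<in> \<V> \<and> x \<in> span (\<Union>(\<V> - {W}))"
            using x(2)
          proof (induction rule: span_induct_alt)
            case base
            then show ?case using W span_zero by blast
          next
            case (step c y x)
            obtain \<V>1 where 1: "\<V>1 \<in> C" "W \<in> \<V>1" "x \<in> span (\<Union>(\<V>1 - {W}))" using step by blast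
            obtain \<V>2 where 2: "\<V>2 \<in> C" "y \<in> \<Union>(\<V>2 - {W})" using step(1) by blast
            have "\<V>1 \<subseteq> \<V>2 \<or> \<V>2 \<subseteq> \<V>1" using C 1(1) 2(1) by (auto simp: subset_chain_def)
            then obtain \<V> where \<V>: "\<V> \<in> C" "\<V>1 \<subseteq> \<V>" "\<V>2 \<subseteq> \<V>" using 1(1) 2(1) by blast
            have "span (\<Union>(\<V>1 - {W})) \<subseteq> span (\<Union>(\<V> - {W}))"
              by (rule span_mono) (use \<V>(2) in blast)
            moreover have "y \<in> span (\<Union>(\<V> - {W}))" using 2 \<V> by (intro span_base) blast
            ultimately have "scale c y + x \<in> span (\<Union>(\<V> - {W}))"
              using 1(3) by (auto intro!: span_add span_scale)
            then show ?case using \<V> 1 by blast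
          qed
          then obtain \<V> where "\<V> \<in> C" "W \<in> \<V>" "x \<in> span (\<Union>(\<V> - {W}))" by blast
          with C x(1) show ?thesis by (auto simp: subset_chain_def indep_def)
        qed
        moreover have "0 \<in> W" using W CI sub subspace_0 by blast
        ultimately show ?thesis using span_zero by blast
      qed
      moreover have "\<Union>C \<subseteq> I" using CI by blast
      ultimately show "\<Union>C \<in> {\<W>. indep \<W>}" unfolding indep_def by blast
    qed blast
  qed
  then obtain \<W> where \<W>: "indep \<W>" and max: "\<And>\<V>. indep \<V> \<Longrightarrow> \<W> \<subseteq> \<V> \<Longrightarrow> \<V> = \<W>" by blast
  have "W \<subseteq> span (\<Union>\<W>)" if W: "W \<in> I" for W
  proof (rule ccontr)
    assume n: "\<not> W \<subseteq> span (\<Union>\<W>)"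
    then have W0: "W \<inter> span (\<Union>\<W>) = {0}" using irr[OF W, of \<W>] \<W> unfolding indep_def by blast
    have "W \<notin> \<W>" using n span_superset by blast
    have "Z \<inter> span (\<Union>(insert W \<W> - {Z})) = {0}" if Z: "Z \<in> insert W \<W>" for Z
    proof (cases "Z = W")
      case True
      then show ?thesis using W0 \<open>W \<notin> \<W>\<close> by simp
    next
      case False
      then have Z\<W>: "Z \<in> \<W>" using Z by simp
      have eq: "\<Union>(insert W \<W> - {Z}) = W \<union> \<Union>(\<W> - {Z})" using False by blast
      have "x = 0" if x: "x \<in> Z" "x \<in> span (W \<union> \<Union>(\<W> - {Z}))" for x
      proof -
        obtain w y where wy: "x = w + y" "w \<in> span W" "y \<in> span (\<Union>(\<W> - {Z}))"
          using x(2) unfolding span_Un by blast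
        have "w \<in> W" using wy sub[OF W] span_eq_iff by blast
        have "y \<in> span (\<Union>\<W>)" using wy(3) span_mono[of "\<Union>(\<W> - {Z})" "\<Union>\<W>"] by blast
        moreover have "x \<in> span (\<Union>\<W>)" using x(1) Z\<W> by (intro span_base) blast
        \<comment> \<open>\<open>w = x - y\<close> lies in \<open>W\<close> and in the span of
          \<open>\<W>\<close>, hence vanishes, and \<open>x = y\<close> becomes a dependence inside
          \<open>\<W>\<close>.\<close>
        ultimately have "w \<in> span (\<Union>\<W>)" using wy(1) span_diff[of x _ y] by simp
        then have "w = 0" using W0 \<open>w \<in> W\<close> by blast
        then have "x \<in> Z \<inter> span (\<Union>(\<W> - {Z}))" using x wy by simp
        then show ?thesis using \<W> Z\<W> unfolding indep_def by blast
      qed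
      moreover have "0 \<in> Z" using Z\<W> \<W> sub subspace_0 unfolding indep_def by blast
      ultimately show ?thesis unfolding eq using span_zero by blast
    qed
    then have "indep (insert W \<W>)" using \<W> W unfolding indep_def by blast
    then have "insert W \<W> = \<W>" by (intro max) auto
    then show False using \<open>W \<notin> \<W>\<close> by blast
  qed
  then have "span (\<Union>\<W>) = span (\<Union>I)"
    using \<W> unfolding indep_def span_eq by (meson Sup_least Union_mono order_trans span_superset)
  then show ?thesis using \<W> unfolding indep_def by (intro that[of \<W>]) auto
qed

end


section \<open>Currents of sl and the singular vectors of conformal weight 2\<close>

text \<open>\<open>V\<close> is a level \<open>k\<close> module of the affine algebra realized as a
  subspace, and \<open>a i j n\<close> is a mode of the matrix unit projected to trace zero. The
  projection is invisible in the brackets but leaves \<open>1 / of_nat N\<close> in the invariant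
  form.\<close>

locale loop_rep = complex_space scale
  for scale :: "complex \<Rightarrow> 'v::ab_group_add \<Rightarrow> 'v"  (infixr \<open>*c\<close> 75) +
  fixes V :: "'v set" and N :: nat and k :: complex
    and a :: "nat \<Rightarrow> nat \<Rightarrow> int \<Rightarrow> 'v \<Rightarrow> 'v"
  assumes subspace_V: "subspace V"
    and endo_a: "endo (a i j n)"
    and a_V: "a i j n v \<in> V"
    and trace_a: "(\<Sum>i<N. a i i n v) = 0"
    and a_comm: "\<lbrakk>i < N; j < N; p < N; q < N; v \<in> V\<rbrakk> \<Longrightarrow>
      a i j m (a p q n v) = a p q n (a i j m v)
        + (if j = p then a i q (m + n) v else 0) - (if q = i then a p j (m + n) v else 0)
        + (if m + n = 0 then of_int m * k *
            ((if j = p \<and> i = q then 1 else 0) - (if i = j \<and> p = q then 1 / of_nat N else 0)) else 0) *c v"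
begin

lemmas a_add = endo_add[OF endo_a] and a_scale = endo_scale[OF endo_a] and a_sum = endo_sum[OF endo_a]
  and a_diff = endo_diff[OF endo_a] and a_zero = endo_zero[OF endo_a] and a_neg = endo_neg[OF endo_a]

definition stable :: "'v set \<Rightarrow> bool"
  where "stable W \<longleftrightarrow> subspace W \<and> W \<subseteq> V \<and> (\<forall>i<N. \<forall>j<N. \<forall>n. \<forall>w\<in>W. a i j n w \<in> W)"

lemma stable_zero: "stable {0}"
  using subspace_V by (simp add: stable_def a_zero subspace_0)

lemma stable_span_Union:
  assumes "\<And>W. W \<in> \<W> \<Longrightarrow> stable W"
  shows "stable (span (\<Union>\<W>))"
  unfolding stable_def
proof (intro conjI allI impI ballI)
  show "span (\<Union>\<W>) \<subseteq> V"
    by (rule span_minimal) (use assms subspace_V in \<open>auto simp: stable_def\<close>)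
  fix i j n w assume "i < N" "j < N" and w: "w \<in> span (\<Union>\<W>)"
  have "a i j n v \<in> span (\<Union>\<W>)" if v: "v \<in> \<Union>\<W>" for v
  proof -
    obtain W where W: "W \<in> \<W>" "v \<in> W" using v by blast
    then have "a i j n v \<in> W" using assms[OF W(1)] \<open>i < N\<close> \<open>j < N\<close> by (simp add: stable_def)
    then show ?thesis using W(1) by (intro span_base) blast
  qed
  then show "a i j n w \<in> span (\<Union>\<W>)"
    by (rule endo_span[OF endo_a _ _ w]) auto
qed simp

text \<open>The span of all words in modes from \<open>I\<close> applied to \<open>R\<close>. It is
  used with \<open>I\<close> the lowering modes.\<close>

definition closure_under :: "(nat \<times> nat \<times> int) set \<Rightarrow> 'v set \<Rightarrow> 'v set"
  where "closure_under I R =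
    \<Inter>{W. subspace W \<and> R \<subseteq> W \<and> (\<forall>(i, j, n)\<in>I. \<forall>w\<in>W. a i j n w \<in> W)}"

lemma subspace_closure_under: "subspace (closure_under I R)"
  unfolding closure_under_def by (rule subspace_Inter) auto

lemma closure_under_base: "R \<subseteq> closure_under I R"
  unfolding closure_under_def by auto

lemma closure_under_step: "(i, j, n) \<in> I \<Longrightarrow> v \<in> closure_under I R \<Longrightarrow> a i j n v \<in> closure_under I R"
  unfolding closure_under_def by fast

lemma closure_under_minimal:
  assumes "subspace W" "R \<subseteq> W" "\<And>i j n w. (i, j, n) \<in> I \<Longrightarrow> w \<in> W \<Longrightarrow> a i j n w \<in> W"
  shows "closure_under I R \<subseteq> W"
  unfolding closure_under_def using assms by auto

text \<open>The part of the Poincare-Birkhoff-Witt theorem that is needed: operators outside \<open>I\<close> that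
  preserve the generators can be commuted to the right through words in \<open>I\<close>.\<close>

lemma stable_closure_under:
  assumes R: "R \<subseteq> V"
    and P: "\<And>i j n r. i < N \<Longrightarrow> j < N \<Longrightarrow> (i, j, n) \<notin> I \<Longrightarrow> r \<in> R \<Longrightarrow> a i j n r \<in> closure_under I R"
    and I: "\<And>i j n. (i, j, n) \<in> I \<Longrightarrow> i < N \<and> j < N"
  shows "stable (closure_under I R)"
proof -
  let ?U = "closure_under I R"
  \<comment> \<open>The invariant carried through the words: every mode, not just those in
    \<open>I\<close>, keeps the vector in \<open>?U\<close>. The commutation relation then
    reproduces it for one more letter.\<close>
  let ?W = "{v \<in> ?U \<inter> V. \<forall>i<N. \<forall>j<N. \<forall>n. a i j n v \<in> ?U}"
  have "?U \<subseteq> ?W"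
  proof (rule closure_under_minimal)
    show "subspace ?W"
      using subspace_V subspace_closure_under[of I R]
      by (auto simp: subspace_def a_zero a_add a_scale)
    show "R \<subseteq> ?W"
    proof
      fix r assume r: "r \<in> R"
      have rU: "r \<in> ?U" using closure_under_base r by (rule subsetD)
      have "a i j n r \<in> ?U" if "i < N" "j < N" for i j n
        using closure_under_step[OF _ rU, of i j n] P[OF that _ r, of n] by (cases "(i, j, n) \<in> I") auto
      then show "r \<in> ?W" using rU r R by blast
    qed
  next
    fix p q n w assume I': "(p, q, n) \<in> I" and w: "w \<in> ?W"
    have pq: "p < N" "q < N" using I[OF I'] by auto
    have "a i j m (a p q n w) \<in> ?U" if "i < N" "j < N" for i j m
    proof -
      note S = subspace_closure_under[of I R]
      have U: "a x y z w \<in> ?U" if "x < N" "y < N" for x y z using w that by simp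
      have "a p q n (a i j m w) \<in> ?U" by (rule closure_under_step[OF I' U[OF that]])
      moreover have "(if j = p then a i q (m + n) w else 0) \<in> ?U" "(if q = i then a p j (m + n) w else 0) \<in> ?U"
        using U that pq subspace_0[OF subspace_closure_under] by simp_all
      moreover have "w \<in> ?U" "w \<in> V" using w by simp_all
      ultimately show ?thesis
        by (subst a_comm[OF that pq \<open>w \<in> V\<close>])
          (rule subspace_add[OF S subspace_diff[OF S subspace_add[OF S]] subspace_scale[OF S]])
    qed
    then show "a p q n w \<in> ?W"
      using closure_under_step[OF I'] w a_V by auto
  qed
  then show ?thesis using subspace_closure_under by (auto simp: stable_def)
qed

end

locale vacuum_rep = loop_rep scale V N k a
  for scale :: "complex \<Rightarrow> 'v::ab_group_add \<Rightarrow> 'v"  (infixr \<open>*c\<close> 75) and V N k a +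
  fixes vac :: 'v
  assumes vac_V: "vac \<in> V"
    and a_vac: "\<lbrakk>i < N; j < N; 0 \<le> n\<rbrakk> \<Longrightarrow> a i j n vac = 0"
    and level: "k = - (of_nat N / 2)"
    and N_pos: "0 < N"
begin

lemma a_a_vac:
  assumes "p < N" "q < N" "i < N" "j < N" "0 \<le> n"
  shows "a p q n (a i j m vac) =
    (if q = i then a p j (n + m) vac else 0) - (if j = p then a i q (n + m) vac else 0)
    + (if n + m = 0 then of_int n * k *
        ((if q = i \<and> p = j then 1 else 0) - (if p = q \<and> i = j then 1 / of_nat N else 0)) else 0) *c vac"
  using assms by (simp add: a_comm vac_V a_vac a_zero)

text \<open>An entry of the square of the matrix of currents, in one fixed order. Exchanging the two
  factors changes it by \<open>N\<close> times \<open>a i j (- 2) vac\<close>, so the symmetrized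
  square differs by half of that.\<close>

definition s :: "nat \<Rightarrow> nat \<Rightarrow> 'v"
  where "s i j = (\<Sum>m<N. a i m (- 1) (a m j (- 1) vac))"

text \<open>Here the mode is commuted past the left factor, and the inner sum is evaluated
  separately for each \<open>n\<close>. A central term arises at this stage only for
  \<open>n = 1\<close>, the mode paired with \<open>- 1\<close>.\<close>

lemma a_s:
  assumes "p < N" "q < N" "i < N" "j < N" "0 \<le> n"
  shows "a p q n (s i j) = (\<Sum>m<N. a i m (- 1) (a p q n (a m j (- 1) vac)))
    + (if q = i then \<Sum>m<N. a p m (n - 1) (a m j (- 1) vac) else 0)
    - a i q (n - 1) (a p j (- 1) vac)
    + (if n = 1 then (if q = i then k *c a p j (- 1) vac else 0)
        - (if p = q then (k / of_nat N) *c a i j (- 1) vac else 0) else 0)"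
proof -
  have term_eq: "a p q n (a i m (- 1) w) = a i m (- 1) (a p q n w)
    + (if q = i then a p m (n - 1) w else 0)
    - (if m = p then a i q (n - 1) w else 0)
    + (if n = 1 then (if m = p then if q = i then k *c w else 0 else 0)
        - (if m = i then if p = q then (k / of_nat N) *c w else 0 else 0) else 0)"
    if "m < N" "w \<in> V" for m w
    using a_comm[OF assms(1-3) that, of n "- 1"]
    by (cases "m = p"; cases "m = i"; cases "q = i"; cases "n = 1") (simp_all add: scale_left_diff_distrib right_diff_distrib)
  have "a p q n (s i j) = (\<Sum>m<N. a i m (- 1) (a p q n (a m j (- 1) vac))
    + (if q = i then a p m (n - 1) (a m j (- 1) vac) else 0)
    - (if m = p then a i q (n - 1) (a m j (- 1) vac) else 0)
    + (if n = 1 then (if m = p then if q = i then k *c a m j (- 1) vac else 0 else 0)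
        - (if m = i then if p = q then (k / of_nat N) *c a m j (- 1) vac else 0 else 0) else 0))"
    unfolding s_def a_sum by (rule sum.cong[OF refl]) (simp only: term_eq a_V lessThan_iff)
  then show ?thesis
    using assms by (cases "n = 1"; cases "q = i") (simp_all add: sum.distrib sum_subtractf)
qed

text \<open>Zero modes act on \<open>s\<close> as on a matrix under the adjoint action: the terms at
  the contracted index \<open>m\<close> cancel between the two factors.\<close>

lemma a0_s:
  assumes "p < N" "q < N" "i < N" "j < N"
  shows "a p q 0 (s i j) = (if q = i then s p j else 0) - (if j = p then s i q else 0)"
proof -
  have "(\<Sum>m<N. a i m (- 1) (a p q 0 (a m j (- 1) vac))) =
    (\<Sum>m<N. (if m = q then a i m (- 1) (a p j (- 1) vac) else 0)
      - (if j = p then a i m (- 1) (a m q (- 1) vac) else 0))"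
    by (rule sum.cong) (use assms in \<open>auto simp: a_a_vac a_diff a_zero\<close>)
  also have "\<dots> = a i q (- 1) (a p j (- 1) vac) - (if j = p then s i q else 0)"
    using assms by (cases "j = p") (simp_all add: sum_subtractf s_def)
  finally have 1: "(\<Sum>m<N. a i m (- 1) (a p q 0 (a m j (- 1) vac))) = \<dots>" .
  show ?thesis unfolding a_s[OF assms order_refl] 1 by (simp add: s_def)
qed

text \<open>The coefficient \<open>N\<close> comes from carrying the zero mode through the sum over
  \<open>m\<close>, each \<open>k\<close> from a central term, and \<open>2 * k / N\<close> from the
  trace corrections of both factors; the remaining terms come from \<open>a i q 0\<close> acting on
  \<open>a p j (- 1) vac\<close>.\<close>

lemma a1_s:
  assumes "p < N" "q < N" "i < N" "j < N"
  shows "a p q 1 (s i j) = (if q = i then (of_nat N + k) *c a p j (- 1) vac else 0)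
    + (if j = p then k *c a i q (- 1) vac else 0)
    - (if p = q then (1 + 2 * k / of_nat N) *c a i j (- 1) vac else 0)
    + (if i = j then a p q (- 1) vac else 0)"
proof -
  have "(\<Sum>m<N. a i m (- 1) (a p q 1 (a m j (- 1) vac))) =
    (\<Sum>m<N. (if m = q then if j = p then k *c a i m (- 1) vac else 0 else 0)
      - (if m = j then if p = q then (k / of_nat N) *c a i m (- 1) vac else 0 else 0))"
    by (rule sum.cong)
      (use assms in \<open>auto simp: a_a_vac a_vac a_scale a_zero a_diff a_neg right_diff_distrib scale_left_diff_distrib\<close>)
  also have "\<dots> = (if j = p then k *c a i q (- 1) vac else 0)
      - (if p = q then (k / of_nat N) *c a i j (- 1) vac else 0)"
    using assms by (simp add: sum_subtractf)
  finally have 1: "(\<Sum>m<N. a i m (- 1) (a p q 1 (a m j (- 1) vac))) = \<dots>" .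
  have "(\<Sum>m<N. a p m 0 (a m j (- 1) vac)) =
    (\<Sum>m<N. a p j (- 1) vac - (if j = p then a m m (- 1) vac else 0))"
    by (rule sum.cong) (use assms in \<open>auto simp: a_a_vac\<close>)
  \<comment> \<open>The \<open>N\<close> equal summands remain because the diagonal currents add up
    to zero.\<close>
  also have "\<dots> = of_nat N *c a p j (- 1) vac"
    using trace_a[of "- 1" vac] by (cases "j = p") (simp_all add: sum_subtractf sum_constant_scale)
  finally have 2: "(\<Sum>m<N. a p m 0 (a m j (- 1) vac)) = \<dots>" .
  have 3: "a i q 0 (a p j (- 1) vac)
      = (if p = q then a i j (- 1) vac else 0) - (if i = j then a p q (- 1) vac else 0)"
    using assms by (auto simp: a_a_vac)
  have 4: "(1 + 2 * k / of_nat N) *c w = w + (k / of_nat N) *c w + (k / of_nat N) *c w" for w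
  proof -
    have "1 + 2 * k / of_nat N = 1 + k / of_nat N + k / of_nat N" by simp
    then show ?thesis by (simp only: scale_left_distrib scale_one)
  qed
  have 5: "(of_nat N + k) *c w = of_nat N *c w + k *c w" for w
    by (rule scale_left_distrib)
  show ?thesis
    unfolding a_s[OF assms zero_le_one] 1 4 5 by (simp add: 2 3)
qed

lemma a2_s:
  assumes "p < N" "q < N" "i < N" "j < N"
  shows "a p q 2 (s i j) = (if q = i \<and> j = p then (k * of_nat N) *c vac else 0)
    - (if p = q \<and> i = j then k *c vac else 0)"
proof -
  have 1: "(\<Sum>m<N. a i m (- 1) (a p q 2 (a m j (- 1) vac))) = 0"
    by (rule sum.neutral) (use assms in \<open>auto simp: a_a_vac a_vac a_zero\<close>)
  have "(\<Sum>m<N. a p m 1 (a m j (- 1) vac)) =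
    (\<Sum>m<N. (if j = p then k *c vac else 0)
      - (if m = p then if j = p then (k / of_nat N) *c vac else 0 else 0))"
    by (rule sum.cong)
      (use assms in \<open>auto simp: a_a_vac a_vac right_diff_distrib scale_left_diff_distrib\<close>)
  also have "\<dots> = (if j = p then (k * of_nat N) *c vac - (k / of_nat N) *c vac else 0)"
    using assms by (simp add: sum_subtractf sum_constant_scale mult.commute)
  finally have 2: "(\<Sum>m<N. a p m 1 (a m j (- 1) vac)) = \<dots>" .
  have one: "2 - 1 = (1::int)" by simp
  have 3: "a i q 1 (a p j (- 1) vac) = (if p = q \<and> i = j then k *c vac else 0)
      - (if q = i \<and> j = p then (k / of_nat N) *c vac else 0)"
    unfolding a_a_vac[OF assms(3,2,1,4) zero_le_one]
    by (cases "q = p"; cases "q = i"; cases "j = i"; cases "j = p")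
      (simp_all add: a_vac assms right_diff_distrib scale_left_diff_distrib)
  show ?thesis
    unfolding a_s[OF assms zero_le_numeral] 1 one 2 3 by simp
qed

lemma a3_s:
  assumes "p < N" "q < N" "i < N" "j < N" "3 \<le> n"
  shows "a p q n (s i j) = 0"
proof -
  have "0 \<le> n" using assms by simp
  have 1: "a x y u (a z w (- 1) vac) = 0" if "x < N" "y < N" "z < N" "w < N" "2 \<le> u" for x y z w u
    using that by (auto simp: a_a_vac a_vac)
  show ?thesis
    unfolding a_s[OF assms(1-4) \<open>0 \<le> n\<close>]
    using assms by (simp add: 1 a_zero)
qed

definition \<omega> :: 'v
  where "\<omega> = (1 / of_nat N) *c (\<Sum>i<N. s i i)"

lemma a0_\<omega>: "p < N \<Longrightarrow> q < N \<Longrightarrow> a p q 0 \<omega> = 0"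
  by (simp add: \<omega>_def a_scale a_sum a0_s sum_subtractf)

text \<open>Through the commutator formula, this and the two neighbouring lemmas say that the
  currents have conformal weight 1; see \<open>primary_commutator\<close>.\<close>

lemma a1_\<omega>:
  assumes "p < N" "q < N"
  shows "a p q 1 \<omega> = a p q (- 1) vac"
proof -
  have "(\<Sum>i<N. a p q 1 (s i i)) = (\<Sum>i<N. (if i = q then (of_nat N + k) *c a p i (- 1) vac else 0)
    + (if i = p then k *c a i q (- 1) vac else 0)
    - (if p = q then (1 + 2 * k / of_nat N) *c a i i (- 1) vac else 0)
    + a p q (- 1) vac)"
    by (rule sum.cong) (use assms in \<open>auto simp: a1_s\<close>)
  also have "\<dots> = of_nat N *c a p q (- 1) vac + of_nat N *c a p q (- 1) vac
      + k *c a p q (- 1) vac + k *c a p q (- 1) vac"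
    using assms trace_a[of "- 1" vac]
    by (cases "p = q")
      (simp_all add: sum.distrib sum_subtractf sum_constant_scale mult_2 scale_left_distrib ac_simps
        flip: scale_sum_right)
  \<comment> \<open>At level \<open>- N / 2\<close> this factor equals \<open>N\<close>, which the
    normalization of \<open>\<omega>\<close> divides out.\<close>
  also have "\<dots> = (of_nat N + of_nat N + k + k) *c a p q (- 1) vac"
    by (simp only: scale_left_distrib)
  finally show ?thesis
    using N_pos by (simp add: \<omega>_def a_scale a_sum level)
qed

lemma a2_\<omega>:
  assumes "p < N" "q < N" "2 \<le> n"
  shows "a p q n \<omega> = 0"
proof (cases "n = 2")
  case True
  have "(\<Sum>i<N. a p q 2 (s i i)) = (\<Sum>i<N. (if i = q then (if p = q then (k * of_nat N) *c vac else 0) else 0)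
      - (if p = q then k *c vac else 0))"
    by (rule sum.cong) (use assms in \<open>auto simp: a2_s algebra_simps\<close>)
  also have "\<dots> = 0"
    using assms by (simp add: sum.distrib sum_subtractf sum_constant_scale algebra_simps)
  finally show ?thesis using True by (simp add: \<omega>_def a_scale a_sum)
next
  case False
  then show ?thesis using assms by (simp add: \<omega>_def a_scale a_sum a3_s)
qed

text \<open>Symmetrizing the square \<open>s\<close> of the matrix of currents subtracts \<open>(N/2) a i j (-2) \<one>\<close>; the
  conformal vector \<open>\<omega>\<close> is its trace part. The level \<open>-N/2\<close> is exactly the one at which the
  traceless part is killed by all positive modes.\<close>

definition b :: "nat \<Rightarrow> nat \<Rightarrow> 'v"
  where "b i j = s i j - (of_nat N / 2) *c a i j (- 2) vac - (if i = j then \<omega> else 0)"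

lemma a0_b:
  assumes "p < N" "q < N" "i < N" "j < N"
  shows "a p q 0 (b i j) = (if q = i then b p j else 0) - (if j = p then b i q else 0)"
  using assms
  by (auto simp: b_def a_diff a_add a_scale a0_s a_a_vac a0_\<omega> a_zero algebra_simps)

text \<open>In \<open>a1_s\<close> the level turns \<open>N + k\<close> into \<open>N / 2\<close>
  and \<open>k\<close> into \<open>- N / 2\<close>, which is what the mode of
  \<open>a i j (- 2) vac\<close> produces; it turns \<open>1 + 2 * k / N\<close> into zero and
  leaves the diagonal term for \<open>\<omega>\<close> to cancel.\<close>

lemma a_b:
  assumes "p < N" "q < N" "i < N" "j < N" "1 \<le> n"
  shows "a p q n (b i j) = 0"
proof -
  consider "n = 1" | "n = 2" | "n \<ge> 3" using assms by linarith
  then show ?thesis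
  proof cases
    case 1
    then show ?thesis using assms N_pos
      by (auto simp: b_def a_diff a_add a_scale a1_s a_a_vac a1_\<omega> a_zero level algebra_simps)
  next
    case 2
    \<comment> \<open>The central term of the modes \<open>2\<close> and \<open>- 2\<close> carries
      a factor 2, which cancels the one half in \<open>b\<close>.\<close>
    have "(of_nat N / 2) *c a p q 2 (a i j (- 2) vac) = (if q = i \<and> j = p then (k * of_nat N) *c vac else 0)
      - (if p = q \<and> i = j then k *c vac else 0)"
      using N_pos unfolding a_a_vac[OF assms(1-4) zero_le_numeral]
      by (cases "q = i"; cases "j = p"; cases "p = q"; cases "i = j")
        (simp_all add: a_vac assms right_diff_distrib scale_left_diff_distrib scale_right_diff_distrib mult.commute)
    then show ?thesis
      unfolding 2 b_def a_diff a_scale a2_s[OF assms(1-4)] by (simp add: a2_\<omega> assms a_zero)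
  next
    case 3
    then show ?thesis using assms
      by (auto simp: b_def a_diff a_add a_scale a3_s a_a_vac a2_\<omega> a_zero a_vac)
  qed
qed

lemma s_V: "s i j \<in> V"
  unfolding s_def by (intro subspace_sum subspace_V a_V)

lemma \<omega>_V: "\<omega> \<in> V"
  unfolding \<omega>_def by (intro subspace_sum subspace_scale subspace_V s_V)

lemma b_V: "b i j \<in> V"
  unfolding b_def using subspace_V
  by (auto intro!: subspace_diff subspace_scale s_V \<omega>_V a_V intro: subspace_0)

end


section \<open>The greatest proper submodule; admissible weights\<close>

text \<open>\<open>D\<close> is L(0), known through its value on the vacuum, its commutators with
  the currents, and the fact that it preserves stable subspaces. This separates the vacuum line from
  the vectors of positive conformal weight.\<close>

locale conformal_vacuum_rep = vacuum_rep scale V N k a vac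
  for scale :: "complex \<Rightarrow> 'v::ab_group_add \<Rightarrow> 'v"  (infixr \<open>*c\<close> 75) and V N k a vac +
  fixes D :: "'v \<Rightarrow> 'v"
  assumes endo_D: "endo D"
    and D_vac: "D vac = 0"
    and D_a: "\<lbrakk>i < N; j < N; v \<in> V\<rbrakk> \<Longrightarrow> D (a i j n v) = a i j n (D v) - of_int n *c a i j n v"
    and D_stable: "\<lbrakk>stable W; w \<in> W\<rbrakk> \<Longrightarrow> D w \<in> W"
    and generated: "\<lbrakk>stable W; vac \<in> W\<rbrakk> \<Longrightarrow> W = V"
    and vac_nonzero: "vac \<noteq> 0"
begin

definition positive :: "'v set"
  where "positive = span {v \<in> V. \<exists>n::nat. 1 \<le> n \<and> D v = of_nat n *c v}"

lemma positive_V: "positive \<subseteq> V"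
  unfolding positive_def by (rule span_minimal) (auto simp: subspace_V)

lemma subspace_positive: "subspace positive"
  by (simp add: positive_def)

lemma D_lower:
  assumes "i < N" "j < N" "n < 0" "v \<in> V" "D v = of_nat d *c v"
  shows "a i j n v \<in> positive"
proof -
  have "D (a i j n v) = (of_nat d - of_int n) *c a i j n v"
    using assms by (simp add: D_a a_scale scale_left_diff_distrib)
  also have "(of_nat d - of_int n :: complex) = of_nat (d + nat (- n))"
    using assms(3) by simp
  finally show ?thesis unfolding positive_def
    using assms(3) a_V by (intro span_base) (auto intro!: exI[of _ "d + nat (- n)"])
qed

lemma lower_positive:
  assumes "i < N" "j < N" "n < 0" "v \<in> positive"
  shows "a i j n v \<in> positive"
  by (rule endo_span[OF endo_a _ subspace_positive assms(4)[unfolded positive_def]])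
    (use assms D_lower in blast)

abbreviation lowering :: "(nat \<times> nat \<times> int) set"
  where "lowering \<equiv> {(i, j, n). i < N \<and> j < N \<and> n < 0}"

text \<open>Words in negative modes applied to the vacuum span \<open>V\<close>, and a nonempty word
  has positive conformal weight.\<close>

lemma V_vac_positive:
  assumes "v \<in> V"
  obtains c u where "v = c *c vac + u" "u \<in> positive"
proof -
  let ?K = "closure_under lowering {vac}" and ?W = "{c *c vac + u | c u. u \<in> positive}"
  have "stable ?K"
    using a_vac vac_V subspace_0[OF subspace_closure_under] by (intro stable_closure_under) auto
  then have "?K = V" using closure_under_base by (intro generated) auto
  moreover have "?K \<subseteq> ?W"
  proof (rule closure_under_minimal)
    have "?W = {x + y | x y. x \<in> span {vac} \<and> y \<in> positive}"
      by (auto simp: span_singleton)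
    then show "subspace ?W" by (simp add: subspace_sums subspace_positive)
    have "vac = 1 *c vac + 0" by simp
    then show "{vac} \<subseteq> ?W" using subspace_0[OF subspace_positive] by blast
  next
    fix i j n w assume ijn: "(i, j, n) \<in> lowering" and "w \<in> ?W"
    then obtain c u where w: "w = c *c vac + u" "u \<in> positive" by blast
    have "a i j n w = 0 *c vac + (c *c a i j n vac + a i j n u)"
      by (simp add: w a_add a_scale)
    moreover have "c *c a i j n vac + a i j n u \<in> positive"
      using ijn w(2) D_vac vac_V D_lower[of i j n vac 0] lower_positive
      by (auto intro!: subspace_add subspace_scale subspace_positive)
    ultimately show "a i j n w \<in> ?W" by blast
  qed
  ultimately show ?thesis using assms that by blast
qed

lemma positive_sub: "positive \<subseteq> span (\<Union>\<mu>\<in>{\<lambda>_::unit. of_nat n | n::nat. 1 \<le> n}. eigen (\<lambda>_. D) \<mu>)"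
  unfolding positive_def by (rule span_mono) (auto simp: eigen_def)

lemma vac_not_positive: "vac \<notin> positive"
proof
  assume "vac \<in> positive"
  then have "vac \<in> span (\<Union>\<mu>\<in>{\<lambda>_::unit. of_nat n | n::nat. 1 \<le> n}. eigen (\<lambda>_. D) \<mu>)"
    using positive_sub by blast
  moreover have "vac \<in> eigen (\<lambda>_::unit. D) (\<lambda>_. 0)" by (simp add: eigen_def D_vac)
  moreover have "(\<lambda>_::unit. 0::complex) \<notin> {\<lambda>_::unit. of_nat n | n::nat. 1 \<le> n}"
    by (auto simp: fun_eq_iff)
  ultimately have "vac = 0" by (intro eigen_Int_span[OF endo_D]) auto
  then show False using vac_nonzero by simp
qed

text \<open>Being stable under L(0), \<open>W\<close> contains the conformal weight zero component
  of each of its elements, and that component is a multiple of the vacuum.\<close>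

lemma proper_positive:
  assumes W: "stable W" and "vac \<notin> W"
  shows "W \<subseteq> positive"
proof
  fix w assume w: "w \<in> W"
  then have "w \<in> V" using W by (auto simp: stable_def)
  then obtain c u where cu: "w = c *c vac + u" "u \<in> positive" by (rule V_vac_positive)
  let ?I = "{\<lambda>_::unit. of_nat n | n::nat. 1 \<le> n}"
  have "u \<in> span (\<Union>\<mu>\<in>?I. eigen (\<lambda>_. D) \<mu>)" using cu positive_sub by blast
  then obtain F x where F: "finite F" "F \<subseteq> ?I" "\<And>\<nu>. \<nu> \<in> F \<Longrightarrow> x \<nu> \<in> eigen (\<lambda>_. D) \<nu>" "u = sum x F"
    by (rule span_Union_sum[OF subspace_eigen[OF endo_D]]) (rule that)
  let ?z = "\<lambda>_::unit. 0::complex"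
  have zF: "?z \<notin> F" using F(2) by (auto simp: fun_eq_iff)
  \<comment> \<open>The vacuum part joins the family as the eigenvector of eigenvalue zero, a value
    absent from \<open>F\<close>.\<close>
  let ?x = "x(?z := c *c vac)"
  have "sum ?x F = sum x F" using zF by (intro sum.cong) auto
  then have s: "sum ?x (insert ?z F) \<in> W" using F(1,4) zF w cu by simp
  have ev: "?x \<mu> \<in> eigen (\<lambda>_. D) \<mu>" if "\<mu> \<in> insert ?z F" for \<mu>
    using that F(3) by (auto simp: eigen_def endo_scale[OF endo_D] D_vac)
  have "?x ?z \<in> W"
    by (rule eigen_components[of "\<lambda>_. D" W "insert ?z F" ?x ?z, OF endo_D _ _ _ ev s])
      (use F(1) W D_stable in \<open>simp_all add: stable_def del: fun_upd_apply\<close>)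
  then have "c *c vac \<in> W" by simp
  then have "inverse c *c c *c vac \<in> W"
    using W by (rule_tac subspace_scale) (auto simp: stable_def)
  then have "c = 0" using assms(2) by (cases "c = 0") simp_all
  then show "w \<in> positive" using cu by simp
qed

lemma D_b:
  assumes "i < N" "j < N"
  shows "D (b i j) = 2 *c b i j"
proof -
  have two: "w + w = 2 *c w" for w
    using scale_left_distrib[of 1 1 w] by simp
  have D_s: "D (s i j) = 2 *c s i j" if "i < N" "j < N" for i j
    unfolding s_def endo_sum[OF endo_D] scale_sum_right
    by (rule sum.cong)
      (use that vac_V a_V in \<open>auto simp: D_a D_vac a_zero a_add a_diff a_scale two\<close>)
  have "D \<omega> = 2 *c \<omega>"
    by (simp add: \<omega>_def endo_sum[OF endo_D] endo_scale[OF endo_D] D_s scale_sum_right mult.commute)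
  then show ?thesis
    using assms vac_V
    by (simp add: b_def endo_diff[OF endo_D] endo_scale[OF endo_D] D_s D_a D_vac a_zero endo_zero[OF endo_D]
        scale_right_diff_distrib mult.commute)
qed

text \<open>Proper stable subspaces have only positive conformal weights, so their sum does too and
  still misses the vacuum. The vectors \<open>b i j\<close> generate such a subspace because
  nonnegative modes map their span into itself.\<close>

theorem greatest_proper_stable:
  obtains J where "stable J" "vac \<notin> J" "\<And>W. stable W \<Longrightarrow> vac \<notin> W \<Longrightarrow> W \<subseteq> J"
    "\<And>i j. i < N \<Longrightarrow> j < N \<Longrightarrow> b i j \<in> J"
proof -
  let ?P = "{W. stable W \<and> vac \<notin> W}"
  let ?J = "span (\<Union>?P)"
  have J: "stable ?J" by (rule stable_span_Union) auto
  have "?J \<subseteq> positive"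
    by (rule span_minimal) (use proper_positive subspace_positive in auto)
  then have v: "vac \<notin> ?J" using vac_not_positive by blast
  have max: "W \<subseteq> ?J" if "stable W" "vac \<notin> W" for W
    using that by (auto intro: span_base)
  let ?R = "span {b i j | i j. i < N \<and> j < N}"
  let ?S = "closure_under lowering ?R"
  have b_pos: "b i j \<in> positive" if "i < N" "j < N" for i j
    unfolding positive_def using that D_b[OF that] b_V
    by (intro span_base) (auto intro!: exI[of _ "2::nat"])
  have R_pos: "?R \<subseteq> positive"
    by (rule span_minimal) (use b_pos subspace_positive in auto)
  have "a p q n r \<in> ?R" if pq: "p < N" "q < N" "0 \<le> n" and r: "r \<in> ?R" for p q n r
  proof (rule endo_span[OF endo_a _ _ r])
    fix v assume "v \<in> {b i j | i j. i < N \<and> j < N}"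
    then obtain i j where ij: "v = b i j" "i < N" "j < N" by blast
    show "a p q n v \<in> ?R"
    proof (cases "n = 0")
      case True
      have "b p j \<in> ?R" "b i q \<in> ?R" using pq ij by (auto intro: span_base)
      then show ?thesis using True pq ij a0_b by (auto intro: span_diff span_zero span_neg)
    next
      case False
      then show ?thesis using pq ij a_b span_zero by auto
    qed
  qed simp
  then have "stable ?S"
    using R_pos positive_V closure_under_base[of ?R lowering]
    by (intro stable_closure_under) (auto simp: not_less)
  moreover have "?S \<subseteq> positive"
    by (rule closure_under_minimal) (use R_pos subspace_positive lower_positive in auto)
  ultimately have SJ: "?S \<subseteq> ?J" using max[of ?S] vac_not_positive by blast
  have "b i j \<in> ?J" if "i < N" "j < N" for i j
  proof -
    have "b i j \<in> ?R" by (rule span_base) (use that in blast)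
    then show ?thesis using closure_under_base SJ by blast
  qed
  then show ?thesis by (intro that[of ?J] J v max)
qed

end

section \<open>Arithmetic of highest weights\<close>

lemma odd_sum_odd:
  fixes z :: "nat \<Rightarrow> int"
  assumes "odd n" and "\<And>i. i < n \<Longrightarrow> odd (z i)"
  shows "odd (\<Sum>i<n. z i)"
proof -
  have "{i \<in> {..<n}. odd (z i)} = {..<n}" using assms(2) by auto
  then show ?thesis using assms(1) by (simp add: even_sum_iff)
qed

text \<open>Entries \<open>0\<close> to \<open>N - 1\<close> stand for the eigenvalues of the
  diagonal zero modes and entry \<open>N\<close> for the conformal weight. The equations are
  obtained for highest weights in \<open>singular_admissible\<close>.\<close>

definition admissible :: "nat \<Rightarrow> (nat \<Rightarrow> complex) \<Rightarrow> bool"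
  where "admissible N f \<longleftrightarrow> (\<Sum>i<N. f i) = 0 \<and>
    (\<forall>i<N. (f i)\<^sup>2 + (\<Sum>m<i. f m - f i) + of_nat N / 2 * f i = f N)"

text \<open>Subtract the equations for \<open>i\<close> and \<open>Suc i\<close>: they share the
  partial sum over \<open>m < i\<close>, the number of its terms produces \<open>Suc i\<close>, and
  the difference factors.\<close>

lemma admissible_step:
  assumes "admissible N f" "Suc i < N"
  shows "f i = f (Suc i) \<or> f i + f (Suc i) = of_nat (Suc i) - of_nat N / 2"
proof -
  have "(f i)\<^sup>2 + (\<Sum>m<i. f m - f i) + of_nat N / 2 * f i
      = (f (Suc i))\<^sup>2 + (\<Sum>m<Suc i. f m - f (Suc i)) + of_nat N / 2 * f (Suc i)"
    using assms unfolding admissible_def by (metis Suc_lessD)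
  note eqn = this
  define c where "c = (of_nat N / 2 :: complex)"
  have "(f i - f (Suc i)) * (f i + f (Suc i) - (of_nat (Suc i) - c)) = 0"
    using eqn[folded c_def]
    by (simp add: sum_subtractf power2_eq_square algebra_simps)
  then show ?thesis unfolding c_def by auto
qed

text \<open>Adding the two recursions with an integral difference would make every \<open>4 g i\<close> an odd
  integer, which is impossible because an odd number of them sums to zero.\<close>

lemma admissible_same_type:
  assumes N: "odd N" and g: "admissible N g" and i: "Suc i < N"
    and int: "f i - g i \<in> \<int>" "f (Suc i) - g (Suc i) \<in> \<int>"
    and f: "f i = f (Suc i)"
    and gi: "g i + g (Suc i) = of_nat (Suc i) - of_nat N / 2"
  shows False
proof -
  define P where "P j \<longleftrightarrow> (\<exists>z. odd z \<and> 4 * g j = of_int z)" for j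
  \<comment> \<open>Either \<open>g\<close> repeats, or \<open>4 * g j\<close> and
    \<open>4 * g (Suc j)\<close> add up to an even integer.\<close>
  have step: "P (Suc j) \<longleftrightarrow> P j" if "Suc j < N" for j
    using admissible_step[OF g that]
  proof
    assume "g j + g (Suc j) = of_nat (Suc j) - of_nat N / 2"
    then have "4 * g j + 4 * g (Suc j) = 4 * (of_nat (Suc j) - of_nat N / 2)"
      by (simp only: distrib_left[symmetric])
    also have "\<dots> = of_int (4 * int (Suc j) - 2 * int N)" by simp
    finally have eq: "4 * g j + 4 * g (Suc j) = of_int (4 * int (Suc j) - 2 * int N)" .
    from eq have "4 * g (Suc j) = of_int (4 * int (Suc j) - 2 * int N) - 4 * g j"
      and "4 * g j = of_int (4 * int (Suc j) - 2 * int N) - 4 * g (Suc j)"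
      by (simp_all add: algebra_simps)
    moreover have "odd (4 * int (Suc j) - 2 * int N - z)" if "odd z" for z
      using that by simp
    ultimately show ?thesis unfolding P_def by (metis of_int_diff)
  qed (simp add: P_def)
  obtain x y where x: "f i = g i + of_int x" and y: "f (Suc i) = g (Suc i) + of_int y"
    using int by (metis Ints_cases add.commute diff_add_cancel)
  \<comment> \<open>Twice \<open>g i\<close> is the sum of \<open>g i + g (Suc i)\<close>, fixed by
    the second branch, and \<open>g i - g (Suc i)\<close>, an integer because
    \<open>f i = f (Suc i)\<close>.\<close>
  have "4 * g i = of_int (2 * int (Suc i) - int N + 2 * (y - x))"
  proof -
    have "g i - g (Suc i) = of_int y - of_int x"
      using f x y by (simp add: algebra_simps)
    moreover have "2 * g i = (g i + g (Suc i)) + (g i - g (Suc i))" by simp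
    ultimately have "2 * g i = (of_nat (Suc i) - of_nat N / 2) + (of_int y - of_int x)"
      by (simp only: gi)
    then show ?thesis by (simp add: field_simps)
  qed
  moreover have "odd (2 * int (Suc i) - int N + 2 * (y - x))" using N by simp
  ultimately have Pi: "P i" unfolding P_def by blast
  have P0: "P j \<longleftrightarrow> P 0" if "j < N" for j
    using that by (induction j) (auto simp: step)
  from this[OF Suc_lessD[OF i]] Pi have "P 0" by blast
  then have "P j" if "j < N" for j using P0[OF that] by blast
  then have "\<forall>j. \<exists>z. j < N \<longrightarrow> odd z \<and> 4 * g j = of_int z" unfolding P_def by blast
  then obtain z where z: "\<And>j. j < N \<Longrightarrow> odd (z j) \<and> 4 * g j = of_int (z j)" by metis
  have "of_int (\<Sum>j<N. z j) = 4 * (\<Sum>j<N. g j)"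
    using z by (simp add: sum_distrib_left)
  also have "\<dots> = 0" using g by (simp add: admissible_def)
  finally have "(\<Sum>j<N. z j) = 0" by (simp only: of_int_eq_0_iff)
  then show False using odd_sum_odd[OF N, of z] z by simp
qed

lemma diff_swap: "w + x = y + z \<Longrightarrow> x - z = - (w - y)" for w x y z :: complex
proof -
  assume "w + x = y + z"
  then have "(w + x) - (w + z) = (y + z) - (w + z)" by simp
  then show ?thesis by simp
qed

text \<open>By \<open>admissible_same_type\<close> the two weights follow the same branch at each
  index, so their difference \<open>d\<close> is constant up to sign. All its entries are odd
  multiples of \<open>d 0\<close>, there is an odd number of them, and they sum to zero.\<close>

lemma admissible_unique:
  assumes N: "odd N" and f: "admissible N f" and g: "admissible N g"
    and int: "\<And>i. i < N \<Longrightarrow> f i - g i \<in> \<int>" and i: "i \<le> N"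
  shows "f i = g i"
proof -
  define d where "d j = f j - g j" for j
  have step: "d (Suc j) = d j \<or> d (Suc j) = - d j" if j: "Suc j < N" for j
  proof -
    have fi: "f j - g j \<in> \<int>" "f (Suc j) - g (Suc j) \<in> \<int>" using int j by auto
    then have gi: "g j - f j \<in> \<int>" "g (Suc j) - f (Suc j) \<in> \<int>"
      by (metis Ints_minus minus_diff_eq)+
    show ?thesis
      using admissible_step[OF f j] admissible_step[OF g j]
        admissible_same_type[OF N g j fi] admissible_same_type[OF N f j gi]
        diff_swap[of "f j" "f (Suc j)" "g j" "g (Suc j)"]
      unfolding d_def by metis
  qed
  have "\<exists>z. odd z \<and> d j = of_int z * d 0" if "j < N" for j
    using that
  proof (induction j)
    case 0
    show ?case by (rule exI[of _ 1]) simp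
  next
    case (Suc j)
    then obtain z where "odd z" "d j = of_int z * d 0" by auto
    then show ?case using step[OF Suc.prems]
      by (auto intro: exI[of _ z] exI[of _ "- z"])
  qed
  then have "\<forall>j. \<exists>z. j < N \<longrightarrow> odd z \<and> d j = of_int z * d 0" by blast
  then obtain z where z: "\<And>j. j < N \<Longrightarrow> odd (z j) \<and> d j = of_int (z j) * d 0" by metis
  have "of_int (\<Sum>j<N. z j) * d 0 = (\<Sum>j<N. d j)"
    unfolding of_int_sum sum_distrib_right by (rule sum.cong[OF refl]) (metis z lessThan_iff)
  also have "\<dots> = 0" using f g by (simp add: d_def sum_subtractf admissible_def)
  finally have s0: "of_int (\<Sum>j<N. z j) * d 0 = 0" .
  have "odd (\<Sum>j<N. z j)" by (rule odd_sum_odd[OF N]) (use z in blast)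
  then have "(\<Sum>j<N. z j) \<noteq> 0" by auto
  then have d0: "d 0 = 0" using s0 by (simp only: mult_eq_0_iff of_int_eq_0_iff) blast
  have eq: "f j = g j" if "j < N" for j
  proof -
    have "d j = of_int (z j) * d 0" using z[OF that] by blast
    then show ?thesis unfolding d0 by (simp add: d_def)
  qed
  have "0 < N" using N by (cases N) auto
  \<comment> \<open>The equation at index \<open>0\<close>, where the inner sum is empty, recovers
    the conformal weight.\<close>
  have "h N = (h 0)\<^sup>2 + of_nat N / 2 * h 0" if "admissible N h" for h
  proof -
    have "(h 0)\<^sup>2 + (\<Sum>m<0. h m - h 0) + of_nat N / 2 * h 0 = h N"
      using that \<open>0 < N\<close> unfolding admissible_def by blast
    then show ?thesis by simp
  qed
  from this[OF f] this[OF g] have "f N = g N" using eq[OF \<open>0 < N\<close>] by simp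
  then show ?thesis using eq[of i] i by (cases "i = N") simp_all
qed


section \<open>Weight modules with bounded weights\<close>

text \<open>An abstract weak module from category O. \<open>D\<close> is L(0);
  \<open>relation\<close> is required modulo every stable \<open>T\<close>, so that it holds in
  quotients as well; \<open>B\<close> bounds the heights of the weights.\<close>

locale bounded_weight_rep = loop_rep scale V N k a
  for scale :: "complex \<Rightarrow> 'v::ab_group_add \<Rightarrow> 'v"  (infixr \<open>*c\<close> 75) and V N k a +
  fixes D :: "'v \<Rightarrow> 'v" and B :: real
  assumes odd_N: "odd N"
    and endo_D: "endo D"
    and D_a: "\<lbrakk>i < N; j < N; v \<in> V\<rbrakk> \<Longrightarrow> D (a i j n v) = a i j n (D v) - of_int n *c a i j n v"
    and D_stable: "\<lbrakk>stable W; w \<in> W\<rbrakk> \<Longrightarrow> D w \<in> W"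
    and relation: "\<lbrakk>stable T; u \<in> V; \<And>i j n. \<lbrakk>i < N; j < N; 1 \<le> n\<rbrakk> \<Longrightarrow> a i j n u \<in> T; i < N\<rbrakk> \<Longrightarrow>
      (\<Sum>m<N. a m i 0 (a i m 0 u)) + (of_nat N / 2) *c a i i 0 u - D u \<in> T"
    and V_weights: "V \<subseteq> span (V \<inter> (\<Union>\<nu>. eigen (\<lambda>h. if h < N then a h h 0 else D) \<nu>))"
    and weights_bounded: "\<lbrakk>v \<in> V; v \<noteq> 0; v \<in> eigen (\<lambda>h. if h < N then a h h 0 else D) \<nu>\<rbrakk> \<Longrightarrow>
      Re (- (\<Sum>j<N. of_nat j * \<nu> j) - of_nat N * \<nu> N) \<le> B"
begin

text \<open>A weight is stored as \<open>\<nu> 0, \<dots>, \<nu> (N - 1)\<close> together with the conformal weight \<open>\<nu> N\<close>.\<close>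

abbreviation C :: "nat \<Rightarrow> 'v \<Rightarrow> 'v"
  where "C \<equiv> \<lambda>h. if h < N then a h h 0 else D"

text \<open>The pairing with the Cartan element on which every simple root takes the value 1.\<close>

definition height :: "(nat \<Rightarrow> complex) \<Rightarrow> real"
  where "height \<nu> = Re (- (\<Sum>j<N. of_nat j * \<nu> j) - of_nat N * \<nu> N)"

definition raising :: "nat \<Rightarrow> nat \<Rightarrow> int \<Rightarrow> bool"
  where "raising i j n \<longleftrightarrow> i < N \<and> j < N \<and> (0 < n \<or> n = 0 \<and> i < j)"

definition lowering :: "(nat \<times> nat \<times> int) set"
  where "lowering = {(i, j, n). i < N \<and> j < N \<and> (n < 0 \<or> n = 0 \<and> j < i)}"

text \<open>\<open>C h\<close> is \<open>D\<close> for every \<open>h\<close> from \<open>N\<close>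
  on, so the conformal weight is shifted at all these indices and not just at
  \<open>N\<close>.\<close>

definition shift :: "nat \<Rightarrow> nat \<Rightarrow> int \<Rightarrow> (nat \<Rightarrow> complex) \<Rightarrow> nat \<Rightarrow> complex"
  where "shift i j n \<nu> = (\<lambda>h. \<nu> h + (if h < N then of_bool (h = i) - of_bool (h = j) else - of_int n))"

text \<open>Conformal weights are left out of the comparison: for highest weights they are
  determined by the other entries.\<close>

definition same_class :: "(nat \<Rightarrow> complex) \<Rightarrow> (nat \<Rightarrow> complex) \<Rightarrow> bool"
  where "same_class \<mu> \<nu> \<longleftrightarrow> (\<forall>i<N. \<mu> i - \<nu> i \<in> \<int>)"

text \<open>A singular weight vector of the quotient of \<open>V\<close> by \<open>T\<close>, given
  by a representative that is itself a weight vector.\<close>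

definition singular :: "'v set \<Rightarrow> 'v \<Rightarrow> (nat \<Rightarrow> complex) \<Rightarrow> bool"
  where "singular T u \<nu> \<longleftrightarrow> u \<in> V \<and> u \<notin> T \<and> u \<in> eigen C \<nu> \<and>
    (\<forall>i j n. raising i j n \<longrightarrow> a i j n u \<in> T)"

lemma N_pos: "0 < N"
  using odd_N by (cases N) auto

lemma endo_C: "endo (C h)"
  using endo_a endo_D by simp

lemma C_stable: "stable W \<Longrightarrow> w \<in> W \<Longrightarrow> C h w \<in> W"
  using D_stable by (auto simp: stable_def)

lemma stable_subspace: "stable W \<Longrightarrow> subspace W"
  by (simp add: stable_def)

lemma same_class_refl: "same_class \<nu> \<nu>"
  by (simp add: same_class_def)

lemma same_class_sym: "same_class \<mu> \<nu> \<Longrightarrow> same_class \<nu> \<mu>"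
  unfolding same_class_def by (metis Ints_minus minus_diff_eq)

lemma same_class_trans: "same_class \<mu> \<nu> \<Longrightarrow> same_class \<nu> \<xi> \<Longrightarrow> same_class \<mu> \<xi>"
  unfolding same_class_def
proof (intro allI impI)
  fix i assume "\<forall>i<N. \<mu> i - \<nu> i \<in> \<int>" "\<forall>i<N. \<nu> i - \<xi> i \<in> \<int>" "i < N"
  then have "(\<mu> i - \<nu> i) + (\<nu> i - \<xi> i) \<in> \<int>" by (intro Ints_add) auto
  then show "\<mu> i - \<xi> i \<in> \<int>" by simp
qed

lemma same_class_shift: "same_class (shift i j n \<nu>) \<nu>"
  by (simp add: same_class_def shift_def)

lemma a_eigen:
  assumes "i < N" "j < N" "v \<in> V" "v \<in> eigen C \<nu>"
  shows "a i j n v \<in> eigen C (shift i j n \<nu>)"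
  unfolding eigen_def
proof (intro CollectI allI)
  fix h
  have Cv: "C h v = \<nu> h *c v" using assms(4) by (simp add: eigen_def)
  show "C h (a i j n v) = shift i j n \<nu> h *c a i j n v"
  proof (cases "h < N")
    case True
    then have "a h h 0 v = \<nu> h *c v" using Cv by simp
    moreover have "C h (a i j n v) = a h h 0 (a i j n v)" using True by simp
    ultimately show ?thesis
      using True assms a_comm[of h h i j v 0 n]
      by (cases "h = i"; cases "h = j")
        (simp_all add: shift_def a_scale scale_left_distrib scale_left_diff_distrib)
  next
    case False
    then show ?thesis
      using assms Cv by (simp add: shift_def D_a a_scale scale_left_diff_distrib)
  qed
qed

lemma height_shift:
  assumes "i < N" "j < N"
  shows "height (shift i j n \<nu>) = height \<nu> + (real j - real i + real N * real_of_int n)"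
proof -
  have "(\<Sum>h<N. of_nat h * shift i j n \<nu> h)
      = (\<Sum>h<N. of_nat h * \<nu> h + ((if h = i then of_nat h else 0) - (if h = j then of_nat h else 0)))"
    by (rule sum.cong) (auto simp: shift_def algebra_simps)
  also have "\<dots> = (\<Sum>h<N. of_nat h * \<nu> h) + of_nat i - of_nat j"
    using assms by (simp add: sum.distrib sum_subtractf)
  finally have 1: "(\<Sum>h<N. of_nat h * shift i j n \<nu> h) = \<dots>" .
  have 2: "shift i j n \<nu> N = \<nu> N - of_int n" by (simp add: shift_def)
  show ?thesis
    unfolding height_def 1 2 by (simp add: algebra_simps)
qed

lemma height_raising:
  assumes "raising i j n"
  shows "height (shift i j n \<nu>) \<ge> height \<nu> + 1"
proof -
  have ij: "i < N" "j < N" using assms by (auto simp: raising_def)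
  have "1 \<le> int j - int i + int N * n"
  proof (cases "n = 0")
    case False
    then have "1 \<le> n" using assms by (auto simp: raising_def)
    \<comment> \<open>One step in the mode outweighs \<open>j - i\<close>, which is at least
      \<open>1 - int N\<close>.\<close>
    then have "int N * 1 \<le> int N * n" by (intro mult_left_mono) auto
    then show ?thesis using ij by linarith
  qed (use assms in \<open>auto simp: raising_def\<close>)
  then have "(1::real) \<le> real_of_int (int j - int i + int N * n)" by linarith
  then show ?thesis using height_shift[OF ij] by simp
qed

lemma height_lowering:
  assumes "(i, j, n) \<in> lowering"
  shows "height (shift i j n \<nu>) < height \<nu>"
proof -
  have ij: "i < N" "j < N" using assms by (auto simp: lowering_def)
  have "int j - int i + int N * n \<le> -1"
  proof (cases "n = 0")
    case False
    then have "n \<le> -1" using assms by (auto simp: lowering_def)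
    then have "int N * n \<le> int N * (-1)" by (intro mult_left_mono) auto
    then show ?thesis using ij by linarith
  qed (use assms in \<open>auto simp: lowering_def\<close>)
  then have "real_of_int (int j - int i + int N * n) \<le> -1" by linarith
  then show ?thesis using height_shift[OF ij] by simp
qed

text \<open>Apply raising operators as long as they lead outside \<open>T\<close>. Each increases
  the height by at least 1 and heights of nonzero vectors are at most \<open>B\<close>, so this
  ends. All vectors met on the way lie in every stable subspace containing \<open>u\<close>.\<close>

lemma ex_singular:
  assumes T: "stable T" and u: "u \<in> V" "u \<notin> T" "u \<in> eigen C \<nu>"
  shows "\<exists>u' \<nu>'. singular T u' \<nu>' \<and> same_class \<nu>' \<nu> \<and> (\<forall>W. stable W \<longrightarrow> u \<in> W \<longrightarrow> u' \<in> W)"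
  using u
proof (induction "nat \<lceil>B - height \<nu>\<rceil>" arbitrary: u \<nu> rule: less_induct)
  case less
  show ?case
  proof (cases "singular T u \<nu>")
    case True
    then show ?thesis using same_class_refl by blast
  next
    case False
    then obtain i j n where r: "raising i j n" and n: "a i j n u \<notin> T"
      using less.prems by (auto simp: singular_def)
    have ij: "i < N" "j < N" using r by (auto simp: raising_def)
    let ?u = "a i j n u" and ?\<nu> = "shift i j n \<nu>"
    have ev: "?u \<in> eigen C ?\<nu>" by (rule a_eigen[OF ij less.prems(1,3)])
    have "?u \<noteq> 0" using n T by (auto simp: stable_def dest: subspace_0)
    then have "height ?\<nu> \<le> B"
      using weights_bounded[OF a_V _ ev] by (simp add: height_def)
    then have "nat \<lceil>B - height ?\<nu>\<rceil> < nat \<lceil>B - height \<nu>\<rceil>"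
      using height_raising[OF r, of \<nu>] by linarith
    from less.hyps[OF this a_V n ev] obtain u' \<nu>' where
      "singular T u' \<nu>'" "same_class \<nu>' ?\<nu>" "\<forall>W. stable W \<longrightarrow> ?u \<in> W \<longrightarrow> u' \<in> W"
      by blast
    moreover have "?u \<in> W" if "stable W" "u \<in> W" for W
      using that ij by (simp add: stable_def)
    ultimately show ?thesis using same_class_trans same_class_shift by blast
  qed
qed

text \<open>In \<open>relation\<close> every off-diagonal product is brought into the order in which
  a raising operator acts first. What commuting leaves over is diagonal, and the total coefficient
  of \<open>u\<close> vanishes because \<open>u\<close> lies outside \<open>T\<close>.\<close>

lemma singular_admissible:
  assumes T: "stable T" and u: "singular T u \<nu>"
  shows "admissible N \<nu>"
  unfolding admissible_def
proof (intro conjI allI impI)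
  have T': "subspace T" using T by (rule stable_subspace)
  have uV: "u \<in> V" and uT: "u \<notin> T" and rT: "\<And>i j n. raising i j n \<Longrightarrow> a i j n u \<in> T"
    using u by (auto simp: singular_def)
  have u0: "u \<noteq> 0" using uT T' subspace_0 by blast
  have Cu: "C h u = \<nu> h *c u" for h using u by (simp add: singular_def eigen_def)
  have w: "a h h 0 u = \<nu> h *c u" if "h < N" for h using Cu[of h] that by simp
  have "(\<Sum>i<N. \<nu> i) *c u = (\<Sum>i<N. a i i 0 u)"
    by (simp add: scale_sum_left w)
  then show "(\<Sum>i<N. \<nu> i) = 0" using trace_a[of 0 u] u0 by simp
  fix i assume i: "i < N"
  \<comment> \<open>The scalar by which the \<open>m\<close>-th product acts modulo
    \<open>T\<close>: the bracket of two opposite matrix units, a square, or zero.\<close>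
  let ?c = "\<lambda>m. if m < i then \<nu> m - \<nu> i else if m = i then (\<nu> i)\<^sup>2 else 0"
  have term_T: "a m i 0 (a i m 0 u) - ?c m *c u \<in> T" if m: "m < N" for m
  proof -
    consider "m < i" | "m = i" | "i < m" by linarith
    then show ?thesis
    proof cases
      case 1
      have "a m i 0 u \<in> T" using 1 m i by (intro rT) (auto simp: raising_def)
      then have "a i m 0 (a m i 0 u) \<in> T" using T m i by (simp add: stable_def)
      moreover have "a m i 0 (a i m 0 u) - ?c m *c u = a i m 0 (a m i 0 u)"
        using 1 m i uV a_comm[of m i i m u 0 0] by (simp add: w scale_left_diff_distrib)
      ultimately show ?thesis by simp
    next
      case 2
      then show ?thesis using i T' by (simp add: w a_scale power2_eq_square subspace_0)
    next
      case 3
      have "a i m 0 u \<in> T" using 3 m i by (intro rT) (auto simp: raising_def)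
      then show ?thesis using T m i 3 by (simp add: stable_def)
    qed
  qed
  have 1: "(\<Sum>m<N. a m i 0 (a i m 0 u) - ?c m *c u) \<in> T"
    by (rule subspace_sum[OF T']) (use term_T in simp)
  have "(\<Sum>m<N. a m i 0 (a i m 0 u)) + (of_nat N / 2) *c a i i 0 u - D u \<in> T"
    using rT by (intro relation[OF T uV _ i]) (auto simp: raising_def)
  from subspace_diff[OF T' this 1]
  have "((\<Sum>m<N. a m i 0 (a i m 0 u)) + (of_nat N / 2) *c a i i 0 u - D u)
      - (\<Sum>m<N. a m i 0 (a i m 0 u) - ?c m *c u) \<in> T" .
  also have "((\<Sum>m<N. a m i 0 (a i m 0 u)) + (of_nat N / 2) *c a i i 0 u - D u)
      - (\<Sum>m<N. a m i 0 (a i m 0 u) - ?c m *c u)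
      = ((\<Sum>m<N. ?c m) + of_nat N / 2 * \<nu> i - \<nu> N) *c u"
    using Cu[of N] by (simp add: sum_subtractf w i scale_sum_left scale_left_distrib scale_left_diff_distrib)
  finally have "(\<Sum>m<N. ?c m) + of_nat N / 2 * \<nu> i - \<nu> N = 0"
    using uT subspace_scale[OF T', of "((\<Sum>m<N. ?c m) + of_nat N / 2 * \<nu> i - \<nu> N) *c u"
        "inverse ((\<Sum>m<N. ?c m) + of_nat N / 2 * \<nu> i - \<nu> N)"]
    by (cases "(\<Sum>m<N. ?c m) + of_nat N / 2 * \<nu> i - \<nu> N = 0") simp_all
  moreover have "(\<Sum>m<N. ?c m) = (\<nu> i)\<^sup>2 + (\<Sum>m<i. \<nu> m - \<nu> i)"
  proof -
    have "(\<Sum>m<N. ?c m) = (\<Sum>m<Suc i. ?c m)"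
      by (rule sum.mono_neutral_right) (use i in auto)
    then show ?thesis by (simp add: add.commute)
  qed
  ultimately show "(\<nu> i)\<^sup>2 + (\<Sum>m<i. \<nu> m - \<nu> i) + of_nat N / 2 * \<nu> i = \<nu> N"
    by (simp add: algebra_simps)
qed

text \<open>The two vectors may be singular modulo different subspaces; \<open>V_span_hwm\<close>
  compares one modulo a sum of submodules with one modulo zero.\<close>

lemma singular_unique:
  assumes "stable S" "singular S u \<mu>" "stable T" "singular T v \<nu>" "same_class \<mu> \<nu>"
  shows "\<mu> = \<nu>"
proof
  fix h
  have eq: "\<mu> h = \<nu> h" if "h \<le> N" for h
    using admissible_unique[OF odd_N singular_admissible singular_admissible _ that] assms
    unfolding same_class_def by blast
  \<comment> \<open>Weights are functions on all of \<open>nat\<close>; from \<open>N\<close> on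
    their values repeat the eigenvalue of \<open>D\<close>.\<close>
  have top: "\<xi> h = \<xi> N" if "singular Q w \<xi>" "stable Q" "N \<le> h" for Q w \<xi> h
  proof -
    have "w \<noteq> 0" using that subspace_0 by (auto simp: singular_def stable_def)
    moreover have "C h' w = \<xi> h' *c w" for h' using that(1) by (simp add: singular_def eigen_def)
    from this[of h] this[of N] have "\<xi> h *c w = \<xi> N *c w" using that(3) by simp
    ultimately show ?thesis by simp
  qed
  show "\<mu> h = \<nu> h"
  proof (cases "h \<le> N")
    case False
    then have "N \<le> h" by simp
    from top[OF assms(2,1) this] top[OF assms(4,3) this] show ?thesis
      using eq[OF order_refl] by simp
  qed (rule eq)
qed

section \<open>Highest weight modules\<close>

definition highest_weight_module :: "'v \<Rightarrow> 'v set"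
  where "highest_weight_module v = closure_under lowering (span {v})"

abbreviation below :: "(nat \<Rightarrow> complex) \<Rightarrow> (nat \<Rightarrow> complex) set"
  where "below \<nu> \<equiv> {\<mu>. same_class \<mu> \<nu> \<and> height \<mu> < height \<nu>}"

context
  fixes v \<nu>
  assumes v: "singular {0} v \<nu>"
begin

lemma v_facts: "v \<in> V" "v \<noteq> 0" "v \<in> eigen C \<nu>" "raising i j n \<Longrightarrow> a i j n v = 0"
  using v by (auto simp: singular_def)

text \<open>The operators that are not lowering preserve the line through \<open>v\<close>: raising
  ones annihilate it, diagonal zero modes scale it.\<close>

lemma stable_hwm: "stable (highest_weight_module v)"
  unfolding highest_weight_module_def
proof (rule stable_closure_under)
  show "span {v} \<subseteq> V" by (rule span_minimal) (use v_facts subspace_V in auto)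
  fix i j n r assume ij: "i < N" "j < N" "(i, j, n) \<notin> lowering" and "r \<in> span {v}"
  then obtain c where r: "r = c *c v" by (auto simp: span_singleton)
  have "a i j n v \<in> span {v}"
  proof (cases "raising i j n")
    case True
    then show ?thesis by (simp add: v_facts span_zero)
  next
    case False
    then have "n = 0" "i = j" using ij by (auto simp: raising_def lowering_def)
    then have "a i j n v = \<nu> i *c v" using v_facts(3) ij by (auto simp: eigen_def dest: spec[of _ i])
    then show ?thesis by (simp add: span_base span_scale)
  qed
  then have "a i j n r \<in> span {v}" by (simp add: r a_scale span_scale)
  then show "a i j n r \<in> closure_under lowering (span {v})" using closure_under_base by blast
qed (auto simp: lowering_def)

lemma v_in_hwm: "v \<in> highest_weight_module v"
  unfolding highest_weight_module_def using closure_under_base[of "span {v}" lowering] span_base[of v "{v}"] by blast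

lemma hwm_minimal:
  assumes "stable W" "v \<in> W"
  shows "highest_weight_module v \<subseteq> W"
  unfolding highest_weight_module_def
proof (rule closure_under_minimal)
  show "span {v} \<subseteq> W" by (rule span_minimal) (use assms in \<open>auto simp: stable_def\<close>)
qed (use assms in \<open>auto simp: stable_def lowering_def\<close>)

text \<open>Lowering operators strictly decrease the height, so the weight \<open>\<nu>\<close>
  occurs only on the line through \<open>v\<close>.\<close>

lemma hwm_decompose:
  assumes "w \<in> highest_weight_module v"
  obtains c y where "w = c *c v + y" "y \<in> span (V \<inter> (\<Union>\<mu>\<in>below \<nu>. eigen C \<mu>))"
proof -
  let ?L = "span (V \<inter> (\<Union>\<mu>\<in>below \<nu>. eigen C \<mu>))"
  let ?W = "{c *c v + y | c y. y \<in> ?L}"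
  have "highest_weight_module v \<subseteq> ?W"
    unfolding highest_weight_module_def
  proof (rule closure_under_minimal)
    have "?W = {x + y | x y. x \<in> span {v} \<and> y \<in> ?L}" by (auto simp: span_singleton)
    then show "subspace ?W" by (simp add: subspace_sums)
    show "span {v} \<subseteq> ?W" using span_zero by (force simp: span_singleton)
  next
    fix i j n w assume l: "(i, j, n) \<in> lowering" and "w \<in> ?W"
    then obtain c y where w: "w = c *c v + y" "y \<in> ?L" by blast
    have ij: "i < N" "j < N" using l by (auto simp: lowering_def)
    have step: "a i j n x \<in> ?L" if x: "x \<in> V" "x \<in> eigen C \<mu>" "same_class \<mu> \<nu>" "height \<mu> \<le> height \<nu>" for x \<mu>
    proof (rule span_base)
      have "shift i j n \<mu> \<in> below \<nu>"
        using same_class_trans[OF same_class_shift x(3)] height_lowering[OF l, of \<mu>] x(4) by simp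
      then show "a i j n x \<in> V \<inter> (\<Union>\<mu>\<in>below \<nu>. eigen C \<mu>)"
        using a_eigen[OF ij x(1,2)] a_V by blast
    qed
    have "a i j n v \<in> ?L" using step[OF v_facts(1,3) same_class_refl] by simp
    moreover have "a i j n y \<in> ?L"
      by (rule endo_span[OF endo_a _ _ w(2)]) (auto intro: step)
    ultimately have "c *c a i j n v + a i j n y \<in> ?L" by (intro span_add span_scale)
    moreover have "a i j n w = 0 *c v + (c *c a i j n v + a i j n y)" by (simp add: w a_add a_scale)
    ultimately show "a i j n w \<in> ?W" by blast
  qed
  then show ?thesis using assms that by blast
qed

abbreviation at_most :: "(nat \<Rightarrow> complex) set"
  where "at_most \<equiv> {\<mu>. same_class \<mu> \<nu> \<and> height \<mu> \<le> height \<nu>}"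

lemma hwm_weights: "highest_weight_module v \<subseteq> span (\<Union>\<mu>\<in>at_most. eigen C \<mu>)"
proof
  fix w assume "w \<in> highest_weight_module v"
  then obtain c y where w: "w = c *c v + y" and y: "y \<in> span (V \<inter> (\<Union>\<mu>\<in>below \<nu>. eigen C \<mu>))"
    by (rule hwm_decompose)
  have "span (V \<inter> (\<Union>\<mu>\<in>below \<nu>. eigen C \<mu>)) \<subseteq> span (\<Union>\<mu>\<in>at_most. eigen C \<mu>)"
    by (rule span_mono) (auto intro: less_imp_le)
  moreover have "v \<in> span (\<Union>\<mu>\<in>at_most. eigen C \<mu>)"
    using v_facts(3) same_class_refl by (intro span_base) auto
  ultimately show "w \<in> span (\<Union>\<mu>\<in>at_most. eigen C \<mu>)"
    using y w by (auto intro: span_add span_scale)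
qed

text \<open>A nonzero submodule contains a singular vector in the class of \<open>\<nu>\<close>.
  Uniqueness makes its weight equal to \<open>\<nu>\<close>, and in this module the vectors of that
  weight are the multiples of \<open>v\<close>.\<close>

lemma hwm_irreducible:
  assumes W: "stable W" "W \<subseteq> highest_weight_module v" "W \<noteq> {0}"
  shows "W = highest_weight_module v"
proof
  have "0 \<in> W" using W(1) subspace_0 by (auto simp: stable_def)
  then obtain w where w: "w \<in> W" "w \<noteq> 0" using W(3) by blast
  then have "w \<in> span (\<Union>\<mu>\<in>at_most. eigen C \<mu>)" using W(2) hwm_weights by blast
  from eigen_components_ex[OF endo_C stable_subspace[OF W(1)] C_stable[OF W(1)] w this]
  obtain \<mu> x where x: "\<mu> \<in> at_most" "x \<in> eigen C \<mu>" "x \<in> W" "x \<noteq> 0" by blast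
  have "x \<in> V" using x W(1) by (auto simp: stable_def)
  from ex_singular[OF stable_zero this _ x(2)] x(4)
  obtain u \<xi> where u: "singular {0} u \<xi>" "same_class \<xi> \<mu>" "\<forall>W. stable W \<longrightarrow> x \<in> W \<longrightarrow> u \<in> W"
    by blast
  have "same_class \<xi> \<nu>" using same_class_trans[OF u(2)] x(1) by blast
  then have \<xi>: "\<xi> = \<nu>" by (rule singular_unique[OF stable_zero u(1) stable_zero v])
  have uW: "u \<in> W" using u(3) W(1) x(3) by blast
  then have "u \<in> highest_weight_module v" using W(2) by blast
  then obtain c y where uy: "u = c *c v + y" and y: "y \<in> span (V \<inter> (\<Union>\<mu>\<in>below \<nu>. eigen C \<mu>))"
    by (rule hwm_decompose)
  have ue: "u \<in> eigen C \<nu>" "u \<noteq> 0" using u(1) \<xi> by (auto simp: singular_def)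
  have "y = u - c *c v" using uy by simp
  moreover have sE: "subspace (eigen C \<nu>)" by (rule subspace_eigen[OF endo_C])
  ultimately have "y \<in> eigen C \<nu>"
    using subspace_diff[OF sE ue(1) subspace_scale[OF sE v_facts(3), of c]] by simp
  moreover have "span (V \<inter> (\<Union>\<mu>\<in>below \<nu>. eigen C \<mu>)) \<subseteq> span (\<Union>\<mu>\<in>below \<nu>. eigen C \<mu>)"
    by (rule span_mono) blast
  ultimately have "y = 0" using y by (intro eigen_Int_span[OF endo_C, of \<nu> "below \<nu>"]) auto
  then have "u = c *c v" "c \<noteq> 0" using uy ue(2) by auto
  then have "v = inverse c *c u" by simp
  then have "v \<in> W" using uW W(1) by (auto simp: stable_def intro: subspace_scale)
  then show "highest_weight_module v \<subseteq> W" by (rule hwm_minimal[OF W(1)])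
qed (rule W(2))

end

text \<open>If the sum of these modules were proper, some \<open>w\<close> would be singular modulo
  it. Uniqueness of the highest weight in a class makes \<open>w\<close> singular outright, so it
  already generates one of the summands.\<close>

lemma V_span_hwm:
  "V = span (\<Union>{highest_weight_module v | v. \<exists>\<nu>. singular {0} v \<nu>})" (is "V = ?T")
proof
  have T: "stable ?T"
    by (rule stable_span_Union) (use stable_hwm in blast)
  then show "?T \<subseteq> V" by (simp add: stable_def)
  let ?I = "{\<mu>. \<exists>v \<nu>. singular {0} v \<nu> \<and> same_class \<mu> \<nu> \<and> height \<mu> \<le> height \<nu>}"
  have T_weights: "?T \<subseteq> span (\<Union>\<mu>\<in>?I. eigen C \<mu>)"
  proof (rule span_minimal)
    show "\<Union>{highest_weight_module v | v. \<exists>\<nu>. singular {0} v \<nu>} \<subseteq> span (\<Union>\<mu>\<in>?I. eigen C \<mu>)"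
    proof
      fix x assume "x \<in> \<Union>{highest_weight_module v | v. \<exists>\<nu>. singular {0} v \<nu>}"
      then obtain v \<nu> where v: "singular {0} v \<nu>" "x \<in> highest_weight_module v" by blast
      have "span (\<Union>\<mu>\<in>{\<mu>. same_class \<mu> \<nu> \<and> height \<mu> \<le> height \<nu>}. eigen C \<mu>) \<subseteq> span (\<Union>\<mu>\<in>?I. eigen C \<mu>)"
        by (rule span_mono) (use v(1) in blast)
      then show "x \<in> span (\<Union>\<mu>\<in>?I. eigen C \<mu>)" using hwm_weights[OF v(1)] v(2) by blast
    qed
  qed simp
  have "u \<in> ?T" if u: "u \<in> V" "u \<in> eigen C \<mu>" for u \<mu>
  proof (rule ccontr)
    assume "u \<notin> ?T"
    from ex_singular[OF T u(1) this u(2)] obtain w \<nu> where w: "singular ?T w \<nu>" by blast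
    have wV: "w \<in> V" and wT: "w \<notin> ?T" and we: "w \<in> eigen C \<nu>" using w by (auto simp: singular_def)
    have "a i j n w = 0" if r: "raising i j n" for i j n
    proof -
      have ij: "i < N" "j < N" using r by (auto simp: raising_def)
      have "a i j n w \<in> ?T" using w r by (simp add: singular_def)
      then have aT: "a i j n w \<in> span (\<Union>\<mu>\<in>?I. eigen C \<mu>)" using T_weights by blast
      \<comment> \<open>The raised weight is higher than \<open>\<nu>\<close>, whereas the weights
        of the sum in this class lie at or below its only highest weight, which is
        \<open>\<nu>\<close>.\<close>
      have "shift i j n \<nu> \<notin> ?I"
      proof
        assume "shift i j n \<nu> \<in> ?I"
        then obtain v \<xi> where v: "singular {0} v \<xi>" "same_class (shift i j n \<nu>) \<xi>"
          "height (shift i j n \<nu>) \<le> height \<xi>" by blast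
        have "same_class \<nu> \<xi>"
          using same_class_trans[OF same_class_sym[OF same_class_shift] v(2)] .
        then have "\<nu> = \<xi>" by (rule singular_unique[OF T w stable_zero v(1)])
        then show False using height_raising[OF r, of \<nu>] v(3) by simp
      qed
      then show ?thesis
        by (rule eigen_Int_span[OF endo_C _ a_eigen[OF ij wV we] aT])
    qed
    moreover have "w \<noteq> 0" using wT span_zero by blast
    ultimately have s: "singular {0} w \<nu>" using wV we by (auto simp: singular_def)
    then have "w \<in> ?T" using v_in_hwm[OF s] by (intro span_base) blast
    then show False using wT by blast
  qed
  then have "span (V \<inter> (\<Union>\<nu>. eigen C \<nu>)) \<subseteq> ?T"
    by (intro span_minimal) auto
  then show "V \<subseteq> ?T" using V_weights by blast
qed

theorem direct_sum_of_hwm: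
  obtains \<W> where "span (\<Union>\<W>) = V"
    "\<And>W. W \<in> \<W> \<Longrightarrow> stable W \<and> W \<noteq> {0} \<and> (\<forall>W'. stable W' \<longrightarrow> W' \<subseteq> W \<longrightarrow> W' = {0} \<or> W' = W)"
    "\<And>W. W \<in> \<W> \<Longrightarrow> W \<inter> span (\<Union>(\<W> - {W})) = {0}"
proof -
  let ?I = "{highest_weight_module v | v. \<exists>\<nu>. singular {0} v \<nu>}"
  have I: "stable W \<and> W \<noteq> {0} \<and> (\<forall>W'. stable W' \<longrightarrow> W' \<subseteq> W \<longrightarrow> W' = {0} \<or> W' = W)" if W: "W \<in> ?I" for W
  proof -
    obtain v \<nu> where v: "singular {0} v \<nu>" "W = highest_weight_module v" using W by blast
    then show ?thesis
      using stable_hwm[OF v(1)] hwm_irreducible[OF v(1)] v_in_hwm[OF v(1)] v_facts(2)[OF v(1)] by blast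
  qed
  have "W \<inter> span (\<Union>\<W>) = {0} \<or> W \<subseteq> span (\<Union>\<W>)" if "W \<in> ?I" "\<W> \<subseteq> ?I" for W \<W>
  proof -
    \<comment> \<open>The intersection of an irreducible \<open>W\<close> with a sum of such modules
      is a stable subspace of \<open>W\<close>, hence zero or \<open>W\<close>.\<close>
    have "stable (span (\<Union>\<W>))" by (rule stable_span_Union) (use that I in blast)
    then have "stable (W \<inter> span (\<Union>\<W>))"
      using I[OF that(1)] by (auto simp: stable_def intro: subspace_inter)
    then show ?thesis using I[OF that(1)] by blast
  qed
  note irr = this
  have sub: "subspace W" if "W \<in> ?I" for W using I[OF that] by (simp add: stable_def)
  have nz: "{0} \<notin> ?I" using I by blast
  show ?thesis
  proof (rule direct_sum_of_irreducibles[of ?I, OF sub irr nz])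
    fix \<W> assume \<W>: "\<W> \<subseteq> ?I" "span (\<Union>\<W>) = span (\<Union>?I)"
      "\<And>W. W \<in> \<W> \<Longrightarrow> W \<inter> span (\<Union>(\<W> - {W})) = {0}"
    show thesis
    proof (rule that[of \<W>])
      show "span (\<Union>\<W>) = V" using \<W>(2) V_span_hwm by simp
      show "stable W \<and> W \<noteq> {0} \<and> (\<forall>W'. stable W' \<longrightarrow> W' \<subseteq> W \<longrightarrow> W' = {0} \<or> W' = W)" if "W \<in> \<W>" for W
        by (rule I) (use \<W>(1) that in blast)
    qed (rule \<W>(3))
  qed
qed

end


section \<open>Modules over the complex numbers as subspaces\<close>

lemma CC_simps [simp]:
  "carrier CC = UNIV" "x \<oplus>\<^bsub>CC\<^esub> y = x + y" "x \<otimes>\<^bsub>CC\<^esub> y = x * y" "\<zero>\<^bsub>CC\<^esub> = 0" "\<one>\<^bsub>CC\<^esub> = 1"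
  by (simp_all add: ring_of_type_algebra_def)

lemma cring_CC: "cring CC"
  by (rule cring_from_type_algebra)

locale complex_module = Module.module CC M for M :: "(complex, 'b, 'm) module_scheme" (structure)
begin

lemma smult_closed' [simp]: "x \<in> carrier M \<Longrightarrow> c \<odot> x \<in> carrier M"
  by (rule smult_closed) simp_all

lemma smult_add: "x \<in> carrier M \<Longrightarrow> y \<in> carrier M \<Longrightarrow> c \<odot> (x \<oplus> y) = c \<odot> x \<oplus> c \<odot> y"
  by (rule smult_r_distr) simp_all

lemma add_smult: "x \<in> carrier M \<Longrightarrow> (c + d) \<odot> x = c \<odot> x \<oplus> d \<odot> x"
  using smult_l_distr[of c d x] by simp

lemma smult_smult: "x \<in> carrier M \<Longrightarrow> c \<odot> (d \<odot> x) = (c * d) \<odot> x"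
  using smult_assoc1[of c d x] by simp

lemma smult_1 [simp]: "x \<in> carrier M \<Longrightarrow> 1 \<odot> x = x"
  using smult_one[of x] by simp

lemma smult_0 [simp]: "x \<in> carrier M \<Longrightarrow> 0 \<odot> x = \<zero>"
  using smult_l_null[of x] by simp

lemma smult_zero [simp]: "c \<odot> \<zero> = \<zero>"
  by (rule smult_r_null) simp

lemma neg_smult: "x \<in> carrier M \<Longrightarrow> \<ominus> x = (- 1) \<odot> x"
proof -
  assume x: "x \<in> carrier M"
  have "(- 1) \<odot> x \<oplus> x = (- 1 + 1) \<odot> x" using x add_smult[of x "- 1" 1] by simp
  then show ?thesis using x minus_equality[of "(- 1) \<odot> x" x] by simp
qed

lemma minus_smult: "x \<in> carrier M \<Longrightarrow> y \<in> carrier M \<Longrightarrow> x \<ominus> y = x \<oplus> (- 1) \<odot> y"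
  by (simp add: a_minus_def neg_smult)

lemma submodule_CC_I:
  assumes "H \<subseteq> carrier M" "\<zero> \<in> H" "\<And>x y. x \<in> H \<Longrightarrow> y \<in> H \<Longrightarrow> x \<oplus> y \<in> H" "\<And>c x. x \<in> H \<Longrightarrow> c \<odot> x \<in> H"
  shows "submodule H CC M"
  by (rule submoduleI) (use assms neg_smult in auto)

lemma submodule_CC_E:
  assumes "submodule H CC M"
  shows "H \<subseteq> carrier M" "\<zero> \<in> H" "x \<in> H \<Longrightarrow> y \<in> H \<Longrightarrow> x \<oplus> y \<in> H" "x \<in> H \<Longrightarrow> c \<odot> x \<in> H"
    "x \<in> H \<Longrightarrow> y \<in> H \<Longrightarrow> x \<ominus> y \<in> H"
proof -
  show H: "H \<subseteq> carrier M" and z: "\<zero> \<in> H" and a: "x \<in> H \<Longrightarrow> y \<in> H \<Longrightarrow> x \<oplus> y \<in> H"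
    and c: "\<And>c x. x \<in> H \<Longrightarrow> c \<odot> x \<in> H" for x y
    using submoduleE[OF assms] subgroup.one_closed[OF submodule.axioms(1)[OF assms]] by auto
  show "x \<in> H \<Longrightarrow> y \<in> H \<Longrightarrow> x \<ominus> y \<in> H"
    using a[of x "(- 1) \<odot> y"] c[of y "- 1"] minus_smult[of x y] subsetD[OF H] by simp
qed

lemma submodule_finsum:
  assumes "submodule H CC M" "\<And>x. x \<in> A \<Longrightarrow> f x \<in> H"
  shows "finsum M f A \<in> H"
  using assms(2)
proof (induction A rule: infinite_finite_induct)
  case (insert x A)
  then have "f \<in> A \<rightarrow> carrier M" "f x \<in> carrier M" using submodule_CC_E(1)[OF assms(1)] by auto
  then show ?case using insert submodule_CC_E(3)[OF assms(1)] by (simp add: finsum_insert)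
qed (simp_all add: finsum_infinite submodule_CC_E(2)[OF assms(1)])

lemma submodule_span_in:
  assumes "S \<subseteq> carrier M"
  shows "submodule (span_in M S) CC M"
proof (rule submodule_CC_I)
  show "span_in M S \<subseteq> carrier M"
    unfolding span_in_def using carrier_is_submodule assms by auto
qed (auto simp: span_in_def intro: submodule_CC_E)

lemma span_in_base: "S \<subseteq> span_in M S"
  by (auto simp: span_in_def)

lemma span_in_minimal: "submodule W CC M \<Longrightarrow> S \<subseteq> W \<Longrightarrow> span_in M S \<subseteq> W"
  by (auto simp: span_in_def)

end

lemma linear_onD:
  assumes "linear_on V W f"
  shows "x \<in> carrier V \<Longrightarrow> f x \<in> carrier W"
    "x \<in> carrier V \<Longrightarrow> y \<in> carrier V \<Longrightarrow> f (x \<oplus>\<^bsub>V\<^esub> y) = f x \<oplus>\<^bsub>W\<^esub> f y"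
    "x \<in> carrier V \<Longrightarrow> f (c \<odot>\<^bsub>V\<^esub> x) = c \<odot>\<^bsub>W\<^esub> f x"
  using assms by (auto simp: linear_on_def)

locale quotient_space = complex_module V for V :: "(complex, 'b, 'm) module_scheme" (structure) +
  fixes W :: "'b set"
  assumes W: "submodule W CC V"
begin

lemma abelian_subgroup_W: "abelian_subgroup W V"
proof (rule abelian_subgroupI3)
  show "additive_subgroup W V"
    using submodule.axioms(1)[OF W] by (simp add: additive_subgroup_def)
qed unfold_locales

interpretation W: abelian_subgroup W V
  by (rule abelian_subgroup_W)

abbreviation Q where "Q \<equiv> quot_module V W"

lemma quot_simps:
  "carrier Q = a_rcosets W" "\<zero>\<^bsub>Q\<^esub> = W" "A \<oplus>\<^bsub>Q\<^esub> B = A <+> B"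
  "c \<odot>\<^bsub>Q\<^esub> A = coset_map V W (\<lambda>a. c \<odot> a) A" "A \<otimes>\<^bsub>Q\<^esub> B = rcoset_mult V W A B" "\<one>\<^bsub>Q\<^esub> = W +> \<one>"
  by (simp_all add: quot_module_def ring.extend_def module.fields_def FactRing_def)

lemma carrier_quot: "carrier Q = {W +> v | v. v \<in> carrier V}"
  by (auto simp: quot_simps A_RCOSETS_def')

lemma coset_closed: "v \<in> carrier V \<Longrightarrow> W +> v \<in> carrier Q"
  by (auto simp: carrier_quot)

lemma mem_coset_iff: "u \<in> carrier V \<Longrightarrow> v \<in> carrier V \<Longrightarrow> u \<in> W +> v \<longleftrightarrow> u \<ominus> v \<in> W"
  unfolding a_minus_def by (rule W.a_rcos_module)

lemma coset_eq_iff: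
  assumes "u \<in> carrier V" "v \<in> carrier V"
  shows "W +> u = W +> v \<longleftrightarrow> u \<ominus> v \<in> W"
proof
  assume "W +> u = W +> v"
  then have "u \<in> W +> v" using W.a_rcos_self[OF assms(1)] by simp
  then show "u \<ominus> v \<in> W" using mem_coset_iff[OF assms] by simp
next
  assume "u \<ominus> v \<in> W"
  then have "u \<in> W +> v" using mem_coset_iff[OF assms] by simp
  then show "W +> u = W +> v" using W.a_repr_independence'[OF _ assms(2)] by simp
qed

lemma zero_coset': "W +> \<zero> = W"
  by (rule a_coset_add_zero) (rule submodule_CC_E[OF W])

lemma coset_eq_zero_iff: "v \<in> carrier V \<Longrightarrow> W +> v = W \<longleftrightarrow> v \<in> W"
  using coset_eq_iff[of v \<zero>] by (simp add: zero_coset' minus_smult)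

lemma mem_coset:
  assumes "v \<in> carrier V" "a \<in> W +> v"
  shows "a \<in> carrier V" "a \<ominus> v \<in> W"
proof -
  show "a \<in> carrier V" by (rule W.a_elemrcos_carrier[OF assms])
  then show "a \<ominus> v \<in> W" using mem_coset_iff assms by blast
qed

text \<open>\<open>coset_map\<close> is a union over representatives. It reduces to a single coset
  because changing the representative moves the value by an element of \<open>W\<close>.\<close>

lemma coset_map_coset:
  assumes f: "f \<in> carrier V \<rightarrow> carrier V" "\<And>x y. x \<in> carrier V \<Longrightarrow> y \<in> carrier V \<Longrightarrow> f (x \<oplus> y) = f x \<oplus> f y"
    and fW: "f ` W \<subseteq> W" and v: "v \<in> carrier V"
  shows "coset_map V W f (W +> v) = W +> f v"
proof -
  have "W +> f a = W +> f v" if a: "a \<in> W +> v" for a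
  proof -
    have ac: "a \<in> carrier V" "a \<ominus> v \<in> W" using mem_coset[OF v a] by auto
    then have "f a = f (a \<ominus> v) \<oplus> f v"
      using f v by (metis a_minus_def a_assoc a_inv_closed l_neg minus_closed r_zero)
    moreover have "f (a \<ominus> v) \<in> W" using fW ac by blast
    moreover have "f v \<in> carrier V" "f (a \<ominus> v) \<in> carrier V" using f v ac by auto
    ultimately have "f a \<ominus> f v \<in> W" "f a \<in> carrier V" "f v \<in> carrier V"
      by (auto simp: a_minus_def a_assoc r_neg)
    then show ?thesis by (simp add: coset_eq_iff)
  qed
  moreover have "v \<in> W +> v" by (rule W.a_rcos_self[OF v])
  ultimately show ?thesis unfolding coset_map_def by blast
qed

lemma add_coset: "u \<in> carrier V \<Longrightarrow> v \<in> carrier V \<Longrightarrow> (W +> u) \<oplus>\<^bsub>Q\<^esub> (W +> v) = W +> (u \<oplus> v)"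
  by (simp add: quot_simps W.a_rcos_sum)

lemma smult_coset:
  assumes "v \<in> carrier V"
  shows "c \<odot>\<^bsub>Q\<^esub> (W +> v) = W +> (c \<odot> v)"
  unfolding quot_simps
  by (rule coset_map_coset) (use assms submodule_CC_E[OF W] in \<open>auto simp: smult_add\<close>)

lemma zero_coset: "\<zero>\<^bsub>Q\<^esub> = W +> \<zero>"
  by (simp add: quot_simps zero_coset')

lemma module_quot: "Module.module CC Q"
proof (rule moduleI)
  show "abelian_group Q"
  proof (rule abelian_groupI)
    fix A B C assume A: "A \<in> carrier Q" "B \<in> carrier Q" "C \<in> carrier Q"
    then show "A \<oplus>\<^bsub>Q\<^esub> B \<oplus>\<^bsub>Q\<^esub> C = A \<oplus>\<^bsub>Q\<^esub> (B \<oplus>\<^bsub>Q\<^esub> C)"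
      by (auto simp: carrier_quot add_coset a_assoc)
  next
    fix A assume "A \<in> carrier Q"
    then obtain v where v: "v \<in> carrier V" "A = W +> v" by (auto simp: carrier_quot)
    then have "(W +> \<ominus> v) \<oplus>\<^bsub>Q\<^esub> A = \<zero>\<^bsub>Q\<^esub>" by (simp add: add_coset l_neg zero_coset)
    then show "\<exists>B\<in>carrier Q. B \<oplus>\<^bsub>Q\<^esub> A = \<zero>\<^bsub>Q\<^esub>" using v coset_closed by blast
  next
    show "\<zero>\<^bsub>Q\<^esub> \<in> carrier Q" unfolding zero_coset by (rule coset_closed) simp
  qed (auto simp: carrier_quot add_coset zero_coset a_comm)
qed (auto simp: carrier_quot smult_coset add_coset add_smult smult_add smult_smult cring_CC)

end

text \<open>\<open>emb\<close> is an injective linear map on the carrier, and \<open>ev\<close> is a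
  linear left inverse defined on the whole ambient type. This makes \<open>lift f\<close> an
  endomorphism of the ambient space and not only of the image.\<close>

locale embedded_module = complex_space scale + complex_module M
  for scale :: "complex \<Rightarrow> 'v::ab_group_add \<Rightarrow> 'v"  (infixr \<open>*c\<close> 75)
    and M :: "(complex, 'w, 'q) module_scheme" (structure) +
  fixes emb :: "'w \<Rightarrow> 'v" and ev :: "'v \<Rightarrow> 'w"
  assumes emb_add: "x \<in> carrier M \<Longrightarrow> y \<in> carrier M \<Longrightarrow> emb (x \<oplus> y) = emb x + emb y"
    and emb_smult: "x \<in> carrier M \<Longrightarrow> emb (c \<odot> x) = c *c emb x"
    and ev_closed [simp]: "ev p \<in> carrier M"
    and ev_add: "ev (p + q) = ev p \<oplus> ev q"
    and ev_scale: "ev (c *c p) = c \<odot> ev p"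
    and ev_emb [simp]: "x \<in> carrier M \<Longrightarrow> ev (emb x) = x"
begin

definition lift :: "('w \<Rightarrow> 'w) \<Rightarrow> 'v \<Rightarrow> 'v"
  where "lift f p = emb (f (ev p))"

abbreviation image_space :: "'v set"
  where "image_space \<equiv> emb ` carrier M"

lemma emb_ev: "p \<in> image_space \<Longrightarrow> emb (ev p) = p"
  by auto

lemma emb_inj: "x \<in> carrier M \<Longrightarrow> y \<in> carrier M \<Longrightarrow> emb x = emb y \<longleftrightarrow> x = y"
  by (metis ev_emb)

lemma emb_zero [simp]: "emb \<zero> = 0"
  using emb_add[of \<zero> \<zero>] by simp

lemma emb_minus: "x \<in> carrier M \<Longrightarrow> y \<in> carrier M \<Longrightarrow> emb (x \<ominus> y) = emb x - emb y"
  by (simp add: minus_smult emb_add emb_smult)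

lemma emb_finsum: "f \<in> A \<rightarrow> carrier M \<Longrightarrow> finite A \<Longrightarrow> emb (finsum M f A) = (\<Sum>x\<in>A. emb (f x))"
proof (induction A rule: infinite_finite_induct)
  case (insert x A)
  then have "f \<in> A \<rightarrow> carrier M" "f x \<in> carrier M" by auto
  then show ?case using insert by (simp add: finsum_insert emb_add)
qed simp_all

lemma lift_emb [simp]: "x \<in> carrier M \<Longrightarrow> lift f (emb x) = emb (f x)"
  by (simp add: lift_def)

lemma lift_image: "(\<And>x. x \<in> carrier M \<Longrightarrow> f x \<in> carrier M) \<Longrightarrow> lift f p \<in> image_space"
  by (simp add: lift_def)

lemma endo_lift: "linear_on M M f \<Longrightarrow> endo (lift f)"
  by (rule endoI) (simp_all add: lift_def ev_add ev_scale linear_onD emb_add emb_smult)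

lemma subspace_emb:
  assumes "submodule W CC M"
  shows "subspace (emb ` W)"
proof (rule subspaceI)
  note E = submodule_CC_E[OF assms]
  show "0 \<in> emb ` W" using E(2) by (metis emb_zero imageI)
  fix p q c assume "p \<in> emb ` W" "q \<in> emb ` W"
  then obtain x y where xy: "x \<in> W" "y \<in> W" "p = emb x" "q = emb y" by blast
  then have "p + q = emb (x \<oplus> y)" using E(1) by (simp add: emb_add subset_iff)
  then show "p + q \<in> emb ` W" using E(3) xy by blast
  have "c *c p = emb (c \<odot> x)" using E(1) xy by (simp add: emb_smult subset_iff)
  then show "c *c p \<in> emb ` W" using E(4) xy by blast
qed

lemma subspace_image_space: "subspace image_space"
  by (rule subspace_emb[OF carrier_is_submodule])

definition pullback :: "'v set \<Rightarrow> 'w set"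
  where "pullback S = {x \<in> carrier M. emb x \<in> S}"

lemma submodule_pullback: "subspace S \<Longrightarrow> submodule (pullback S) CC M"
  by (rule submodule_CC_I)
    (auto simp: pullback_def emb_add emb_smult subspace_0 subspace_add subspace_scale)

lemma emb_pullback: "S \<subseteq> image_space \<Longrightarrow> emb ` pullback S = S"
  by (auto simp: pullback_def)

lemma pullback_emb: "W \<subseteq> carrier M \<Longrightarrow> pullback (emb ` W) = W"
  by (auto simp: pullback_def subset_iff) (metis ev_emb)

lemma emb_span_in:
  assumes "S \<subseteq> carrier M"
  shows "emb ` span_in M S = span (emb ` S)"
proof
  have "span_in M S \<subseteq> pullback (span (emb ` S))"
    by (rule span_in_minimal[OF submodule_pullback])
      (use assms in \<open>auto simp: pullback_def intro: span_base\<close>)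
  then show "emb ` span_in M S \<subseteq> span (emb ` S)" by (auto simp: pullback_def)
  show "span (emb ` S) \<subseteq> emb ` span_in M S"
    by (rule span_minimal) (use span_in_base subspace_emb[OF submodule_span_in[OF assms]] in auto)
qed

text \<open>\<open>P\<close> is the ambient counterpart of being a stable subspace; a decomposition
  found in the ambient space is pulled back along \<open>emb\<close>.\<close>

lemma completely_reducible_I:
  assumes P: "\<And>W. W \<subseteq> carrier M \<Longrightarrow> stable_submodule M F W \<longleftrightarrow> P (emb ` W)"
    and sub: "\<And>S. P S \<Longrightarrow> S \<subseteq> image_space"
    and span: "span (\<Union>\<W>) = image_space"
    and irr: "\<And>S. S \<in> \<W> \<Longrightarrow> P S \<and> S \<noteq> {0} \<and> (\<forall>S'. P S' \<longrightarrow> S' \<subseteq> S \<longrightarrow> S' = {0} \<or> S' = S)"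
    and direct: "\<And>S. S \<in> \<W> \<Longrightarrow> S \<inter> span (\<Union>(\<W> - {S})) = {0}"
  shows "completely_reducible M F"
  unfolding completely_reducible_def
proof (intro exI conjI ballI)
  have pb: "pullback S \<subseteq> carrier M" for S by (auto simp: pullback_def)
  have \<W>: "S \<subseteq> image_space" if "S \<in> \<W>" for S using irr[OF that] sub by blast
  have emb_Un: "emb ` (\<Union>(pullback ` \<V>)) = \<Union>\<V>" if "\<V> \<subseteq> \<W>" for \<V>
  proof -
    have "emb ` pullback S = S" if "S \<in> \<V>" for S
      using emb_pullback[OF \<W>, of S] that \<open>\<V> \<subseteq> \<W>\<close> by blast
    then have "(\<Union>S\<in>\<V>. emb ` pullback S) = (\<Union>S\<in>\<V>. S)" by (intro SUP_cong) auto
    then show ?thesis by (simp only: image_UN image_ident)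
  qed
  show "irreducible_submodule M F W" if W: "W \<in> pullback ` \<W>" for W
    unfolding irreducible_submodule_def
  proof (intro conjI allI impI)
    obtain S where S: "S \<in> \<W>" "W = pullback S" using W by blast
    then have eW: "emb ` W = S" using emb_pullback \<W> by simp
    show "stable_submodule M F W" using P[of W] irr[OF S(1)] eW pb S(2) by simp
    show "W \<noteq> {\<zero>}" using eW irr[OF S(1)] by auto
    fix W' assume W': "stable_submodule M F W'" "W' \<subseteq> W"
    have c: "W' \<subseteq> carrier M" using W' pb S(2) by blast
    have "P (emb ` W')" using P[OF c] W'(1) by blast
    moreover have "emb ` W' \<subseteq> S" using W'(2) eW by blast
    ultimately have "emb ` W' = {0} \<or> emb ` W' = S" using irr[OF S(1)] by blast
    moreover have "W' = pullback (emb ` W')" using pullback_emb[OF c] by simp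
    moreover have "pullback {0} = {\<zero>}"
      using emb_inj[of _ \<zero>] by (auto simp: pullback_def)
    ultimately show "W' = {\<zero>} \<or> W' = W" using S(2) by metis
  qed
  show "internal_direct_sum M (pullback ` \<W>)"
    unfolding internal_direct_sum_def
  proof (intro conjI ballI)
    have c: "\<Union>(pullback ` \<W>) \<subseteq> carrier M" using pb by blast
    have "emb ` span_in M (\<Union>(pullback ` \<W>)) = emb ` carrier M"
      unfolding emb_span_in[OF c] emb_Un[OF order_refl] by (rule span)
    then show "span_in M (\<Union>(pullback ` \<W>)) = carrier M"
      using pullback_emb submodule_CC_E(1)[OF submodule_span_in[OF c]] by (metis order_refl)
    fix W assume "W \<in> pullback ` \<W>"
    then obtain S where S: "S \<in> \<W>" "W = pullback S" by blast
    \<comment> \<open>\<open>pullback\<close> is injective on \<open>\<W>\<close>, so it does not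
      matter whether the summand is removed before or after pulling back.\<close>
    have inj: "S' = S''" if "S' \<in> \<W>" "S'' \<in> \<W>" "pullback S' = pullback S''" for S' S''
      using that emb_pullback[OF \<W>] by metis
    have "pullback ` \<W> - {W} = pullback ` (\<W> - {S})"
    proof (intro equalityI subsetI)
      fix U assume "U \<in> pullback ` \<W> - {W}"
      then show "U \<in> pullback ` (\<W> - {S})" using S by blast
    next
      fix U assume "U \<in> pullback ` (\<W> - {S})"
      then obtain S' where "S' \<in> \<W>" "S' \<noteq> S" "U = pullback S'" by blast
      then show "U \<in> pullback ` \<W> - {W}" using S inj[of S' S] by blast
    qed
    then have eq: "emb ` \<Union>(pullback ` \<W> - {W}) = \<Union>(\<W> - {S})"
      using emb_Un[of "\<W> - {S}"] by auto
    have c: "\<Union>(pullback ` \<W> - {W}) \<subseteq> carrier M" using pb by blast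
    let ?R = "span_in M (\<Union>(pullback ` \<W> - {W}))"
    have R: "submodule ?R CC M" by (rule submodule_span_in[OF c])
    have W: "submodule W CC M"
      using irr[OF S(1)] P[OF pb, of S] emb_pullback[OF \<W>[OF S(1)]] S(2) by (simp add: stable_submodule_def)
    have "x = \<zero>" if x: "x \<in> W" "x \<in> ?R" for x
    proof -
      have xc: "x \<in> carrier M" using x(1) S(2) pb by blast
      have "emb x \<in> S" using x(1) S(2) by (simp add: pullback_def)
      moreover have "emb x \<in> span (\<Union>(\<W> - {S}))" using imageI[OF x(2), of emb] unfolding emb_span_in[OF c] eq .
      ultimately have "emb x = 0" using direct[OF S(1)] by blast
      then show ?thesis using emb_inj[OF xc zero_closed] by simp
    qed
    then show "W \<inter> ?R = {\<zero>}"
      using submodule_CC_E(2)[OF W] submodule_CC_E(2)[OF R] by blast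
  qed
qed

end

text \<open>Extend a basis of \<open>K\<close> to a basis of the whole space and send the basis
  vectors from \<open>K\<close> to zero: \<open>\<pi>\<close> projects onto a complement of
  \<open>K\<close>.\<close>

lemma (in complex_space) ex_projection_along:
  assumes "subspace K"
  obtains \<pi> where "endo \<pi>" "\<And>p. \<pi> p - p \<in> K" "\<And>p. p \<in> K \<Longrightarrow> \<pi> p = 0"
proof -
  interpret pair: vector_space_pair scale scale by unfold_locales
  obtain B where B: "B \<subseteq> K" "independent B" "K \<subseteq> span B"
    using maximal_independent_subset[of K] by blast
  let ?B = "extend_basis B"
  note E = extend_basis_superset[OF B(2)] independent_extend_basis[OF B(2)] span_extend_basis[OF B(2)]
  define \<pi> where "\<pi> = pair.construct ?B (\<lambda>b. if b \<in> B then 0 else b)"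
  have lin: "endo \<pi>" unfolding \<pi>_def by (rule pair.linear_construct[OF E(2)])
  have val: "\<pi> b = (if b \<in> B then 0 else b)" if "b \<in> ?B" for b
    unfolding \<pi>_def by (rule pair.construct_basis[OF E(2) that])
  have "\<pi> p \<in> {0}" if "p \<in> K" for p
    by (rule endo_span[OF lin, of B]) (use val E(1) B that in auto)
  moreover have "\<pi> p - p \<in> K" for p
  proof -
    have "p \<in> span ?B" using E(3) by simp
    then show ?thesis
    proof (induction rule: span_induct_alt)
      case base
      then show ?case by (simp add: endo_zero[OF lin] subspace_0[OF assms])
    next
      case (step c b p)
      have "\<pi> b - b \<in> K"
        using val[OF step(1)] B(1) assms by (cases "b \<in> B") (auto intro: subspace_neg subspace_0)
      then have "scale c (\<pi> b - b) + (\<pi> p - p) \<in> K"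
        using step(2) assms by (intro subspace_add subspace_scale)
      moreover have "scale c (\<pi> b - b) + (\<pi> p - p) = \<pi> (scale c b + p) - (scale c b + p)"
        by (simp add: endo_add[OF lin] endo_scale[OF lin] scale_right_diff_distrib)
      ultimately show ?case by simp
    qed
  qed
  ultimately show ?thesis using that lin by blast
qed

section \<open>Embedding a module into the formal linear combinations of its elements\<close>

definition poly_scale :: "complex \<Rightarrow> ('a \<Rightarrow>\<^sub>0 complex) \<Rightarrow> ('a \<Rightarrow>\<^sub>0 complex)"
  where "poly_scale c = Poly_Mapping.map (\<lambda>a. c * a)"

lemma lookup_poly_scale [simp]: "Poly_Mapping.lookup (poly_scale c p) x = c * Poly_Mapping.lookup p x"
  by (simp add: poly_scale_def map.rep_eq when_def)

interpretation poly_scale: complex_space poly_scale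
  by unfold_locales (auto intro!: poly_mapping_eqI simp: lookup_add algebra_simps)

context complex_module
begin

text \<open>Keys outside the carrier are ignored, which makes evaluation linear on all formal
  combinations.\<close>

definition eval_comb :: "('b \<Rightarrow>\<^sub>0 complex) \<Rightarrow> 'b"
  where "eval_comb p = (\<Oplus>v\<in>Poly_Mapping.keys p \<inter> carrier M. Poly_Mapping.lookup p v \<odot> v)"

lemma eval_comb_superset:
  assumes "finite A" "Poly_Mapping.keys p \<inter> carrier M \<subseteq> A" "A \<subseteq> carrier M"
  shows "eval_comb p = (\<Oplus>v\<in>A. Poly_Mapping.lookup p v \<odot> v)"
  unfolding eval_comb_def
  by (rule add.finprod_mono_neutral_cong_left) (use assms in \<open>auto simp: in_keys_iff\<close>)

lemma eval_comb_closed: "eval_comb p \<in> carrier M"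
  unfolding eval_comb_def by (rule finsum_closed) auto

lemma eval_comb_add: "eval_comb (p + q) = eval_comb p \<oplus> eval_comb q"
proof -
  let ?A = "(Poly_Mapping.keys p \<union> Poly_Mapping.keys q) \<inter> carrier M"
  have "eval_comb r = (\<Oplus>v\<in>?A. Poly_Mapping.lookup r v \<odot> v)"
    if "Poly_Mapping.keys r \<subseteq> Poly_Mapping.keys p \<union> Poly_Mapping.keys q" for r
    by (rule eval_comb_superset) (use that in auto)
  note eq = this[OF Poly_Mapping.keys_add] this[of p] this[of q]
  have "(\<Oplus>v\<in>?A. Poly_Mapping.lookup (p + q) v \<odot> v)
      = (\<Oplus>v\<in>?A. Poly_Mapping.lookup p v \<odot> v \<oplus> Poly_Mapping.lookup q v \<odot> v)"
    by (rule finsum_cong') (auto simp: lookup_add add_smult)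
  also have "\<dots> = (\<Oplus>v\<in>?A. Poly_Mapping.lookup p v \<odot> v) \<oplus> (\<Oplus>v\<in>?A. Poly_Mapping.lookup q v \<odot> v)"
    by (rule finsum_addf) auto
  finally show ?thesis using eq by simp
qed

lemma eval_comb_scale: "eval_comb (poly_scale c p) = c \<odot> eval_comb p"
proof -
  let ?A = "Poly_Mapping.keys p \<inter> carrier M"
  have "eval_comb (poly_scale c p) = (\<Oplus>v\<in>?A. Poly_Mapping.lookup (poly_scale c p) v \<odot> v)"
    by (rule eval_comb_superset) (auto simp: in_keys_iff)
  also have "\<dots> = (\<Oplus>v\<in>?A. c \<odot> (Poly_Mapping.lookup p v \<odot> v))"
    by (rule finsum_cong') (auto simp: smult_smult)
  also have "\<dots> = c \<odot> eval_comb p"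
    unfolding eval_comb_def by (rule finsum_smult_ldistr[symmetric]) auto
  finally show ?thesis .
qed

lemma eval_comb_single: "v \<in> carrier M \<Longrightarrow> eval_comb (Poly_Mapping.single v 1) = v"
  by (subst eval_comb_superset[of "{v}"]) (auto simp: finsum_insert)

text \<open>The quotient of the space of formal linear combinations by the kernel of evaluation is
  realized as a complement of the kernel.\<close>

theorem ex_embedding: "\<exists>(emb :: 'b \<Rightarrow> 'b \<Rightarrow>\<^sub>0 complex) ev. embedded_module poly_scale M emb ev"
proof -
  let ?K = "{p. eval_comb p = \<zero>}"
  have "eval_comb 0 = \<zero>" using eval_comb_scale[of 0 0] eval_comb_closed[of 0] by simp
  then have "poly_scale.subspace ?K"
    by (intro poly_scale.subspaceI) (simp_all add: eval_comb_add eval_comb_scale)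
  then obtain \<pi> where \<pi>: "poly_scale.endo \<pi>" "\<And>p. \<pi> p - p \<in> ?K" "\<And>p. p \<in> ?K \<Longrightarrow> \<pi> p = 0"
    by (rule poly_scale.ex_projection_along) (rule that)
  let ?s = "\<lambda>v. Poly_Mapping.single v (1::complex)"
  have minus: "eval_comb (p - q) = eval_comb p \<oplus> (- 1) \<odot> eval_comb q" for p q
  proof -
    have "p - q = p + poly_scale (- 1) q" by simp
    then show ?thesis by (simp only: eval_comb_add eval_comb_scale)
  qed
  \<comment> \<open>\<open>?s\<close> itself is not additive: \<open>?s (x \<oplus> y)\<close> and
    \<open>?s x + ?s y\<close> differ by an element of the kernel of evaluation, which
    \<open>\<pi>\<close> kills.\<close>
  have \<pi>_eqI: "\<pi> p = \<pi> q" if "eval_comb p = eval_comb q" for p q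
  proof -
    have "eval_comb (p - q) = \<zero>"
      using that eval_comb_closed[of q] minus_smult[of "eval_comb q" "eval_comb q"]
      by (simp add: minus a_minus_def r_neg)
    then have "\<pi> (p - q) = 0" using \<pi>(3) by simp
    then show ?thesis by (simp add: poly_scale.endo_diff[OF \<pi>(1)])
  qed
  have eval_\<pi>: "eval_comb (\<pi> p) = eval_comb p" for p
  proof -
    have "eval_comb ((\<pi> p - p) + p) = eval_comb p"
      unfolding eval_comb_add using \<pi>(2)[of p] eval_comb_closed by simp
    then show ?thesis by simp
  qed
  have "embedded_module poly_scale M (\<lambda>v. \<pi> (?s v)) eval_comb"
  proof (intro embedded_module.intro embedded_module_axioms.intro)
    fix x y c assume xy: "x \<in> carrier M" "y \<in> carrier M"
    show "\<pi> (?s (x \<oplus> y)) = \<pi> (?s x) + \<pi> (?s y)"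
      using xy unfolding poly_scale.endo_add[OF \<pi>(1), symmetric]
      by (intro \<pi>_eqI) (simp add: eval_comb_single eval_comb_add)
    show "\<pi> (?s (c \<odot> x)) = poly_scale c (\<pi> (?s x))"
      using xy unfolding poly_scale.endo_scale[OF \<pi>(1), symmetric]
      by (intro \<pi>_eqI) (simp add: eval_comb_single eval_comb_scale)
  qed (unfold_locales, simp_all add: eval_\<pi> eval_comb_single eval_comb_closed eval_comb_add eval_comb_scale)
  then show ?thesis by (intro exI)
qed

end


section \<open>Enveloping algebras and induced modules\<close>

lemma free_algebra_simps:
  "carrier (free_algebra L) = {p. Poly_Mapping.keys p \<subseteq> lists (carrier L)}"
  "\<zero>\<^bsub>free_algebra L\<^esub> = 0" "p \<oplus>\<^bsub>free_algebra L\<^esub> q = p + q"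
  "c \<odot>\<^bsub>free_algebra L\<^esub> p = poly_scale c p" "\<one>\<^bsub>free_algebra L\<^esub> = Poly_Mapping.single [] 1"
  by (simp_all add: free_algebra_def poly_scale_def)

text \<open>Concatenation of words, extended bilinearly. It is stated without \<open>L\<close>, on
  which it does not depend.\<close>

definition fmult :: "('b list \<Rightarrow>\<^sub>0 complex) \<Rightarrow> ('b list \<Rightarrow>\<^sub>0 complex) \<Rightarrow> ('b list \<Rightarrow>\<^sub>0 complex)"
  where "fmult p q = (\<Sum>u\<in>Poly_Mapping.keys p. \<Sum>v\<in>Poly_Mapping.keys q.
    Poly_Mapping.single (u @ v) (Poly_Mapping.lookup p u * Poly_Mapping.lookup q v))"

lemma free_algebra_mult: "p \<otimes>\<^bsub>free_algebra L\<^esub> q = fmult p q"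
  by (simp add: free_algebra_def fmult_def)

lemma fmult_superset:
  assumes "finite A" "Poly_Mapping.keys p \<subseteq> A" "finite B" "Poly_Mapping.keys q \<subseteq> B"
  shows "fmult p q = (\<Sum>u\<in>A. \<Sum>v\<in>B. Poly_Mapping.single (u @ v) (Poly_Mapping.lookup p u * Poly_Mapping.lookup q v))"
proof -
  have "fmult p q = (\<Sum>u\<in>Poly_Mapping.keys p. \<Sum>v\<in>B. Poly_Mapping.single (u @ v) (Poly_Mapping.lookup p u * Poly_Mapping.lookup q v))"
    unfolding fmult_def
    by (intro sum.cong[OF refl] sum.mono_neutral_left) (use assms in \<open>auto simp: in_keys_iff\<close>)
  also have "\<dots> = (\<Sum>u\<in>A. \<Sum>v\<in>B. Poly_Mapping.single (u @ v) (Poly_Mapping.lookup p u * Poly_Mapping.lookup q v))"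
    by (intro sum.mono_neutral_left) (use assms in \<open>auto simp: in_keys_iff\<close>)
  finally show ?thesis .
qed

lemma fmult_add_left: "fmult (p + p') q = fmult p q + fmult p' q"
proof -
  let ?A = "Poly_Mapping.keys p \<union> Poly_Mapping.keys p'" and ?B = "Poly_Mapping.keys q"
  note sup = fmult_superset[of ?A _ ?B q]
  show ?thesis
    using Poly_Mapping.keys_add[of p p']
    by (simp add: sup sum.distrib[symmetric] lookup_add distrib_right single_add)
qed

lemma fmult_add_right: "fmult p (q + q') = fmult p q + fmult p q'"
proof -
  let ?A = "Poly_Mapping.keys p" and ?B = "Poly_Mapping.keys q \<union> Poly_Mapping.keys q'"
  note sup = fmult_superset[of ?A p ?B]
  show ?thesis
    using Poly_Mapping.keys_add[of q q']
    by (simp add: sup sum.distrib[symmetric] lookup_add distrib_left single_add)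
qed

lemma fmult_single: "fmult (Poly_Mapping.single u c) (Poly_Mapping.single v d) = Poly_Mapping.single (u @ v) (c * d)"
  by (subst fmult_superset[of "{u}" _ "{v}"]) auto

lemma fmult_zero [simp]: "fmult 0 q = 0" "fmult p 0 = 0"
  by (simp_all add: fmult_def)

lemma poly_mapping_add_induct [case_names zero add]:
  fixes p :: "'a \<Rightarrow>\<^sub>0 'b::comm_monoid_add"
  assumes "P 0" and "\<And>w c p. P p \<Longrightarrow> P (Poly_Mapping.single w c + p)"
  shows "P p"
proof -
  have "P (\<Sum>w\<in>A. Poly_Mapping.single w (Poly_Mapping.lookup p w))" if "finite A" for A
    using that by (induction A) (auto simp: assms)
  moreover have "p = (\<Sum>w\<in>Poly_Mapping.keys p. Poly_Mapping.single w (Poly_Mapping.lookup p w))"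
    by (rule poly_mapping_eqI) (simp add: lookup_sum lookup_single when_def in_keys_iff)
  ultimately show ?thesis by (metis finite_keys)
qed

lemma fmult_scale_left: "fmult (poly_scale c p) q = poly_scale c (fmult p q)"
  and fmult_scale_right: "fmult p (poly_scale c q) = poly_scale c (fmult p q)"
proof -
  have ps: "poly_scale c (Poly_Mapping.single w d) = Poly_Mapping.single w (c * d)" for w :: "'z list" and c d
    by (rule poly_mapping_eqI) (simp add: lookup_single when_def)
  have pa: "poly_scale c (p + q) = poly_scale c p + poly_scale c q" for p q :: "'z list \<Rightarrow>\<^sub>0 complex"
    by (rule poly_mapping_eqI) (simp add: lookup_add distrib_left)
  have p0: "poly_scale c 0 = (0 :: 'z list \<Rightarrow>\<^sub>0 complex)"
    by (rule poly_mapping_eqI) simp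
  have 1: "fmult (poly_scale c (Poly_Mapping.single w d)) q = poly_scale c (fmult (Poly_Mapping.single w d) q)"
    "fmult (Poly_Mapping.single w d) (poly_scale c q) = poly_scale c (fmult (Poly_Mapping.single w d) q)"
    for w d and q :: "'a list \<Rightarrow>\<^sub>0 complex"
    by (induction q rule: poly_mapping_add_induct)
      (simp_all add: fmult_add_right pa ps p0 fmult_single mult.left_commute mult.assoc)
  show "fmult (poly_scale c p) q = poly_scale c (fmult p q)"
    "fmult p (poly_scale c q) = poly_scale c (fmult p q)"
    by (induction p rule: poly_mapping_add_induct) (simp_all add: fmult_add_left pa p0 1)
qed

lemma fmult_assoc: "fmult (fmult p q) r = fmult p (fmult q r)"
proof -
  have 1: "fmult (fmult (Poly_Mapping.single u c) (Poly_Mapping.single v d)) r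
      = fmult (Poly_Mapping.single u c) (fmult (Poly_Mapping.single v d) r)" for u v c d and r :: "'a list \<Rightarrow>\<^sub>0 complex"
    by (induction r rule: poly_mapping_add_induct) (simp_all add: fmult_add_right fmult_single mult.assoc)
  have 2: "fmult (fmult (Poly_Mapping.single u c) q) r
      = fmult (Poly_Mapping.single u c) (fmult q r)" for u c and q :: "'a list \<Rightarrow>\<^sub>0 complex"
    by (induction q rule: poly_mapping_add_induct) (simp_all add: fmult_add_right fmult_add_left 1)
  show ?thesis
    by (induction p rule: poly_mapping_add_induct) (simp_all add: fmult_add_left 2)
qed

lemma fmult_one: "fmult (Poly_Mapping.single [] 1) p = p" "fmult p (Poly_Mapping.single [] 1) = p"
  by (induction p rule: poly_mapping_add_induct) (simp_all add: fmult_add_right fmult_add_left fmult_single)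

lemma keys_fmult: "Poly_Mapping.keys (fmult p q) \<subseteq> {u @ v | u v. u \<in> Poly_Mapping.keys p \<and> v \<in> Poly_Mapping.keys q}"
  unfolding fmult_def
  by (intro order.trans[OF Poly_Mapping.keys_sum] UN_least) (auto split: if_splits)

lemma free_algebra_closed:
  "p \<in> carrier (free_algebra L) \<Longrightarrow> q \<in> carrier (free_algebra L) \<Longrightarrow> p + q \<in> carrier (free_algebra L)"
  "p \<in> carrier (free_algebra L) \<Longrightarrow> q \<in> carrier (free_algebra L) \<Longrightarrow> p - q \<in> carrier (free_algebra L)"
  "p \<in> carrier (free_algebra L) \<Longrightarrow> poly_scale c p \<in> carrier (free_algebra L)"
  "p \<in> carrier (free_algebra L) \<Longrightarrow> q \<in> carrier (free_algebra L) \<Longrightarrow> fmult p q \<in> carrier (free_algebra L)"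
  "x \<in> carrier L \<Longrightarrow> letter x \<in> carrier (free_algebra L)"
  "Poly_Mapping.single [] c \<in> carrier (free_algebra L)"
  "0 \<in> carrier (free_algebra L)"
proof -
  assume "p \<in> carrier (free_algebra L)" "q \<in> carrier (free_algebra L)"
  then have pq: "Poly_Mapping.keys p \<subseteq> lists (carrier L)" "Poly_Mapping.keys q \<subseteq> lists (carrier L)"
    by (simp_all add: free_algebra_simps)
  show "p + q \<in> carrier (free_algebra L)" "p - q \<in> carrier (free_algebra L)"
    unfolding free_algebra_simps
    using Poly_Mapping.keys_add[of p q] keys_diff[of p q] pq by (simp_all only: mem_Collect_eq) blast+
  have "{u @ v | u v. u \<in> Poly_Mapping.keys p \<and> v \<in> Poly_Mapping.keys q} \<subseteq> lists (carrier L)"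
  proof (intro subsetI, elim CollectE exE conjE)
    fix w u v assume "u \<in> Poly_Mapping.keys p" "v \<in> Poly_Mapping.keys q" and w: "w = u @ v"
    then have "u \<in> lists (carrier L)" "v \<in> lists (carrier L)" using pq by blast+
    then show "w \<in> lists (carrier L)" using w by simp
  qed
  then show "fmult p q \<in> carrier (free_algebra L)"
    unfolding free_algebra_simps using keys_fmult[of p q] by blast
next
  assume "p \<in> carrier (free_algebra L)"
  then show "poly_scale c p \<in> carrier (free_algebra L)"
    by (auto simp: free_algebra_simps in_keys_iff subset_iff)
qed (simp_all add: free_algebra_simps letter_def)

lemma ring_free_algebra: "ring (free_algebra L)"
proof (rule ringI)
  show "abelian_group (free_algebra L)"
  proof (rule abelian_groupI)
    fix p assume "p \<in> carrier (free_algebra L)"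
    from free_algebra_closed(2)[OF free_algebra_closed(7) this] have "- p \<in> carrier (free_algebra L)" by simp
    then show "\<exists>q\<in>carrier (free_algebra L). q \<oplus>\<^bsub>free_algebra L\<^esub> p = \<zero>\<^bsub>free_algebra L\<^esub>"
      by (intro bexI[of _ "- p"]) (simp_all add: free_algebra_simps(2,3))
  qed (simp_all add: free_algebra_simps(2,3) free_algebra_closed algebra_simps)
  show "Group.monoid (free_algebra L)"
    by (rule monoidI)
      (simp_all add: free_algebra_mult free_algebra_simps(5) free_algebra_closed fmult_assoc fmult_one)
qed (simp_all add: free_algebra_mult free_algebra_simps(3) fmult_add_left fmult_add_right)

lemma module_free_algebra: "Module.module CC (free_algebra L)"
proof (rule moduleI)
  show "abelian_group (free_algebra L)" by (rule ring.axioms(1)[OF ring_free_algebra])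
qed (auto intro!: poly_mapping_eqI
      simp: cring_CC free_algebra_simps(2-4) free_algebra_closed lookup_add algebra_simps)

text \<open>Closure of \<open>L\<close> under its operations keeps the defining relations inside the
  free algebra. \<open>P\<close> and \<open>\<chi>\<close> play the part of the subalgebra and the
  character from which one induces.\<close>

locale closed_bracket =
  fixes L :: "(complex, 'b, 'm) lie_algebra_scheme"
    and P :: "'b set" and \<chi> :: "'b \<Rightarrow> complex"
  assumes add_L: "x \<in> carrier L \<Longrightarrow> y \<in> carrier L \<Longrightarrow> x \<oplus>\<^bsub>L\<^esub> y \<in> carrier L"
    and smult_L: "x \<in> carrier L \<Longrightarrow> c \<odot>\<^bsub>L\<^esub> x \<in> carrier L"
    and bracket_L: "x \<in> carrier L \<Longrightarrow> y \<in> carrier L \<Longrightarrow> lie_bracket L x y \<in> carrier L"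
    and P_L: "P \<subseteq> carrier L"
begin

abbreviation F where "F \<equiv> free_algebra L"
abbreviation I where "I \<equiv> uea_ideal L"

lemma uea_relations_closed: "uea_relations L \<subseteq> carrier F"
  by (auto simp: uea_relations_def Let_def free_algebra_mult free_algebra_simps(4)
      intro!: free_algebra_closed add_L smult_L bracket_L)

lemma ideal_I: "ideal I F"
  unfolding uea_ideal_def by (rule ring.genideal_ideal[OF ring_free_algebra uea_relations_closed])

lemma relations_I: "r \<in> uea_relations L \<Longrightarrow> r \<in> I"
  unfolding uea_ideal_def using ring.genideal_self[OF ring_free_algebra uea_relations_closed] by blast

lemma submodule_I: "submodule I CC F"
proof (rule complex_module.submodule_CC_I[OF complex_module.intro[OF module_free_algebra]])
  interpret ideal I F by (rule ideal_I)
  show "I \<subseteq> carrier F" "\<zero>\<^bsub>F\<^esub> \<in> I" by (simp_all add: a_subset)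
  show "x \<oplus>\<^bsub>F\<^esub> y \<in> I" if "x \<in> I" "y \<in> I" for x y using that by simp
  fix c x assume x: "x \<in> I"
  have "Poly_Mapping.single [] c \<otimes>\<^bsub>F\<^esub> x \<in> I"
    by (rule I_l_closed[OF x]) (rule free_algebra_closed)
  moreover have "Poly_Mapping.single [] c = poly_scale c (Poly_Mapping.single [] 1 :: 'b list \<Rightarrow>\<^sub>0 complex)"
    by (rule poly_mapping_eqI) (simp add: lookup_single when_def)
  ultimately show "c \<odot>\<^bsub>F\<^esub> x \<in> I"
    by (simp add: free_algebra_mult free_algebra_simps(4) fmult_scale_left fmult_one)
qed

sublocale FI: quotient_space F I
  by (intro quotient_space.intro complex_module.intro quotient_space_axioms.intro module_free_algebra submodule_I)

abbreviation U where "U \<equiv> uea L"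

definition q :: "('b list \<Rightarrow>\<^sub>0 complex) \<Rightarrow> ('b list \<Rightarrow>\<^sub>0 complex) set"
  where "q p = I +>\<^bsub>F\<^esub> p"

lemma U_facts:
  "carrier U = {q p | p. p \<in> carrier F}"
  "p \<in> carrier F \<Longrightarrow> r \<in> carrier F \<Longrightarrow> q p \<oplus>\<^bsub>U\<^esub> q r = q (p + r)"
  "p \<in> carrier F \<Longrightarrow> c \<odot>\<^bsub>U\<^esub> q p = q (poly_scale c p)"
  "p \<in> carrier F \<Longrightarrow> r \<in> carrier F \<Longrightarrow> q p \<otimes>\<^bsub>U\<^esub> q r = q (fmult p r)"
  "\<one>\<^bsub>U\<^esub> = q (Poly_Mapping.single [] 1)"
  "uea_inj L x = q (letter x)"
  "p \<in> carrier F \<Longrightarrow> p \<in> I \<Longrightarrow> q p = \<zero>\<^bsub>U\<^esub>"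
proof -
  show "carrier U = {q p | p. p \<in> carrier F}"
    unfolding uea_def q_def by (rule FI.carrier_quot)
  show "p \<in> carrier F \<Longrightarrow> r \<in> carrier F \<Longrightarrow> q p \<oplus>\<^bsub>U\<^esub> q r = q (p + r)"
    unfolding uea_def q_def by (simp add: FI.add_coset free_algebra_simps(3))
  show "p \<in> carrier F \<Longrightarrow> c \<odot>\<^bsub>U\<^esub> q p = q (poly_scale c p)"
    unfolding uea_def q_def by (simp add: FI.smult_coset free_algebra_simps(4))
  show "p \<in> carrier F \<Longrightarrow> r \<in> carrier F \<Longrightarrow> q p \<otimes>\<^bsub>U\<^esub> q r = q (fmult p r)"
    unfolding uea_def q_def FI.quot_simps(5) by (simp add: ideal.rcoset_mult_add[OF ideal_I] free_algebra_mult)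
  show "\<one>\<^bsub>U\<^esub> = q (Poly_Mapping.single [] 1)"
    unfolding uea_def q_def FI.quot_simps(6) by (simp add: free_algebra_simps(5))
  show "uea_inj L x = q (letter x)" by (simp add: uea_inj_def q_def)
  show "p \<in> carrier F \<Longrightarrow> p \<in> I \<Longrightarrow> q p = \<zero>\<^bsub>U\<^esub>"
    unfolding uea_def q_def FI.quot_simps(2) using FI.coset_eq_zero_iff by simp
qed

lemma q_closed: "p \<in> carrier F \<Longrightarrow> q p \<in> carrier U"
  by (auto simp: U_facts(1))

sublocale U: complex_module U
  unfolding uea_def by (rule complex_module.intro[OF FI.module_quot])

lemma q_eqI:
  assumes "p \<in> carrier F" "r \<in> carrier F" "p - r \<in> I"
  shows "q p = q r"
proof -
  have "q p = q (r + (p - r))" by simp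
  also have "\<dots> = q r \<oplus>\<^bsub>U\<^esub> q (p - r)"
    using U_facts(2)[OF assms(2) free_algebra_closed(2)[OF assms(1,2)]] by simp
  also have "\<dots> = q r"
    using U_facts(7)[OF _ assms(3)] free_algebra_closed(2)[OF assms(1,2)] q_closed[OF assms(2)] by simp
  finally show ?thesis .
qed

abbreviation R where "R \<equiv> balancing L P \<chi>"

lemma R_eq: "R = span_in U {q (fmult p (letter a)) \<ominus>\<^bsub>U\<^esub> \<chi> a \<odot>\<^bsub>U\<^esub> q p | p a. p \<in> carrier F \<and> a \<in> P}"
proof -
  have "{u \<otimes>\<^bsub>U\<^esub> uea_inj L a \<ominus>\<^bsub>U\<^esub> \<chi> a \<odot>\<^bsub>U\<^esub> u | u a. u \<in> carrier U \<and> a \<in> P}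
    = {q (fmult p (letter a)) \<ominus>\<^bsub>U\<^esub> \<chi> a \<odot>\<^bsub>U\<^esub> q p | p a. p \<in> carrier F \<and> a \<in> P}" (is "?A = ?B")
  proof (intro equalityI subsetI)
    fix x assume "x \<in> ?A"
    then obtain p a where "p \<in> carrier F" "a \<in> P" "x = q p \<otimes>\<^bsub>U\<^esub> uea_inj L a \<ominus>\<^bsub>U\<^esub> \<chi> a \<odot>\<^bsub>U\<^esub> q p"
      by (auto simp: U_facts(1))
    moreover from this have "letter a \<in> carrier F" using P_L by (intro free_algebra_closed) auto
    ultimately show "x \<in> ?B" by (auto simp: U_facts(4,6))
  next
    fix x assume "x \<in> ?B"
    then obtain p a where "p \<in> carrier F" "a \<in> P" "x = q (fmult p (letter a)) \<ominus>\<^bsub>U\<^esub> \<chi> a \<odot>\<^bsub>U\<^esub> q p"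
      by blast
    moreover from this have "letter a \<in> carrier F" using P_L by (intro free_algebra_closed) auto
    ultimately have "x = q p \<otimes>\<^bsub>U\<^esub> uea_inj L a \<ominus>\<^bsub>U\<^esub> \<chi> a \<odot>\<^bsub>U\<^esub> q p" by (simp add: U_facts(4,6))
    then show "x \<in> ?A" using q_closed[OF \<open>p \<in> carrier F\<close>] \<open>a \<in> P\<close> by blast
  qed
  then show ?thesis by (simp add: balancing_def Let_def)
qed

lemma R_gens_closed: "{q (fmult p (letter a)) \<ominus>\<^bsub>U\<^esub> \<chi> a \<odot>\<^bsub>U\<^esub> q p | p a. p \<in> carrier F \<and> a \<in> P} \<subseteq> carrier U"
  using P_L by (auto simp: U.minus_smult q_closed free_algebra_closed subset_iff)

lemma submodule_R: "submodule R CC U"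
  unfolding R_eq by (rule U.submodule_span_in[OF R_gens_closed])

sublocale UR: quotient_space U R
  by (intro quotient_space.intro quotient_space_axioms.intro submodule_R U.complex_module_axioms)

abbreviation N where "N \<equiv> quot_module U R"

text \<open>The composite of the two quotient maps from the free algebra to the induced module.
  Identities in the module are checked on representatives in the free algebra.\<close>

definition \<Phi> :: "('b list \<Rightarrow>\<^sub>0 complex) \<Rightarrow> ('b list \<Rightarrow>\<^sub>0 complex) set set"
  where "\<Phi> p = R +>\<^bsub>U\<^esub> q p"

definition act :: "'b \<Rightarrow> ('b list \<Rightarrow>\<^sub>0 complex) set set \<Rightarrow> ('b list \<Rightarrow>\<^sub>0 complex) set set"
  where "act z = coset_map U R (\<lambda>u. uea_inj L z \<otimes>\<^bsub>U\<^esub> u)"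

sublocale N: complex_module N
  by (rule complex_module.intro[OF UR.module_quot])

lemma carrier_N: "carrier N = {\<Phi> p | p. p \<in> carrier F}"
  by (auto simp: UR.carrier_quot U_facts(1) \<Phi>_def)

lemma \<Phi>_add: "p \<in> carrier F \<Longrightarrow> r \<in> carrier F \<Longrightarrow> \<Phi> (p + r) = \<Phi> p \<oplus>\<^bsub>N\<^esub> \<Phi> r"
  by (simp add: \<Phi>_def UR.add_coset q_closed U_facts(2))

lemma \<Phi>_scale: "p \<in> carrier F \<Longrightarrow> \<Phi> (poly_scale c p) = c \<odot>\<^bsub>N\<^esub> \<Phi> p"
  by (simp add: \<Phi>_def UR.smult_coset q_closed U_facts(3))

lemma \<Phi>_closed: "p \<in> carrier F \<Longrightarrow> \<Phi> p \<in> carrier N"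
  by (auto simp: carrier_N)

text \<open>\<open>I\<close> is two-sided, so its elements may be multiplied by any \<open>w\<close>
  on the right. This turns each defining relation into an identity between operators on the
  module.\<close>

lemma \<Phi>_relation:
  assumes "p \<in> carrier F" "r \<in> carrier F" "p - r \<in> I" "w \<in> carrier F"
  shows "\<Phi> (fmult p w) = \<Phi> (fmult r w)"
proof -
  have "(p - r) \<otimes>\<^bsub>F\<^esub> w \<in> I" by (rule ideal.I_r_closed[OF ideal_I assms(3,4)])
  moreover have "fmult p w = fmult r w + fmult (p - r) w"
    by (simp flip: fmult_add_left)
  ultimately have "fmult p w - fmult r w \<in> I" by (simp add: free_algebra_mult)
  then show ?thesis
    unfolding \<Phi>_def
    using q_eqI[OF free_algebra_closed(4)[OF assms(1,4)] free_algebra_closed(4)[OF assms(2,4)]] by simp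
qed

lemma \<Phi>_balanced:
  assumes p: "p \<in> carrier F" and a: "a \<in> P"
  shows "\<Phi> (fmult p (letter a)) = \<chi> a \<odot>\<^bsub>N\<^esub> \<Phi> p"
proof -
  have l: "letter a \<in> carrier F" using P_L a by (intro free_algebra_closed) auto
  have "q (fmult p (letter a)) \<ominus>\<^bsub>U\<^esub> \<chi> a \<odot>\<^bsub>U\<^esub> q p \<in> R"
    unfolding R_eq using p a by (intro subsetD[OF U.span_in_base]) blast
  then have "R +>\<^bsub>U\<^esub> q (fmult p (letter a)) = R +>\<^bsub>U\<^esub> (\<chi> a \<odot>\<^bsub>U\<^esub> q p)"
    using p l by (simp add: UR.coset_eq_iff q_closed free_algebra_closed)
  then show ?thesis by (simp add: \<Phi>_def UR.smult_coset q_closed p)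
qed

text \<open>The balancing relations concern multiplication on the right and are therefore respected
  by multiplication on the left. This makes the action on cosets well defined.\<close>

lemma R_left_ideal:
  assumes z: "z \<in> carrier L" and u: "u \<in> R"
  shows "q (letter z) \<otimes>\<^bsub>U\<^esub> u \<in> R"
proof -
  have l: "letter z \<in> carrier F" by (rule free_algebra_closed(5)[OF z])
  let ?W = "{u \<in> carrier U. q (letter z) \<otimes>\<^bsub>U\<^esub> u \<in> R}"
  note E = U.submodule_CC_E[OF submodule_R]
  have mult: "q (letter z) \<otimes>\<^bsub>U\<^esub> q p = q (fmult (letter z) p)" if "p \<in> carrier F" for p
    using U_facts(4)[OF l that] .
  have "submodule ?W CC U"
  proof (rule U.submodule_CC_I)
    have z0: "\<zero>\<^bsub>U\<^esub> = q 0"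
      using U_facts(7)[of 0] free_algebra_closed(7)[of L] FI.submodule_CC_E(2)[OF submodule_I]
      by (simp add: free_algebra_simps(2))
    have "q (letter z) \<otimes>\<^bsub>U\<^esub> \<zero>\<^bsub>U\<^esub> = \<zero>\<^bsub>U\<^esub>"
      unfolding z0 by (simp add: mult free_algebra_closed)
    then show "\<zero>\<^bsub>U\<^esub> \<in> ?W" using E(2) by simp
  next
    fix x y assume "x \<in> ?W" "y \<in> ?W"
    then obtain p r where pr: "p \<in> carrier F" "r \<in> carrier F" "x = q p" "y = q r"
      "q (letter z) \<otimes>\<^bsub>U\<^esub> q p \<in> R" "q (letter z) \<otimes>\<^bsub>U\<^esub> q r \<in> R"
      by (auto simp: U_facts(1))
    have "q (letter z) \<otimes>\<^bsub>U\<^esub> (x \<oplus>\<^bsub>U\<^esub> y) = q (letter z) \<otimes>\<^bsub>U\<^esub> q p \<oplus>\<^bsub>U\<^esub> q (letter z) \<otimes>\<^bsub>U\<^esub> q r"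
      using pr l by (simp add: U_facts(2) mult free_algebra_closed fmult_add_right)
    then show "x \<oplus>\<^bsub>U\<^esub> y \<in> ?W" using pr E(3) by (simp add: q_closed)
  next
    fix c x assume "x \<in> ?W"
    then obtain p where pr: "p \<in> carrier F" "x = q p" "q (letter z) \<otimes>\<^bsub>U\<^esub> q p \<in> R"
      by (auto simp: U_facts(1))
    have "q (letter z) \<otimes>\<^bsub>U\<^esub> (c \<odot>\<^bsub>U\<^esub> x) = c \<odot>\<^bsub>U\<^esub> (q (letter z) \<otimes>\<^bsub>U\<^esub> q p)"
      using pr l by (simp add: U_facts(3) mult free_algebra_closed fmult_scale_right)
    then show "c \<odot>\<^bsub>U\<^esub> x \<in> ?W" using pr E(4) by (simp add: q_closed)
  qed auto
  moreover have "{q (fmult p (letter a)) \<ominus>\<^bsub>U\<^esub> \<chi> a \<odot>\<^bsub>U\<^esub> q p | p a. p \<in> carrier F \<and> a \<in> P} \<subseteq> ?W"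
  proof (intro subsetI, elim CollectE exE conjE)
    fix x p a assume p: "p \<in> carrier F" and a: "a \<in> P"
      and x: "x = q (fmult p (letter a)) \<ominus>\<^bsub>U\<^esub> \<chi> a \<odot>\<^bsub>U\<^esub> q p"
    have la: "letter a \<in> carrier F" using P_L a by (intro free_algebra_closed) auto
    have g: "q (fmult r (letter a)) \<ominus>\<^bsub>U\<^esub> \<chi> a \<odot>\<^bsub>U\<^esub> q r
        = q (fmult r (letter a) + poly_scale (- \<chi> a) r)" if "r \<in> carrier F" for r
      using that la
      by (simp add: U.minus_smult U.smult_smult q_closed free_algebra_closed U_facts(2,3)
          del: poly_scale.scale_minus_left)
    have "q (letter z) \<otimes>\<^bsub>U\<^esub> (q (fmult p (letter a)) \<ominus>\<^bsub>U\<^esub> \<chi> a \<odot>\<^bsub>U\<^esub> q p)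
        = q (fmult (fmult (letter z) p) (letter a)) \<ominus>\<^bsub>U\<^esub> \<chi> a \<odot>\<^bsub>U\<^esub> q (fmult (letter z) p)"
      unfolding g[OF p] g[OF free_algebra_closed(4)[OF l p]]
      using p l la by (simp add: mult free_algebra_closed fmult_add_right fmult_scale_right fmult_assoc
          del: poly_scale.scale_minus_left)
    also have "\<dots> \<in> R"
      unfolding R_eq using free_algebra_closed(4)[OF l p] a by (intro subsetD[OF U.span_in_base]) blast
    finally show "x \<in> ?W"
      using p la x by (simp add: q_closed free_algebra_closed)
  qed
  ultimately have "R \<subseteq> ?W" unfolding R_eq by (rule U.span_in_minimal)
  then show ?thesis using u by blast
qed

lemma act_\<Phi>:
  assumes z: "z \<in> carrier L" and p: "p \<in> carrier F"
  shows "act z (\<Phi> p) = \<Phi> (fmult (letter z) p)"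
proof -
  have l: "letter z \<in> carrier F" by (rule free_algebra_closed(5)[OF z])
  have "act z (\<Phi> p) = R +>\<^bsub>U\<^esub> (q (letter z) \<otimes>\<^bsub>U\<^esub> q p)"
    unfolding act_def \<Phi>_def U_facts(6)
  proof (rule UR.coset_map_coset)
    show "(\<otimes>\<^bsub>U\<^esub>) (q (letter z)) \<in> carrier U \<rightarrow> carrier U"
      using l by (auto simp: U_facts(1,4) intro: free_algebra_closed)
    show "(\<otimes>\<^bsub>U\<^esub>) (q (letter z)) ` R \<subseteq> R" using R_left_ideal[OF z] by blast
    fix x y assume "x \<in> carrier U" "y \<in> carrier U"
    then obtain a b where "a \<in> carrier F" "b \<in> carrier F" "x = q a" "y = q b" by (auto simp: U_facts(1))
    then show "q (letter z) \<otimes>\<^bsub>U\<^esub> (x \<oplus>\<^bsub>U\<^esub> y) = q (letter z) \<otimes>\<^bsub>U\<^esub> x \<oplus>\<^bsub>U\<^esub> q (letter z) \<otimes>\<^bsub>U\<^esub> y"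
      using l by (simp add: U_facts(2,4) free_algebra_closed fmult_add_right)
  qed (rule q_closed[OF p])
  then show ?thesis using l p by (simp add: U_facts(4) \<Phi>_def)
qed

lemma act_linear: "z \<in> carrier L \<Longrightarrow> linear_on N N (act z)"
  unfolding linear_on_def
  by (auto simp: carrier_N act_\<Phi> free_algebra_closed fmult_add_right fmult_scale_right
      simp flip: \<Phi>_add \<Phi>_scale)

lemma act_add:
  assumes "x \<in> carrier L" "y \<in> carrier L" "v \<in> carrier N"
  shows "act (x \<oplus>\<^bsub>L\<^esub> y) v = act x v \<oplus>\<^bsub>N\<^esub> act y v"
proof -
  obtain p where p: "p \<in> carrier F" "v = \<Phi> p" using assms by (auto simp: carrier_N)
  have "letter (x \<oplus>\<^bsub>L\<^esub> y) - (letter x + letter y) \<in> I"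
    using assms by (intro relations_I) (auto simp: uea_relations_def Let_def)
  then have "\<Phi> (fmult (letter (x \<oplus>\<^bsub>L\<^esub> y)) p) = \<Phi> (fmult (letter x + letter y) p)"
    using assms p by (intro \<Phi>_relation) (auto intro: free_algebra_closed add_L)
  then show ?thesis
    using assms p by (simp add: act_\<Phi> add_L fmult_add_left \<Phi>_add free_algebra_closed)
qed

lemma act_smult:
  assumes "x \<in> carrier L" "v \<in> carrier N"
  shows "act (c \<odot>\<^bsub>L\<^esub> x) v = c \<odot>\<^bsub>N\<^esub> act x v"
proof -
  obtain p where p: "p \<in> carrier F" "v = \<Phi> p" using assms by (auto simp: carrier_N)
  have "letter (c \<odot>\<^bsub>L\<^esub> x) - c \<odot>\<^bsub>F\<^esub> letter x \<in> I"
    using assms by (intro relations_I) (auto simp: uea_relations_def Let_def)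
  then have "\<Phi> (fmult (letter (c \<odot>\<^bsub>L\<^esub> x)) p) = \<Phi> (fmult (poly_scale c (letter x)) p)"
    using assms p by (intro \<Phi>_relation) (auto simp: free_algebra_simps(4) intro: free_algebra_closed smult_L)
  then show ?thesis
    using assms p by (simp add: act_\<Phi> smult_L fmult_scale_left \<Phi>_scale free_algebra_closed)
qed

lemma act_bracket:
  assumes "x \<in> carrier L" "y \<in> carrier L" "v \<in> carrier N"
  shows "act x (act y v) = act y (act x v) \<oplus>\<^bsub>N\<^esub> act (lie_bracket L x y) v"
proof -
  obtain p where p: "p \<in> carrier F" "v = \<Phi> p" using assms by (auto simp: carrier_N)
  have l: "letter x \<in> carrier F" "letter y \<in> carrier F" "letter (lie_bracket L x y) \<in> carrier F"
    using assms by (auto intro: free_algebra_closed bracket_L)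
  have "letter x \<otimes>\<^bsub>F\<^esub> letter y - letter y \<otimes>\<^bsub>F\<^esub> letter x - letter (lie_bracket L x y) \<in> I"
    using assms by (intro relations_I) (auto simp: uea_relations_def Let_def)
  then have "fmult (letter x) (letter y) - (fmult (letter y) (letter x) + letter (lie_bracket L x y)) \<in> I"
    by (simp add: free_algebra_mult algebra_simps)
  then have "\<Phi> (fmult (fmult (letter x) (letter y)) p)
      = \<Phi> (fmult (fmult (letter y) (letter x) + letter (lie_bracket L x y)) p)"
    using l p by (intro \<Phi>_relation) (auto intro: free_algebra_closed)
  then show ?thesis
    using assms p l
    by (simp add: act_\<Phi> bracket_L fmult_add_left \<Phi>_add free_algebra_closed fmult_assoc)
qed

abbreviation vac where "vac \<equiv> R +>\<^bsub>U\<^esub> \<one>\<^bsub>U\<^esub>"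

lemma vac_eq: "vac = \<Phi> (Poly_Mapping.single [] 1)"
  by (simp add: \<Phi>_def U_facts(5))

lemma vac_closed: "vac \<in> carrier N"
  unfolding vac_eq by (rule \<Phi>_closed[OF free_algebra_closed(6)])

lemma act_vac:
  assumes "a \<in> P"
  shows "act a vac = \<chi> a \<odot>\<^bsub>N\<^esub> vac"
  using \<Phi>_balanced[OF free_algebra_closed(6) assms, of 1] P_L assms
  by (simp add: vac_eq act_\<Phi> free_algebra_closed fmult_one subset_iff)

text \<open>A word is its letters acting one after the other on the vacuum, and words span the free
  algebra.\<close>

lemma generated_by_vac:
  assumes W: "submodule W CC N" and v: "vac \<in> W" and s: "\<And>z w. z \<in> carrier L \<Longrightarrow> w \<in> W \<Longrightarrow> act z w \<in> W"
  shows "W = carrier N"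
proof -
  note E = N.submodule_CC_E[OF W]
  have word: "\<Phi> (Poly_Mapping.single w 1) \<in> W" if "w \<in> lists (carrier L)" for w
    using that
  proof (induction w)
    case Nil
    then show ?case using v by (simp add: vac_eq)
  next
    case (Cons z w)
    have "Poly_Mapping.single w 1 \<in> carrier F" using Cons by (simp add: free_algebra_simps)
    then have "act z (\<Phi> (Poly_Mapping.single w 1)) = \<Phi> (fmult (letter z) (Poly_Mapping.single w 1))"
      using Cons by (intro act_\<Phi>) auto
    moreover have "act z (\<Phi> (Poly_Mapping.single w 1)) \<in> W" using Cons by (intro s) auto
    ultimately show ?case by (simp add: letter_def fmult_single)
  qed
  have "\<Phi> p \<in> W" if p: "p \<in> carrier F" for p
  proof -
    have "(\<Sum>w\<in>A. Poly_Mapping.single w (Poly_Mapping.lookup p w)) \<in> carrier F \<and>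
        \<Phi> (\<Sum>w\<in>A. Poly_Mapping.single w (Poly_Mapping.lookup p w)) \<in> W"
      if "finite A" "A \<subseteq> lists (carrier L)" for A
      using that
    proof (induction A)
      case empty
      have "\<Phi> (poly_scale 0 0) = 0 \<odot>\<^bsub>N\<^esub> \<Phi> 0" by (rule \<Phi>_scale[OF free_algebra_closed(7)])
      then have "\<Phi> 0 = \<zero>\<^bsub>N\<^esub>" using \<Phi>_closed[OF free_algebra_closed(7)] by simp
      then show ?case using E(2) by (simp add: free_algebra_closed)
    next
      case (insert w A)
      have sw: "Poly_Mapping.single w c = poly_scale c (Poly_Mapping.single w 1)" for c
        by (rule poly_mapping_eqI) (simp add: lookup_single when_def)
      have w1: "Poly_Mapping.single w 1 \<in> carrier F" using insert by (simp add: free_algebra_simps)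
      have "\<Phi> (Poly_Mapping.single w c) \<in> W" for c
        unfolding sw[of c] \<Phi>_scale[OF w1] using word insert E(4) by simp
      moreover have "Poly_Mapping.single w c \<in> carrier F" for c
        unfolding sw[of c] by (rule free_algebra_closed(3)[OF w1])
      ultimately show ?case using insert E(3) by (simp add: \<Phi>_add free_algebra_closed)
    qed
    from this[of "Poly_Mapping.keys p"]
    have "\<Phi> (\<Sum>w\<in>Poly_Mapping.keys p. Poly_Mapping.single w (Poly_Mapping.lookup p w)) \<in> W"
      using p by (simp add: free_algebra_simps)
    moreover have "(\<Sum>w\<in>Poly_Mapping.keys p. Poly_Mapping.single w (Poly_Mapping.lookup p w)) = p"
      by (rule poly_mapping_eqI) (simp add: lookup_sum lookup_single when_def in_keys_iff)
    ultimately show ?thesis by simp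
  qed
  then show ?thesis using E(1) by (auto simp: carrier_N)
qed

end


section \<open>Weak modules of vertex algebras\<close>

context complex_module
begin

lemma fin_supp_sum_eq:
  assumes "finite A" "\<And>j. f j \<in> carrier M" "\<And>j. j \<notin> A \<Longrightarrow> f j = \<zero>"
  shows "fin_supp_sum M f = finsum M f A"
  unfolding fin_supp_sum_def
  by (rule add.finprod_mono_neutral_cong_left) (use assms in auto)

lemma fin_supp_sum_first:
  assumes "\<And>j. f j \<in> carrier M" "\<And>j. 0 < j \<Longrightarrow> f j = \<zero>"
  shows "fin_supp_sum M f = f 0"
  by (subst fin_supp_sum_eq[of "{0}"]) (use assms in \<open>auto simp: finsum_insert\<close>)

lemma fin_supp_sum_first_two:
  assumes "\<And>j. f j \<in> carrier M" "\<And>j. 1 < j \<Longrightarrow> f j = \<zero>"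
  shows "fin_supp_sum M f = f 0 \<oplus> f 1"
  by (subst fin_supp_sum_eq[of "{0, 1}"]) (use assms in \<open>auto simp: finsum_insert\<close>)

lemma fin_supp_sum_mem:
  assumes "submodule W CC M" "\<And>j. f j \<in> W"
  shows "fin_supp_sum M f \<in> W"
  unfolding fin_supp_sum_def by (rule submodule_finsum) (use assms in auto)

text \<open>Truncation is needed because an infinite \<open>finsum\<close> is zero by convention.\<close>

lemma fin_supp_sum_congruent:
  assumes W: "submodule W CC M" and f: "\<And>j. f j \<in> carrier M" "\<And>j. 0 < j \<Longrightarrow> f j \<in> W"
    and trunc: "\<And>j. n \<le> j \<Longrightarrow> f j = \<zero>"
  shows "fin_supp_sum M f \<ominus> f 0 \<in> W"
proof -
  have "fin_supp_sum M f = finsum M f (insert 0 {1..n})"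
    by (rule fin_supp_sum_eq) (use f trunc in \<open>auto simp: not_le\<close>)
  also have "\<dots> = f 0 \<oplus> finsum M f {1..n}" using f(1) by (simp add: finsum_insert)
  finally have eq: "fin_supp_sum M f = f 0 \<oplus> finsum M f {1..n}" .
  have s: "finsum M f {1..n} \<in> W" by (rule submodule_finsum[OF W]) (use f(2) in auto)
  then have "finsum M f {1..n} \<in> carrier M" using submodule_CC_E(1)[OF W] by blast
  then have "fin_supp_sum M f \<ominus> f 0 = finsum M f {1..n}"
    unfolding eq using f(1)[of 0] by (simp add: a_minus_def a_ac r_neg1 r_neg2)
  then show ?thesis using s by simp
qed

end

locale weak_vertex_module = V: complex_module V + M: complex_module M
  for V :: "(complex, 'v, 'p) module_scheme" and M :: "(complex, 'm, 'q) module_scheme" +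
  fixes vac :: 'v and Y :: "'v \<Rightarrow> int \<Rightarrow> 'v \<Rightarrow> 'v" and YM :: "'v \<Rightarrow> int \<Rightarrow> 'm \<Rightarrow> 'm"
  assumes weak: "weak_module V vac Y M YM"
    and Y_closed: "u \<in> carrier V \<Longrightarrow> v \<in> carrier V \<Longrightarrow> Y u n v \<in> carrier V"
    and vac_closed: "vac \<in> carrier V"
begin

lemma YM_linear: "v \<in> carrier V \<Longrightarrow> linear_on M M (YM v n)"
  and YM_linear_left: "w \<in> carrier M \<Longrightarrow> linear_on V M (\<lambda>v. YM v n w)"
  and truncation: "v \<in> carrier V \<Longrightarrow> w \<in> carrier M \<Longrightarrow> \<exists>n0. \<forall>n\<ge>n0. YM v n w = \<zero>\<^bsub>M\<^esub>"
  and YM_vac: "w \<in> carrier M \<Longrightarrow> YM vac n w = (if n = -1 then w else \<zero>\<^bsub>M\<^esub>)"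
  using weak by (auto simp: weak_module_def)

lemma YM_closed [simp]: "v \<in> carrier V \<Longrightarrow> w \<in> carrier M \<Longrightarrow> YM v n w \<in> carrier M"
  by (rule linear_onD(1)[OF YM_linear])

lemma YM_zero: "v \<in> carrier V \<Longrightarrow> YM v n \<zero>\<^bsub>M\<^esub> = \<zero>\<^bsub>M\<^esub>"
  using linear_onD(3)[OF YM_linear, of v "\<zero>\<^bsub>M\<^esub>" n 0] by simp

lemma YM_zero_left: "w \<in> carrier M \<Longrightarrow> YM \<zero>\<^bsub>V\<^esub> n w = \<zero>\<^bsub>M\<^esub>"
  using linear_onD(3)[OF YM_linear_left, of w "\<zero>\<^bsub>V\<^esub>" 0 n] by simp

lemma jacobi:
  assumes "u \<in> carrier V" "v \<in> carrier V" "w \<in> carrier M"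
  shows "fin_supp_sum M (\<lambda>j. ((of_int r :: complex) gchoose j) \<odot>\<^bsub>M\<^esub> YM (Y u (p + int j) v) (r + q - int j) w) =
      fin_supp_sum M (\<lambda>j. ((-1) ^ j * ((of_int p :: complex) gchoose j)) \<odot>\<^bsub>M\<^esub>
          (YM u (p + r - int j) (YM v (q + int j) w) \<ominus>\<^bsub>M\<^esub>
           ((-1) powi p) \<odot>\<^bsub>M\<^esub> YM v (p + q - int j) (YM u (r + int j) w)))"
  using weak assms unfolding weak_module_def jacobi_identity_def by blast

lemma minus_closed_M: "x \<in> carrier M \<Longrightarrow> y \<in> carrier M \<Longrightarrow> x \<ominus>\<^bsub>M\<^esub> y \<in> carrier M"
  by (simp add: M.minus_smult)

text \<open>The Jacobi identity at \<open>p = 0\<close>: on the right the coefficients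
  \<open>0 gchoose j\<close> vanish for positive \<open>j\<close>.\<close>

lemma commutator:
  assumes "u \<in> carrier V" "v \<in> carrier V" "w \<in> carrier M"
  shows "YM u r (YM v q w) \<ominus>\<^bsub>M\<^esub> YM v q (YM u r w) =
    fin_supp_sum M (\<lambda>j. ((of_int r :: complex) gchoose j) \<odot>\<^bsub>M\<^esub> YM (Y u (int j) v) (r + q - int j) w)"
proof -
  let ?f = "\<lambda>j. ((-1) ^ j * ((of_int 0 :: complex) gchoose j)) \<odot>\<^bsub>M\<^esub>
          (YM u (0 + r - int j) (YM v (q + int j) w) \<ominus>\<^bsub>M\<^esub>
           ((-1) powi 0) \<odot>\<^bsub>M\<^esub> YM v (0 + q - int j) (YM u (r + int j) w))"
  have "fin_supp_sum M ?f = ?f 0"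
    by (rule M.fin_supp_sum_first) (use assms in \<open>auto simp: minus_closed_M gbinomial_0_left\<close>)
  then show ?thesis using jacobi[OF assms, of r 0 q] assms by (simp add: minus_closed_M)
qed

text \<open>The Jacobi identity at \<open>r = 0\<close>, where the left side collapses to its first
  term.\<close>

lemma iterate:
  assumes "u \<in> carrier V" "v \<in> carrier V" "w \<in> carrier M"
  shows "YM (Y u p v) q w = fin_supp_sum M (\<lambda>j. ((-1) ^ j * ((of_int p :: complex) gchoose j)) \<odot>\<^bsub>M\<^esub>
          (YM u (p - int j) (YM v (q + int j) w) \<ominus>\<^bsub>M\<^esub>
           ((-1) powi p) \<odot>\<^bsub>M\<^esub> YM v (p + q - int j) (YM u (int j) w)))"
proof -
  let ?f = "\<lambda>j. ((of_int 0 :: complex) gchoose j) \<odot>\<^bsub>M\<^esub> YM (Y u (p + int j) v) (0 + q - int j) w"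
  have "fin_supp_sum M ?f = ?f 0"
    by (rule M.fin_supp_sum_first) (use assms in \<open>auto simp: Y_closed gbinomial_0_left\<close>)
  then show ?thesis using jacobi[OF assms, of 0 p q] assms by (simp add: Y_closed)
qed

text \<open>The vectors all of whose modes preserve \<open>W\<close> include the vacuum and, by the
  iterate formula, are closed under the modes of the generators.\<close>

lemma stable_under_generated:
  assumes W: "submodule W CC M" and G: "G \<subseteq> carrier V"
    and GW: "\<And>g n w. g \<in> G \<Longrightarrow> w \<in> W \<Longrightarrow> YM g n w \<in> W"
    and gen: "\<And>S. submodule S CC V \<Longrightarrow> vac \<in> S \<Longrightarrow> (\<And>g n s. g \<in> G \<Longrightarrow> s \<in> S \<Longrightarrow> Y g n s \<in> S) \<Longrightarrow> S = carrier V"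
    and v: "v \<in> carrier V" and w: "w \<in> W"
  shows "YM v n w \<in> W"
proof -
  let ?S = "{v \<in> carrier V. \<forall>n. \<forall>w\<in>W. YM v n w \<in> W}"
  note E = M.submodule_CC_E[OF W]
  have "?S = carrier V"
  proof (rule gen)
    show "submodule ?S CC V"
      by (rule V.submodule_CC_I)
        (use E in \<open>auto simp: YM_zero_left subset_iff linear_onD[OF YM_linear_left]\<close>)
    show "vac \<in> ?S" using vac_closed E by (auto simp: YM_vac subset_iff)
    fix g p s assume g: "g \<in> G" and s: "s \<in> ?S"
    have gV: "g \<in> carrier V" and sV: "s \<in> carrier V" using g G s by auto
    have "YM (Y g p s) q w \<in> W" if w: "w \<in> W" for q w
    proof -
      have wM: "w \<in> carrier M" using w E(1) by blast
      show ?thesis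
        unfolding iterate[OF gV sV wM]
        by (rule M.fin_supp_sum_mem[OF W]) (use g s w GW in \<open>auto intro!: E(4) E(5)\<close>)
    qed
    then show "Y g p s \<in> ?S" using Y_closed[OF gV sV] by simp
  qed
  then show ?thesis using v w by blast
qed

text \<open>In the expansion of mode 1 of \<open>Y x (-1) y\<close>, every term except the product
  of the two zero modes applies a positive mode of \<open>x\<close> or \<open>y\<close> to
  \<open>u\<close> first and so lands in \<open>W\<close>.\<close>

lemma iterate_congruent:
  assumes W: "submodule W CC M" and ab: "x \<in> carrier V" "y \<in> carrier V" and u: "u \<in> carrier M"
    and xW: "\<And>n w. w \<in> W \<Longrightarrow> YM x n w \<in> W" and yW: "\<And>n w. w \<in> W \<Longrightarrow> YM y n w \<in> W"
    and x: "\<And>n. 1 \<le> n \<Longrightarrow> YM x n u \<in> W" and y: "\<And>n. 1 \<le> n \<Longrightarrow> YM y n u \<in> W"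
  shows "YM (Y x (-1) y) 1 u \<ominus>\<^bsub>M\<^esub> YM y 0 (YM x 0 u) \<in> W"
proof -
  note E = M.submodule_CC_E[OF W]
  let ?f = "\<lambda>j. ((-1) ^ j * ((of_int (-1) :: complex) gchoose j)) \<odot>\<^bsub>M\<^esub>
          (YM x (-1 - int j) (YM y (1 + int j) u) \<ominus>\<^bsub>M\<^esub>
           ((-1) powi (-1)) \<odot>\<^bsub>M\<^esub> YM y (-1 + 1 - int j) (YM x (int j) u))"
  obtain n0 where n0: "\<And>n. n \<ge> n0 \<Longrightarrow> YM x n u = \<zero>\<^bsub>M\<^esub>" using truncation[OF ab(1) u] by blast
  obtain n1 where n1: "\<And>n. n \<ge> n1 \<Longrightarrow> YM y n u = \<zero>\<^bsub>M\<^esub>" using truncation[OF ab(2) u] by blast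
  have mem: "?f j \<in> W" if "0 < j" for j
    using that by (intro E(4) E(5) xW yW x y) auto
  have cl: "?f j \<in> carrier M" for j using ab u by (simp add: minus_closed_M)
  have trunc: "?f j = \<zero>\<^bsub>M\<^esub>" if "nat (max n0 n1) \<le> j" for j
  proof -
    have "YM x (int j) u = \<zero>\<^bsub>M\<^esub>" "YM y (1 + int j) u = \<zero>\<^bsub>M\<^esub>" using that by (auto intro: n0 n1)
    then show ?thesis using ab by (simp add: YM_zero M.minus_smult)
  qed
  have "fin_supp_sum M ?f \<ominus>\<^bsub>M\<^esub> ?f 0 \<in> W"
    by (rule M.fin_supp_sum_congruent[OF W cl mem trunc])
  moreover have "YM (Y x (-1) y) 1 u = fin_supp_sum M ?f" by (rule iterate[OF ab u])
  moreover have "?f 0 \<ominus>\<^bsub>M\<^esub> YM y 0 (YM x 0 u) \<in> W"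
  proof -
    let ?A = "YM x (-1) (YM y 1 u)" and ?B = "YM y 0 (YM x 0 u)"
    have AB: "?A \<in> carrier M" "?B \<in> carrier M" using ab u by auto
    \<comment> \<open>The sign \<open>(- 1) powi (- 1)\<close> turns the difference into a
      sum.\<close>
    have "?f 0 = ?A \<oplus>\<^bsub>M\<^esub> ?B" using AB by (simp add: M.minus_smult M.smult_smult)
    then have "?f 0 \<ominus>\<^bsub>M\<^esub> ?B = ?A" using AB by (simp add: a_minus_def M.a_assoc M.r_neg)
    moreover have "?A \<in> W" by (intro xW y) simp
    ultimately show ?thesis by simp
  qed
  ultimately have "(YM (Y x (-1) y) 1 u \<ominus>\<^bsub>M\<^esub> ?f 0) \<oplus>\<^bsub>M\<^esub> (?f 0 \<ominus>\<^bsub>M\<^esub> YM y 0 (YM x 0 u)) \<in> W"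
    by (simp only: E(3))
  moreover have "(YM (Y x (-1) y) 1 u \<ominus>\<^bsub>M\<^esub> ?f 0) \<oplus>\<^bsub>M\<^esub> (?f 0 \<ominus>\<^bsub>M\<^esub> YM y 0 (YM x 0 u))
      = YM (Y x (-1) y) 1 u \<ominus>\<^bsub>M\<^esub> YM y 0 (YM x 0 u)"
  proof -
    have telescope: "(P \<ominus>\<^bsub>M\<^esub> Q) \<oplus>\<^bsub>M\<^esub> (Q \<ominus>\<^bsub>M\<^esub> R) = P \<ominus>\<^bsub>M\<^esub> R"
      if "P \<in> carrier M" "Q \<in> carrier M" "R \<in> carrier M" for P Q R
    proof -
      have "(P \<ominus>\<^bsub>M\<^esub> Q) \<oplus>\<^bsub>M\<^esub> (Q \<ominus>\<^bsub>M\<^esub> R) = P \<oplus>\<^bsub>M\<^esub> (\<ominus>\<^bsub>M\<^esub> Q \<oplus>\<^bsub>M\<^esub> Q) \<oplus>\<^bsub>M\<^esub> \<ominus>\<^bsub>M\<^esub> R"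
        using that by (simp add: a_minus_def M.a_assoc)
      then show ?thesis using that by (simp add: a_minus_def M.l_neg)
    qed
    show ?thesis by (rule telescope) (use ab u cl[of 0] Y_closed in auto)
  qed
  ultimately show ?thesis by simp
qed

text \<open>\<open>Y x (-2) vac\<close> is the translate of \<open>x\<close>, and mode 1 of a
  derivative is minus mode 0. In the iterate formula only the term with mode \<open>- 1\<close> of
  the vacuum survives.\<close>

lemma derivative_mode:
  assumes "x \<in> carrier V" "u \<in> carrier M"
  shows "YM (Y x (-2) vac) 1 u = (- 1) \<odot>\<^bsub>M\<^esub> YM x 0 u"
proof -
  let ?f = "\<lambda>j. ((-1) ^ j * ((of_int (-2) :: complex) gchoose j)) \<odot>\<^bsub>M\<^esub>
          (YM x (-2 - int j) (YM vac (1 + int j) u) \<ominus>\<^bsub>M\<^esub>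
           ((-1) powi (-2)) \<odot>\<^bsub>M\<^esub> YM vac (-2 + 1 - int j) (YM x (int j) u))"
  have "fin_supp_sum M ?f = ?f 0"
    by (rule M.fin_supp_sum_first) (use assms vac_closed in \<open>auto simp: minus_closed_M YM_vac YM_zero M.minus_smult\<close>)
  then show ?thesis
    using iterate[OF assms(1) vac_closed assms(2), of "-2" 1] assms
    by (simp add: YM_vac YM_zero M.minus_smult)
qed

end

text \<open>A subspace stable under the modes of the generators turns out to be a two-sided ideal,
  so the vertex operators descend to the quotient.\<close>

locale vertex_ideal = weak_vertex_module V V vac Y Y
  for V :: "(complex, 'v, 'p) module_scheme" and vac Y +
  fixes \<omega> :: 'v and G :: "'v set" and J :: "'v set"
  assumes \<omega>: "\<omega> \<in> carrier V"
    and creation: "v \<in> carrier V \<Longrightarrow> Y v (-1) vac = v" "v \<in> carrier V \<Longrightarrow> 0 \<le> n \<Longrightarrow> Y v n vac = \<zero>\<^bsub>V\<^esub>"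
    and derivative: "u \<in> carrier V \<Longrightarrow> v \<in> carrier V \<Longrightarrow> Y (Y \<omega> 0 u) n v = (- of_int n) \<odot>\<^bsub>V\<^esub> Y u (n - 1) v"
    and G: "G \<subseteq> carrier V"
    and generated: "\<And>S. submodule S CC V \<Longrightarrow> vac \<in> S \<Longrightarrow> (\<And>g n s. g \<in> G \<Longrightarrow> s \<in> S \<Longrightarrow> Y g n s \<in> S) \<Longrightarrow> S = carrier V"
    and J: "submodule J CC V" "\<And>g n v. g \<in> G \<Longrightarrow> v \<in> J \<Longrightarrow> Y g n v \<in> J"
begin

lemma left_ideal: "v \<in> carrier V \<Longrightarrow> m \<in> J \<Longrightarrow> Y v n m \<in> J"
  by (rule stable_under_generated[OF J(1) G J(2) generated])

text \<open>Nonnegative modes annihilate the vacuum, and mode \<open>- 1\<close> returns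
  \<open>m\<close>. The lower modes follow by translation: mode 0 of \<open>\<omega>\<close> keeps
  \<open>m\<close> in \<open>J\<close> and lowers the mode by one, up to a nonzero factor.\<close>

lemma ideal_vac:
  assumes "m \<in> J"
  shows "Y m n vac \<in> J"
proof -
  note E = V.submodule_CC_E[OF J(1)]
  consider "0 \<le> n" | k where "n = - 1 - int k"
    by (metis add_diff_cancel_left' diff_add_cancel int_nat_eq linorder_le_cases nonneg_int_cases diff_ge_0_iff_ge not_less zle_diff1_eq minus_diff_eq diff_minus_eq_add)
  then show ?thesis
  proof cases
    case 1
    then show ?thesis using creation(2)[of m n] assms E(1,2) by (simp add: subset_iff)
  next
    case (2 k)
    have "Y m (- 1 - int k) vac \<in> J" using assms
    proof (induction k arbitrary: m)
      case 0
      then show ?case using creation(1)[of m] E(1) by (simp add: subset_iff)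
    next
      case (Suc k)
      have mV: "m \<in> carrier V" using Suc.prems E(1) by blast
      have "Y (Y \<omega> 0 m) (- 1 - int k) vac \<in> J" by (intro Suc.IH left_ideal[OF \<omega> Suc.prems])
      moreover have "Y (Y \<omega> 0 m) (- 1 - int k) vac = (of_nat (Suc k)) \<odot>\<^bsub>V\<^esub> Y m (- 1 - int (Suc k)) vac"
        using derivative[OF mV vac_closed, of "- 1 - int k"] by (simp add: algebra_simps)
      ultimately have "(1 / of_nat (Suc k)) \<odot>\<^bsub>V\<^esub> (of_nat (Suc k) \<odot>\<^bsub>V\<^esub> Y m (- 1 - int (Suc k)) vac) \<in> J"
        using E(4) by simp
      moreover have "(1 / of_nat (Suc k)) * of_nat (Suc k) = (1::complex)"
        by (metis nonzero_eq_divide_eq of_nat_neq_0)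
      ultimately show ?case
        using Y_closed[OF mV vac_closed] by (simp only: V.smult_smult V.smult_1)
    qed
    then show ?thesis using 2 by simp
  qed
qed

text \<open>Build \<open>b\<close> from the vacuum, starting with \<open>ideal_vac\<close>.
  Exchanging \<open>m\<close> with a generator costs terms whose left entry is a mode of the
  generator applied to \<open>m\<close>, again an element of \<open>J\<close>.\<close>

lemma right_ideal:
  assumes m: "m \<in> J" and b: "b \<in> carrier V"
  shows "Y m n b \<in> J"
proof -
  note E = V.submodule_CC_E[OF J(1)]
  let ?S = "{b \<in> carrier V. \<forall>m\<in>J. \<forall>n. Y m n b \<in> J}"
  have "?S = carrier V"
  proof (rule generated)
    have "Y m n \<zero>\<^bsub>V\<^esub> \<in> J" if "m \<in> J" for m n
      using YM_zero[of m n] that E(1,2) by (simp add: subset_iff)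
    moreover have "Y m n (x \<oplus>\<^bsub>V\<^esub> y) \<in> J"
      if "m \<in> J" "x \<in> ?S" "y \<in> ?S" for m n x y
      using that E linear_onD(2)[OF YM_linear, of m x y n] by (simp add: subset_iff)
    moreover have "Y m n (c \<odot>\<^bsub>V\<^esub> x) \<in> J" if "m \<in> J" "x \<in> ?S" for m n x c
      using that E linear_onD(3)[OF YM_linear, of m x n c] by (simp add: subset_iff)
    ultimately show "submodule ?S CC V"
      by (intro V.submodule_CC_I) auto
    show "vac \<in> ?S" using ideal_vac vac_closed by blast
    fix g r b assume g: "g \<in> G" and b: "b \<in> ?S"
    have gV: "g \<in> carrier V" and bV: "b \<in> carrier V" using g G b by auto
    have "Y m n (Y g r b) \<in> J" if m: "m \<in> J" for m n
    proof -
      have mV: "m \<in> carrier V" using m E(1) by blast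
      let ?s = "fin_supp_sum V (\<lambda>j. ((of_int r :: complex) gchoose j) \<odot>\<^bsub>V\<^esub> Y (Y g (int j) m) (r + n - int j) b)"
      have s: "?s \<in> J"
        by (rule V.fin_supp_sum_mem[OF J(1)]) (use b J(2)[OF g m] E(4) in blast)
      have A: "Y g r (Y m n b) \<in> J" using J(2)[OF g] b m by blast
      have AV: "Y g r (Y m n b) \<in> carrier V" "Y m n (Y g r b) \<in> carrier V" using gV mV bV by auto
      have "Y g r (Y m n b) \<ominus>\<^bsub>V\<^esub> Y m n (Y g r b) = ?s" by (rule commutator[OF gV mV bV])
      then have "Y g r (Y m n b) \<ominus>\<^bsub>V\<^esub> (Y g r (Y m n b) \<ominus>\<^bsub>V\<^esub> Y m n (Y g r b)) \<in> J"
        using E(5)[OF A s] by simp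
      moreover have "P \<ominus>\<^bsub>V\<^esub> (P \<ominus>\<^bsub>V\<^esub> Q) = Q" if "P \<in> carrier V" "Q \<in> carrier V" for P Q
        using that by (simp add: a_minus_def V.minus_add V.minus_minus V.a_assoc[symmetric] V.r_neg)
      ultimately show ?thesis using AV by simp
    qed
    then show "Y g r b \<in> ?S" using Y_closed[OF gV bV] by blast
  qed
  then show ?thesis using assms by blast
qed

interpretation VJ: quotient_space V J
  by (intro quotient_space.intro quotient_space_axioms.intro J(1) V.complex_module_axioms)

text \<open>Changing the first entry by an element of \<open>J\<close> is harmless by
  \<open>right_ideal\<close>, changing the second by \<open>left_ideal\<close>.\<close>

lemma vertex_coset:
  assumes "x \<in> carrier V" "y \<in> carrier V"
  shows "(\<Union>a\<in>J +>\<^bsub>V\<^esub> x. \<Union>b\<in>J +>\<^bsub>V\<^esub> y. J +>\<^bsub>V\<^esub> Y a n b) = J +>\<^bsub>V\<^esub> Y x n y"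
proof -
  note E = V.submodule_CC_E[OF J(1)]
  have "J +>\<^bsub>V\<^esub> Y a n b = J +>\<^bsub>V\<^esub> Y x n y" if "a \<in> J +>\<^bsub>V\<^esub> x" "b \<in> J +>\<^bsub>V\<^esub> y" for a b
  proof -
    have a: "a \<in> carrier V" "a \<ominus>\<^bsub>V\<^esub> x \<in> J" and b: "b \<in> carrier V" "b \<ominus>\<^bsub>V\<^esub> y \<in> J"
      using VJ.mem_coset that assms by auto
    have split: "c = (c \<ominus>\<^bsub>V\<^esub> d) \<oplus>\<^bsub>V\<^esub> d" if "c \<in> carrier V" "d \<in> carrier V" for c d
      using that by (simp add: a_minus_def V.a_assoc V.l_neg)
    have mc: "a \<ominus>\<^bsub>V\<^esub> x \<in> carrier V" "b \<ominus>\<^bsub>V\<^esub> y \<in> carrier V" using a b E(1) by auto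
    have "Y a n b = Y (a \<ominus>\<^bsub>V\<^esub> x) n b \<oplus>\<^bsub>V\<^esub> Y x n b"
      using linear_onD(2)[OF YM_linear_left[OF b(1)] mc(1) assms(1), of n] split[OF a(1) assms(1)] by simp
    moreover have "Y x n b = Y x n (b \<ominus>\<^bsub>V\<^esub> y) \<oplus>\<^bsub>V\<^esub> Y x n y"
      using linear_onD(2)[OF YM_linear[OF assms(1)] mc(2) assms(2), of n] split[OF b(1) assms(2)] by simp
    ultimately have "Y a n b = (Y (a \<ominus>\<^bsub>V\<^esub> x) n b \<oplus>\<^bsub>V\<^esub> Y x n (b \<ominus>\<^bsub>V\<^esub> y)) \<oplus>\<^bsub>V\<^esub> Y x n y"
      using assms a b mc by (simp add: V.a_assoc)
    moreover have "Y (a \<ominus>\<^bsub>V\<^esub> x) n b \<oplus>\<^bsub>V\<^esub> Y x n (b \<ominus>\<^bsub>V\<^esub> y) \<in> J"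
      by (intro E(3) right_ideal left_ideal a b assms)
    moreover have "(P \<oplus>\<^bsub>V\<^esub> Q) \<ominus>\<^bsub>V\<^esub> Q = P" if "P \<in> carrier V" "Q \<in> carrier V" for P Q
      using that by (simp add: a_minus_def V.a_assoc V.r_neg)
    ultimately have "Y a n b \<ominus>\<^bsub>V\<^esub> Y x n y \<in> J"
      using assms E(1) by (metis YM_closed subsetD)
    then show ?thesis using assms a b by (simp add: VJ.coset_eq_iff)
  qed
  moreover have "x \<in> J +>\<^bsub>V\<^esub> x" "y \<in> J +>\<^bsub>V\<^esub> y"
    using assms E(2) by (simp_all add: VJ.mem_coset_iff a_minus_def V.r_neg)
  ultimately show ?thesis by blast
qed

end


section \<open>The Lie algebra sl and its affinization\<close>

lemma sl_simps:
  "carrier (sl l) = {A \<in> carrier_mat (l + 1) (l + 1). (\<Sum>i<l + 1. A $$ (i, i)) = 0}"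
  "A \<oplus>\<^bsub>sl l\<^esub> B = A + B" "c \<odot>\<^bsub>sl l\<^esub> A = c \<cdot>\<^sub>m A" "\<zero>\<^bsub>sl l\<^esub> = 0\<^sub>m (l + 1) (l + 1)"
  "lie_bracket (sl l) A B = A * B - B * A"
  by (simp_all add: sl_def module.extend_def lie_algebra.fields_def module_mat_def)

lemma trace_mult_comm:
  fixes A B :: "complex mat"
  assumes "A \<in> carrier_mat n n" "B \<in> carrier_mat n n"
  shows "(\<Sum>i<n. (A * B) $$ (i, i)) = (\<Sum>i<n. (B * A) $$ (i, i))"
proof -
  have 1: "(\<Sum>i<n. (A * B) $$ (i, i)) = (\<Sum>i<n. \<Sum>j<n. A $$ (i, j) * B $$ (j, i))"
    if "A \<in> carrier_mat n n" "B \<in> carrier_mat n n" for A B :: "complex mat"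
    using that by (intro sum.cong) (auto simp: scalar_prod_def atLeast0LessThan)
  show ?thesis
    unfolding 1[OF assms] 1[OF assms(2,1)] by (subst sum.swap) (simp add: mult.commute)
qed

lemma of_nat_plus_1_neq_0 [simp]: "1 + of_nat l \<noteq> (0::complex)"
  using of_nat_neq_0[of l, where ?'a = complex] by simp

lemma zero_sl: "0\<^sub>m (l + 1) (l + 1) \<in> carrier (sl l)"
  unfolding sl_simps by simp

lemma zero_sl' [simp]: "0\<^sub>m (Suc l) (Suc l) \<in> carrier (sl l)"
  using zero_sl[of l] by simp

lemma sum_delta2:
  fixes g :: "nat \<Rightarrow> nat \<Rightarrow> 'a::comm_monoid_add"
  assumes "p < n" "q < n"
  shows "(\<Sum>i<n. \<Sum>j<n. if i = p then if j = q then g i j else 0 else 0) = g p q"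
proof -
  have "(\<Sum>j<n. if i = p then if j = q then g i j else 0 else 0) = (if i = p then g i q else 0)" for i
    using assms by (cases "i = p") simp_all
  then show ?thesis using assms by simp
qed

lemma sl_closed:
  "A \<in> carrier (sl l) \<Longrightarrow> B \<in> carrier (sl l) \<Longrightarrow> A + B \<in> carrier (sl l)"
  "A \<in> carrier (sl l) \<Longrightarrow> c \<cdot>\<^sub>m A \<in> carrier (sl l)"
  "A \<in> carrier (sl l) \<Longrightarrow> B \<in> carrier (sl l) \<Longrightarrow> A * B - B * A \<in> carrier (sl l)"
  "0\<^sub>m (l + 1) (l + 1) \<in> carrier (sl l)"
proof -
  assume A: "A \<in> carrier (sl l)"
  then show "c \<cdot>\<^sub>m A \<in> carrier (sl l)"
    by (auto simp: sl_simps sum_distrib_left[symmetric] simp del: sum.lessThan_Suc)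
  assume B: "B \<in> carrier (sl l)"
  show "A + B \<in> carrier (sl l)"
    using A B by (auto simp: sl_simps sum.distrib simp del: sum.lessThan_Suc)
  show "A * B - B * A \<in> carrier (sl l)"
    using A B trace_mult_comm[of A "l + 1" B] by (auto simp: sl_simps sum_subtractf simp del: index_mult_mat(1) sum.lessThan_Suc)
qed (rule zero_sl)

lemma sl_mat: "A \<in> carrier (sl l) \<Longrightarrow> A \<in> carrier_mat (l + 1) (l + 1)"
  by (simp add: sl_simps)

lemma module_sl: "Module.module CC (sl l)"
proof (rule moduleI)
  show "abelian_group (sl l)"
  proof (rule abelian_groupI)
    fix A assume A: "A \<in> carrier (sl l)"
    then show "\<exists>B\<in>carrier (sl l). B \<oplus>\<^bsub>sl l\<^esub> A = \<zero>\<^bsub>sl l\<^esub>"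
      using sl_closed(2)[OF A, of "- 1"] sl_mat[OF A]
      by (intro bexI[of _ "(- 1) \<cdot>\<^sub>m A"]) (auto simp: sl_simps(2,4))
  qed (auto simp: sl_simps(2,4) sl_closed dest!: sl_mat intro: assoc_add_mat comm_add_mat)
qed (auto simp: cring_CC sl_simps(2,3) sl_closed add_smult_distrib_right_mat add_smult_distrib_left_mat
    dest!: sl_mat intro!: eq_matI)

interpretation sl: complex_module "sl l" for l
  by (rule complex_module.intro[OF module_sl])

lemma trace_form_zero:
  "trace_form l (0\<^sub>m (l + 1) (l + 1)) B = 0" if "B \<in> carrier_mat (l + 1) (l + 1)"
  using that by (simp add: trace_form_def)

lemma trace_form_zero_right:
  "trace_form l A (0\<^sub>m (l + 1) (l + 1)) = 0" if "A \<in> carrier_mat (l + 1) (l + 1)"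
  using that by (simp add: trace_form_def)

abbreviation ahat where "ahat l \<equiv> affine_lie (sl l) (trace_form l)"

lemma affine_simps:
  "carrier (affine_lie g \<kappa>) = {(f, a). (\<forall>n. f n \<in> carrier g) \<and> finite {n. f n \<noteq> \<zero>\<^bsub>g\<^esub>}}"
  "\<zero>\<^bsub>affine_lie g \<kappa>\<^esub> = (\<lambda>n. \<zero>\<^bsub>g\<^esub>, 0)"
  "(f, a) \<oplus>\<^bsub>affine_lie g \<kappa>\<^esub> (h, b) = (\<lambda>n. f n \<oplus>\<^bsub>g\<^esub> h n, a + b)"
  "s \<odot>\<^bsub>affine_lie g \<kappa>\<^esub> (f, a) = (\<lambda>n. s \<odot>\<^bsub>g\<^esub> f n, s * a)"
  "lie_bracket (affine_lie g \<kappa>) (f, a) (h, b) =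
        (\<lambda>n. \<Oplus>\<^bsub>g\<^esub>m\<in>{m. f m \<noteq> \<zero>\<^bsub>g\<^esub>}. lie_bracket g (f m) (h (n - m)),
         \<Sum>m\<in>{m. f m \<noteq> \<zero>\<^bsub>g\<^esub>}. of_int m * \<kappa> (f m) (h (- m)))"
  by (simp_all add: affine_lie_def)

lemma bracket_zero_right: "A \<in> carrier (sl l) \<Longrightarrow> lie_bracket (sl l) A \<zero>\<^bsub>sl l\<^esub> = \<zero>\<^bsub>sl l\<^esub>"
  and bracket_zero_left: "A \<in> carrier (sl l) \<Longrightarrow> lie_bracket (sl l) \<zero>\<^bsub>sl l\<^esub> A = \<zero>\<^bsub>sl l\<^esub>"
  by (auto simp: sl_simps(4,5) dest!: sl_mat)

lemma bracket_closed_sl: "A \<in> carrier (sl l) \<Longrightarrow> B \<in> carrier (sl l) \<Longrightarrow> lie_bracket (sl l) A B \<in> carrier (sl l)"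
  by (simp only: sl_simps(5) sl_closed)

lemma closed_bracket_affine: "closed_bracket (ahat l) (affine_nonneg (sl l) (trace_form l))"
proof
  fix x y assume xy: "x \<in> carrier (ahat l)" "y \<in> carrier (ahat l)"
  obtain f a where x: "x = (f, a)" by (cases x)
  obtain h b where y: "y = (h, b)" by (cases y)
  have f: "\<And>n. f n \<in> carrier (sl l)" "finite {n. f n \<noteq> \<zero>\<^bsub>sl l\<^esub>}"
    and h: "\<And>n. h n \<in> carrier (sl l)" "finite {n. h n \<noteq> \<zero>\<^bsub>sl l\<^esub>}"
    using xy x y by (auto simp: affine_simps)
  have "{n. f n \<oplus>\<^bsub>sl l\<^esub> h n \<noteq> \<zero>\<^bsub>sl l\<^esub>} \<subseteq> {n. f n \<noteq> \<zero>\<^bsub>sl l\<^esub>} \<union> {n. h n \<noteq> \<zero>\<^bsub>sl l\<^esub>}"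
    by auto
  then have "finite {n. f n \<oplus>\<^bsub>sl l\<^esub> h n \<noteq> \<zero>\<^bsub>sl l\<^esub>}" using f h finite_subset by blast
  then show "x \<oplus>\<^bsub>ahat l\<^esub> y \<in> carrier (ahat l)"
    using f h by (simp add: x y affine_simps)
  let ?b = "\<lambda>n. \<Oplus>\<^bsub>sl l\<^esub>m\<in>{m. f m \<noteq> \<zero>\<^bsub>sl l\<^esub>}. lie_bracket (sl l) (f m) (h (n - m))"
  have "?b n \<in> carrier (sl l)" for n
    by (rule sl.finsum_closed) (use f h bracket_closed_sl in auto)
  \<comment> \<open>The support of a bracket lies in the sum of the two finite supports.\<close>
  moreover have "{n. ?b n \<noteq> \<zero>\<^bsub>sl l\<^esub>} \<subseteq> (\<lambda>(m, m'). m + m') ` ({n. f n \<noteq> \<zero>\<^bsub>sl l\<^esub>} \<times> {n. h n \<noteq> \<zero>\<^bsub>sl l\<^esub>})"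
  proof (intro subsetI, rule ccontr)
    fix n assume n: "n \<in> {n. ?b n \<noteq> \<zero>\<^bsub>sl l\<^esub>}"
      "n \<notin> (\<lambda>(m, m'). m + m') ` ({n. f n \<noteq> \<zero>\<^bsub>sl l\<^esub>} \<times> {n. h n \<noteq> \<zero>\<^bsub>sl l\<^esub>})"
    have "lie_bracket (sl l) (f m) (h (n - m)) = \<zero>\<^bsub>sl l\<^esub>" if "f m \<noteq> \<zero>\<^bsub>sl l\<^esub>" for m
    proof -
      have "h (n - m) = \<zero>\<^bsub>sl l\<^esub>"
      proof (rule ccontr)
        assume "h (n - m) \<noteq> \<zero>\<^bsub>sl l\<^esub>"
        then have "(m, n - m) \<in> {n. f n \<noteq> \<zero>\<^bsub>sl l\<^esub>} \<times> {n. h n \<noteq> \<zero>\<^bsub>sl l\<^esub>}" using that by simp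
        then show False using n(2) by force
      qed
      then show ?thesis using bracket_zero_right f(1) by simp
    qed
    then have "?b n = \<zero>\<^bsub>sl l\<^esub>" by (intro sl.add.finprod_one_eqI) auto
    then show False using n(1) by simp
  qed
  then have "finite {n. ?b n \<noteq> \<zero>\<^bsub>sl l\<^esub>}" using f h finite_subset by blast
  ultimately show "lie_bracket (ahat l) x y \<in> carrier (ahat l)"
    by (simp add: x y affine_simps)
next
  fix x c assume xy: "x \<in> carrier (ahat l)"
  obtain f a where x: "x = (f, a)" by (cases x)
  have f: "\<And>n. f n \<in> carrier (sl l)" "finite {n. f n \<noteq> \<zero>\<^bsub>sl l\<^esub>}"
    using xy x by (auto simp: affine_simps)
  have "{n. c \<odot>\<^bsub>sl l\<^esub> f n \<noteq> \<zero>\<^bsub>sl l\<^esub>} \<subseteq> {n. f n \<noteq> \<zero>\<^bsub>sl l\<^esub>}" by auto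
  then have "finite {n. c \<odot>\<^bsub>sl l\<^esub> f n \<noteq> \<zero>\<^bsub>sl l\<^esub>}" using f finite_subset by blast
  then show "c \<odot>\<^bsub>ahat l\<^esub> x \<in> carrier (ahat l)"
    using f by (simp add: x affine_simps)
qed (auto simp: affine_nonneg_def)

definition central :: "nat \<Rightarrow> complex \<Rightarrow> complex mat aff"
  where "central l s = (\<lambda>n. \<zero>\<^bsub>sl l\<^esub>, s)"

lemma loop_closed: "x \<in> carrier (sl l) \<Longrightarrow> loop (sl l) x n \<in> carrier (ahat l)"
  by (auto simp: loop_def affine_simps)

lemma central_closed: "central l s \<in> carrier (ahat l)"
  by (auto simp: central_def affine_simps)

lemma loop_add: "x \<in> carrier (sl l) \<Longrightarrow> y \<in> carrier (sl l) \<Longrightarrow>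
    loop (sl l) (x + y) n = loop (sl l) x n \<oplus>\<^bsub>ahat l\<^esub> loop (sl l) y n"
  by (auto simp: loop_def affine_simps sl_simps(2)[symmetric])

lemma loop_smult: "x \<in> carrier (sl l) \<Longrightarrow> loop (sl l) (c \<cdot>\<^sub>m x) n = c \<odot>\<^bsub>ahat l\<^esub> loop (sl l) x n"
  by (auto simp: loop_def affine_simps sl_simps(3)[symmetric])

lemma central_smult: "central l s = s \<odot>\<^bsub>ahat l\<^esub> central l 1"
  by (auto simp: central_def affine_simps)

lemma bracket_loop:
  assumes "x \<in> carrier (sl l)" "y \<in> carrier (sl l)"
  shows "lie_bracket (ahat l) (loop (sl l) x m) (loop (sl l) y n)
    = loop (sl l) (x * y - y * x) (m + n) \<oplus>\<^bsub>ahat l\<^esub> central l (if m + n = 0 then of_int m * trace_form l x y else 0)"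
proof (cases "x = \<zero>\<^bsub>sl l\<^esub>")
  \<comment> \<open>For \<open>x = 0\<close> the support over which the bracket is summed is empty
    instead of \<open>{m}\<close>.\<close>
  case True
  have t: "trace_form l x y = 0" using True assms(2) trace_form_zero sl_mat by (simp add: sl_simps(4))
  have b: "x * y - y * x = \<zero>\<^bsub>sl l\<^esub>" using True bracket_zero_left[OF assms(2)] by (simp add: sl_simps(5))
  show ?thesis
    unfolding b t by (simp add: True loop_def central_def affine_simps)
next
  case False
  then have s: "{r. (if r = m then x else \<zero>\<^bsub>sl l\<^esub>) \<noteq> \<zero>\<^bsub>sl l\<^esub>} = {m}" by auto
  have b: "lie_bracket (sl l) x (if r - m = n then y else \<zero>\<^bsub>sl l\<^esub>)
      = (if r = m + n then lie_bracket (sl l) x y else \<zero>\<^bsub>sl l\<^esub>)" for r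
    using bracket_zero_right[OF assms(1)] by auto
  have t: "trace_form l x (if - m = n then y else \<zero>\<^bsub>sl l\<^esub>) = (if m + n = 0 then trace_form l x y else 0)"
    using trace_form_zero_right[OF sl_mat[OF assms(1)]] by (auto simp: sl_simps(4))
  show ?thesis
    unfolding loop_def affine_simps s using assms bracket_closed_sl[OF assms] b t
    by (auto simp: sl.finsum_insert central_def affine_simps sl_simps(5)[of l, symmetric] intro!: ext)
qed

lemma bracket_central:
  assumes "z \<in> carrier (ahat l)"
  shows "lie_bracket (ahat l) z (central l s) = central l 0"
proof -
  obtain f a where z: "z = (f, a)" by (cases z)
  have f: "\<And>n. f n \<in> carrier (sl l)" using assms z by (auto simp: affine_simps)
  have "trace_form l (f m) \<zero>\<^bsub>sl l\<^esub> = 0" for m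
    using trace_form_zero_right[OF sl_mat[OF f]] by (simp add: sl_simps(4))
  then show ?thesis
    using f by (simp add: z central_def affine_simps bracket_zero_right)
qed

lemma affine_split:
  assumes "(f, a) \<in> carrier (ahat l)"
  shows "(f, a) = (f(n := \<zero>\<^bsub>sl l\<^esub>), a) \<oplus>\<^bsub>ahat l\<^esub> loop (sl l) (f n) n"
  using assms by (auto simp: affine_simps loop_def)

text \<open>The matrix unit, projected to trace zero. The commutators are those of the matrix units.\<close>

definition munit :: "nat \<Rightarrow> nat \<Rightarrow> nat \<Rightarrow> complex mat"
  where "munit l i j = mat (l + 1) (l + 1)
    (\<lambda>(p, q). (if p = i \<and> q = j then 1 else 0) - (if i = j \<and> p = q then 1 / of_nat (l + 1) else 0))"

lemma munit_mat: "munit l i j \<in> carrier_mat (l + 1) (l + 1)"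
  by (simp add: munit_def)

lemma munit_entry: "p < l + 1 \<Longrightarrow> q < l + 1 \<Longrightarrow> munit l i j $$ (p, q) =
    (if p = i then if q = j then 1 else 0 else 0) - (if p = q then if i = j then 1 / of_nat (l + 1) else 0 else 0)"
  by (simp add: munit_def)

lemma munit_closed: "i < l + 1 \<Longrightarrow> j < l + 1 \<Longrightarrow> munit l i j \<in> carrier (sl l)"
proof -
  assume ij: "i < l + 1" "j < l + 1"
  have "(\<Sum>p<l + 1. munit l i j $$ (p, p))
      = (\<Sum>p<l + 1. (if p = i then if i = j then 1 else 0 else 0) - (if i = j then 1 / of_nat (l + 1) else 0))"
    by (rule sum.cong) (auto simp: munit_entry)
  also have "\<dots> = 0" using ij by (simp add: sum_subtractf del: sum.lessThan_Suc)
  finally show ?thesis using munit_mat by (simp add: sl_simps)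
qed

lemma munit_mult_entry:
  assumes "A \<in> carrier_mat (l + 1) (l + 1)" "i < l + 1" "j < l + 1" "r < l + 1" "s < l + 1"
  shows "(munit l i j * A) $$ (r, s) = (if r = i then A $$ (j, s) else 0) - (if i = j then 1 / of_nat (l + 1) else 0) * A $$ (r, s)"
    and "(A * munit l i j) $$ (r, s) = (if s = j then A $$ (r, i) else 0) - (if i = j then 1 / of_nat (l + 1) else 0) * A $$ (r, s)"
proof -
  have "(munit l i j * A) $$ (r, s) = (\<Sum>t<l + 1. munit l i j $$ (r, t) * A $$ (t, s))"
    using assms munit_mat[of l i j] by (simp add: scalar_prod_def atLeast0LessThan del: sum.lessThan_Suc)
  also have "\<dots> = (\<Sum>t<l + 1. (if t = j then if r = i then A $$ (t, s) else 0 else 0)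
      - (if t = r then (if i = j then 1 / of_nat (l + 1) else 0) * A $$ (t, s) else 0))"
    by (rule sum.cong) (use assms in \<open>auto simp: munit_entry left_diff_distrib\<close>)
  also have "\<dots> = (if r = i then A $$ (j, s) else 0) - (if i = j then 1 / of_nat (l + 1) else 0) * A $$ (r, s)"
    using assms by (simp add: sum_subtractf del: sum.lessThan_Suc)
  finally show "(munit l i j * A) $$ (r, s) = \<dots>" .
  have "(A * munit l i j) $$ (r, s) = (\<Sum>t<l + 1. A $$ (r, t) * munit l i j $$ (t, s))"
    using assms munit_mat[of l i j] by (simp add: scalar_prod_def atLeast0LessThan del: sum.lessThan_Suc)
  also have "\<dots> = (\<Sum>t<l + 1. (if t = i then if s = j then A $$ (r, t) else 0 else 0)
      - (if t = s then (if i = j then 1 / of_nat (l + 1) else 0) * A $$ (r, t) else 0))"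
    by (rule sum.cong) (use assms in \<open>auto simp: munit_entry right_diff_distrib\<close>)
  also have "\<dots> = (if s = j then A $$ (r, i) else 0) - (if i = j then 1 / of_nat (l + 1) else 0) * A $$ (r, s)"
    using assms by (simp add: sum_subtractf del: sum.lessThan_Suc)
  finally show "(A * munit l i j) $$ (r, s) = \<dots>" .
qed

text \<open>The multiple of the identity inside \<open>munit\<close> pairs with the trace of
  \<open>A\<close>, which is zero.\<close>

lemma trace_form_munit:
  assumes "A \<in> carrier (sl l)" "i < l + 1" "j < l + 1"
  shows "trace_form l A (munit l i j) = A $$ (j, i)"
proof -
  have A: "A \<in> carrier_mat (l + 1) (l + 1)" "(\<Sum>r<l + 1. A $$ (r, r)) = 0"
    using assms(1) by (auto simp: sl_simps)
  have "trace_form l A (munit l i j) = (\<Sum>r<l + 1. (if r = j then A $$ (r, i) else 0)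
      - (if i = j then 1 / of_nat (l + 1) else 0) * A $$ (r, r))"
    unfolding trace_form_def by (rule sum.cong) (use assms A in \<open>auto simp: munit_mult_entry\<close>)
  also have "\<dots> = A $$ (j, i)"
    using A(2) assms by (simp add: sum_subtractf del: sum.lessThan_Suc flip: sum_distrib_left)
  finally show ?thesis .
qed

lemma trace_form_munit_munit:
  assumes "i < l + 1" "j < l + 1" "p < l + 1" "q < l + 1"
  shows "trace_form l (munit l i j) (munit l p q)
    = (if j = p \<and> i = q then 1 else 0) - (if i = j \<and> p = q then 1 / of_nat (l + 1) else 0)"
  unfolding trace_form_munit[OF munit_closed[OF assms(1,2)] assms(3,4)] munit_entry[OF assms(4,3)]
  by (cases "q = i"; cases "p = j"; cases "q = p"; cases "i = j") simp_all

text \<open>The identity parts commute with everything, so ordinary matrix units decide. The second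
  term is a sum with a scalar multiple because \<open>sl_linear\<close> provides linearity in that
  form.\<close>

lemma bracket_munit:
  assumes "i < l + 1" "j < l + 1" "p < l + 1" "q < l + 1"
  shows "munit l i j * munit l p q - munit l p q * munit l i j
    = (if j = p then munit l i q else 0\<^sub>m (l + 1) (l + 1)) + (- 1) \<cdot>\<^sub>m (if q = i then munit l p j else 0\<^sub>m (l + 1) (l + 1))"
proof (rule eq_matI)
  fix r s
  assume "r < dim_row ((if j = p then munit l i q else 0\<^sub>m (l + 1) (l + 1)) + (- 1) \<cdot>\<^sub>m (if q = i then munit l p j else 0\<^sub>m (l + 1) (l + 1)))"
    "s < dim_col ((if j = p then munit l i q else 0\<^sub>m (l + 1) (l + 1)) + (- 1) \<cdot>\<^sub>m (if q = i then munit l p j else 0\<^sub>m (l + 1) (l + 1)))"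
  then have rs: "r < l + 1" "s < l + 1" by (auto simp: munit_def split: if_splits)
  have l: "(munit l i j * munit l p q - munit l p q * munit l i j) $$ (r, s)
      = (if r = i then munit l p q $$ (j, s) else 0) - (if s = j then munit l p q $$ (r, i) else 0)"
  proof -
    have "(munit l i j * munit l p q - munit l p q * munit l i j) $$ (r, s)
        = (munit l i j * munit l p q) $$ (r, s) - (munit l p q * munit l i j) $$ (r, s)"
      using rs munit_mat[of l i j] munit_mat[of l p q] by (simp del: index_mult_mat(1))
    then show ?thesis
      unfolding munit_mult_entry(1)[OF munit_mat assms(1,2) rs] munit_mult_entry(2)[OF munit_mat assms(1,2) rs]
      by simp
  qed
  have r: "((if j = p then munit l i q else 0\<^sub>m (l + 1) (l + 1)) + (- 1) \<cdot>\<^sub>m (if q = i then munit l p j else 0\<^sub>m (l + 1) (l + 1))) $$ (r, s)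
      = (if j = p then munit l i q $$ (r, s) else 0) - (if q = i then munit l p j $$ (r, s) else 0)"
    using rs munit_mat[of l i q] munit_mat[of l p j] by auto
  show "(munit l i j * munit l p q - munit l p q * munit l i j) $$ (r, s) =
    ((if j = p then munit l i q else 0\<^sub>m (l + 1) (l + 1)) + (- 1) \<cdot>\<^sub>m (if q = i then munit l p j else 0\<^sub>m (l + 1) (l + 1))) $$ (r, s)"
    unfolding l r using rs assms by (auto simp: munit_entry)
qed (auto simp: munit_def)

section \<open>Linear maps on \<open>sl\<close> and the Casimir sum\<close>

locale sl_linear = complex_space scale
  for scale :: "complex \<Rightarrow> 'v::ab_group_add \<Rightarrow> 'v"  (infixr \<open>*c\<close> 75) +
  fixes l :: nat and f :: "complex mat \<Rightarrow> 'v"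
  assumes f_add: "x \<in> carrier (sl l) \<Longrightarrow> y \<in> carrier (sl l) \<Longrightarrow> f (x + y) = f x + f y"
    and f_scale: "x \<in> carrier (sl l) \<Longrightarrow> f (c \<cdot>\<^sub>m x) = c *c f x"
begin

lemma f_zero: "f (0\<^sub>m (l + 1) (l + 1)) = 0"
  using f_add[OF sl_closed(4) sl_closed(4)] by simp

text \<open>The projected matrix units are linearly dependent, yet the naive expansion is correct:
  their corrections add up to a multiple of the trace of \<open>x\<close>.\<close>

lemma expand_munit:
  assumes x: "x \<in> carrier (sl l)"
  shows "f x = (\<Sum>i<l + 1. \<Sum>j<l + 1. x $$ (i, j) *c f (munit l i j))"
proof -
  \<comment> \<open>The partial sums are explicit matrices of fixed size, so the empty one is the
    zero matrix of the right dimension.\<close>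
  define S where "S A = mat (l + 1) (l + 1) (\<lambda>r. \<Sum>(i, j)\<in>A. x $$ (i, j) * munit l i j $$ r)" for A
  have S: "S A \<in> carrier (sl l) \<and> f (S A) = (\<Sum>(i, j)\<in>A. x $$ (i, j) *c f (munit l i j))"
    if "finite A" "A \<subseteq> {..<l + 1} \<times> {..<l + 1}" for A
    using that
  proof (induction A)
    case empty
    have "S {} = 0\<^sub>m (l + 1) (l + 1)" by (auto simp: S_def)
    then show ?case using sl_closed(4) f_zero by simp
  next
    case (insert a A)
    obtain i j where a: "a = (i, j)" by (cases a)
    have ij: "munit l i j \<in> carrier (sl l)" using insert.prems a by (intro munit_closed) auto
    have "S (insert a A) = (x $$ (i, j)) \<cdot>\<^sub>m munit l i j + S A"
      using insert.hyps a munit_mat[of l i j] by (auto simp: S_def intro!: eq_matI)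
    then show ?case
      using insert a ij by (simp add: f_add f_scale sl_closed)
  qed
  have "S ({..<l + 1} \<times> {..<l + 1}) = x"
  proof (rule eq_matI)
    fix p q assume "p < dim_row x" "q < dim_col x"
    then have pq: "p < l + 1" "q < l + 1" using sl_mat[OF x] by auto
    have "S ({..<l + 1} \<times> {..<l + 1}) $$ (p, q) = (\<Sum>i<l + 1. \<Sum>j<l + 1. x $$ (i, j) * munit l i j $$ (p, q))"
      using pq by (simp add: S_def sum.cartesian_product del: sum.lessThan_Suc)
    also have "\<dots> = (\<Sum>i<l + 1. \<Sum>j<l + 1. (if i = p then if j = q then x $$ (i, j) else 0 else 0)
        - (if j = i then if p = q then x $$ (i, j) / of_nat (l + 1) else 0 else 0))"
      using pq by (intro sum.cong) (auto simp: munit_entry right_diff_distrib)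
    also have "\<dots> = x $$ (p, q) - (if p = q then (\<Sum>i<l + 1. x $$ (i, i)) / of_nat (l + 1) else 0)"
      using pq unfolding sum_subtractf sum_delta2[OF pq] by (simp add: sum_divide_distrib del: sum.lessThan_Suc)
    also have "\<dots> = x $$ (p, q)" using x by (simp add: sl_simps)
    finally show "S ({..<l + 1} \<times> {..<l + 1}) $$ (p, q) = x $$ (p, q)" .
  qed (use sl_mat[OF x] in \<open>auto simp: S_def\<close>)
  then have "f x = (\<Sum>(i, j)\<in>{..<l + 1} \<times> {..<l + 1}. x $$ (i, j) *c f (munit l i j))"
    using S[of "{..<l + 1} \<times> {..<l + 1}"] by simp
  then show ?thesis by (simp add: sum.cartesian_product del: sum.lessThan_Suc)
qed

text \<open>Expanding \<open>munit l 0 0\<close> by \<open>expand_munit\<close> reproduces it minus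
  \<open>1 / (l + 1)\<close> times the sum in question.\<close>

lemma trace_munit: "(\<Sum>i<l + 1. f (munit l i i)) = 0"
proof -
  let ?N = "of_nat (l + 1) :: complex"
  have "f (munit l 0 0) = (\<Sum>i<l + 1. \<Sum>j<l + 1. munit l 0 0 $$ (i, j) *c f (munit l i j))"
    by (rule expand_munit[OF munit_closed]) simp_all
  also have "\<dots> = (\<Sum>i<l + 1. \<Sum>j<l + 1. (if i = 0 then if j = 0 then f (munit l i j) else 0 else 0)
      - (if j = i then (1 / ?N) *c f (munit l i j) else 0))"
    by (intro sum.cong) (auto simp: munit_entry scale_left_diff_distrib)
  also have "\<dots> = f (munit l 0 0) - (1 / ?N) *c (\<Sum>i<l + 1. f (munit l i i))"
    unfolding sum_subtractf by (subst sum_delta2) (simp_all add: scale_sum_right del: sum.lessThan_Suc)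
  finally have "(1 / ?N) *c (\<Sum>i<l + 1. f (munit l i i)) = 0" by (simp del: sum.lessThan_Suc)
  then show ?thesis by (simp del: sum.lessThan_Suc add: of_nat_Suc[symmetric] del: of_nat_Suc)
qed

lemma expand_orthonormal:
  assumes xs: "orthonormal_basis (sl l) (trace_form l) xs" and y: "y \<in> carrier (sl l)"
  shows "f y = (\<Sum>a<length xs. trace_form l (xs ! a) y *c f (xs ! a))"
proof -
  have xs_sl: "xs ! a \<in> carrier (sl l)" if "a < length xs" for a
    using xs that by (auto simp: orthonormal_basis_def)
  have tr_add: "trace_form l x (y + z) = trace_form l x y + trace_form l x z"
    if "x \<in> carrier (sl l)" "y \<in> carrier (sl l)" "z \<in> carrier (sl l)" for x y z
    using sl_mat[OF that(1)] sl_mat[OF that(2)] sl_mat[OF that(3)]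
    by (simp add: trace_form_def mult_add_distrib_mat[of _ "l + 1" "l + 1" _ "l + 1"] sum.distrib
        del: index_mult_mat(1) sum.lessThan_Suc)
  have tr_scale: "trace_form l x (c \<cdot>\<^sub>m y) = c * trace_form l x y"
    if "x \<in> carrier (sl l)" "y \<in> carrier (sl l)" for x y c
    using sl_mat[OF that(1)] sl_mat[OF that(2)]
    by (simp add: trace_form_def mult_smult_distrib[of _ "l + 1" "l + 1" _ "l + 1"] sum_distrib_left
        del: index_mult_mat(1) sum.lessThan_Suc)
  let ?S = "{y \<in> carrier (sl l). f y = (\<Sum>a<length xs. trace_form l (xs ! a) y *c f (xs ! a))}"
  have "submodule ?S CC (sl l)"
  proof (rule sl.submodule_CC_I)
    have "trace_form l (xs ! a) (0\<^sub>m (l + 1) (l + 1)) = 0" if "a < length xs" for a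
      by (rule trace_form_zero_right[OF sl_mat[OF xs_sl[OF that]]])
    then show "\<zero>\<^bsub>sl l\<^esub> \<in> ?S" using f_zero sl_closed(4) by (simp add: sl_simps(4))
  next
    fix u v assume "u \<in> ?S" "v \<in> ?S"
    then show "u \<oplus>\<^bsub>sl l\<^esub> v \<in> ?S"
      using xs_sl by (simp add: sl_simps(2) sl_closed f_add tr_add scale_left_distrib sum.distrib)
  next
    fix c u assume "u \<in> ?S"
    then show "c \<odot>\<^bsub>sl l\<^esub> u \<in> ?S"
      using xs_sl by (simp add: sl_simps(3) sl_closed f_scale tr_scale scale_sum_right)
  qed auto
  moreover have "set xs \<subseteq> ?S"
  proof
    fix x assume "x \<in> set xs"
    then obtain b where b: "b < length xs" "x = xs ! b" by (auto simp: in_set_conv_nth)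
    have "(\<Sum>a<length xs. trace_form l (xs ! a) x *c f (xs ! a)) = (\<Sum>a<length xs. if a = b then f (xs ! a) else 0)"
      by (rule sum.cong) (use xs b in \<open>auto simp: orthonormal_basis_def\<close>)
    then show "x \<in> ?S" using b xs_sl by simp
  qed
  ultimately have "span_in (sl l) (set xs) \<subseteq> ?S" by (rule sl.span_in_minimal)
  then show ?thesis using xs y by (auto simp: orthonormal_basis_def)
qed

end

text \<open>The Casimir tensor is the same for all pairs of dual bases: expand one argument in
  matrix units, recognize the coefficients as trace pairings, and resum over the orthonormal basis
  in the other argument.\<close>

lemma (in complex_space) casimir_independent:
  assumes xs: "orthonormal_basis (sl l) (trace_form l) xs"
    and left: "\<And>y. y \<in> carrier (sl l) \<Longrightarrow> sl_linear scale l (\<lambda>x. B x y)"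
    and right: "\<And>x. x \<in> carrier (sl l) \<Longrightarrow> sl_linear scale l (\<lambda>y. B x y)"
  shows "(\<Sum>a<length xs. B (xs ! a) (xs ! a)) = (\<Sum>i<l + 1. \<Sum>j<l + 1. B (munit l i j) (munit l j i))"
proof -
  have xs_sl: "xs ! a \<in> carrier (sl l)" if "a < length xs" for a
    using xs that by (auto simp: orthonormal_basis_def)
  have "(\<Sum>a<length xs. B (xs ! a) (xs ! a))
      = (\<Sum>a<length xs. \<Sum>i<l + 1. \<Sum>j<l + 1. scale (trace_form l (xs ! a) (munit l j i)) (B (munit l i j) (xs ! a)))"
  proof (rule sum.cong[OF refl])
    fix a assume "a \<in> {..<length xs}"
    then have a: "xs ! a \<in> carrier (sl l)" using xs_sl by simp
    show "B (xs ! a) (xs ! a) = (\<Sum>i<l + 1. \<Sum>j<l + 1. scale (trace_form l (xs ! a) (munit l j i)) (B (munit l i j) (xs ! a)))"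
      unfolding sl_linear.expand_munit[OF left[OF a] a]
      by (intro sum.cong refl) (use a in \<open>simp add: trace_form_munit\<close>)
  qed
  also have "\<dots> = (\<Sum>i<l + 1. \<Sum>j<l + 1. \<Sum>a<length xs. scale (trace_form l (xs ! a) (munit l j i)) (B (munit l i j) (xs ! a)))"
    by (subst sum.swap, rule sum.cong[OF refl], subst sum.swap) (rule refl)
  also have "\<dots> = (\<Sum>i<l + 1. \<Sum>j<l + 1. B (munit l i j) (munit l j i))"
    by (intro sum.cong refl sl_linear.expand_orthonormal[OF right xs, symmetric] munit_closed) auto
  finally show ?thesis .
qed


section \<open>The vertex algebra N(k,0)\<close>

declare One_nat_def [simp del]

locale affine_sl =
  fixes l :: nat and k :: complex
begin

abbreviation NM where "NM \<equiv> N_mod (sl l) (trace_form l) k"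
abbreviation nact where "nact \<equiv> N_act (sl l) (trace_form l) k"
abbreviation nvac where "nvac \<equiv> N_vac (sl l) (trace_form l) k"

sublocale cb: closed_bracket "ahat l" "affine_nonneg (sl l) (trace_form l)" "\<lambda>(f, a). k * a"
  by (rule closed_bracket_affine)

lemma N_eqs: "cb.N = NM" "cb.act = nact" "cb.vac = nvac"
  by (simp_all add: N_mod_def N_rel_def N_vac_def N_act_def cb.act_def Let_def fun_eq_iff)

lemmas nact_linear = cb.act_linear[unfolded N_eqs]
  and nact_add = cb.act_add[unfolded N_eqs]
  and nact_smult = cb.act_smult[unfolded N_eqs]
  and nact_bracket = cb.act_bracket[unfolded N_eqs]
  and nact_vac = cb.act_vac[unfolded N_eqs]
  and nvac_closed = cb.vac_closed[unfolded N_eqs]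
  and nact_generated = cb.generated_by_vac[unfolded N_eqs]

sublocale NM: complex_module NM
  using cb.N.complex_module_axioms by (simp only: N_eqs)

definition cur :: "complex mat \<Rightarrow> int \<Rightarrow> complex mat Ncarr \<Rightarrow> complex mat Ncarr"
  where "cur x n = nact (loop (sl l) x n)"

lemma cur_linear: "x \<in> carrier (sl l) \<Longrightarrow> linear_on NM NM (cur x n)"
  unfolding cur_def by (rule nact_linear[OF loop_closed])

lemma cur_closed: "x \<in> carrier (sl l) \<Longrightarrow> v \<in> carrier NM \<Longrightarrow> cur x n v \<in> carrier NM"
  by (rule linear_onD(1)[OF cur_linear])

lemma cur_add: "x \<in> carrier (sl l) \<Longrightarrow> y \<in> carrier (sl l) \<Longrightarrow> v \<in> carrier NM \<Longrightarrow>
    cur (x + y) n v = cur x n v \<oplus>\<^bsub>NM\<^esub> cur y n v"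
  unfolding cur_def loop_add by (rule nact_add) (simp_all add: loop_closed)

lemma cur_smult: "x \<in> carrier (sl l) \<Longrightarrow> v \<in> carrier NM \<Longrightarrow> cur (c \<cdot>\<^sub>m x) n v = c \<odot>\<^bsub>NM\<^esub> cur x n v"
  unfolding cur_def loop_smult by (rule nact_smult) (simp_all add: loop_closed)

lemma cur_zero: "v \<in> carrier NM \<Longrightarrow> cur (0\<^sub>m (l + 1) (l + 1)) n v = \<zero>\<^bsub>NM\<^esub>"
  using cur_smult[OF zero_sl, of v 0 n] cur_closed[OF zero_sl, of v n]
  by simp

lemma cur_of_zero: "x \<in> carrier (sl l) \<Longrightarrow> cur x n \<zero>\<^bsub>NM\<^esub> = \<zero>\<^bsub>NM\<^esub>"
  using linear_onD(3)[OF cur_linear, of x "\<zero>\<^bsub>NM\<^esub>" n 0] cur_closed[of x "\<zero>\<^bsub>NM\<^esub>" n] by simp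

lemma nact_central_0: "v \<in> carrier NM \<Longrightarrow> nact (central l 0) v = \<zero>\<^bsub>NM\<^esub>"
  using nact_smult[OF central_closed, of v 0 1] linear_onD(1)[OF nact_linear[OF central_closed]]
  by (simp flip: central_smult)

text \<open>The vectors on which the central element acts by \<open>k\<close> include the vacuum and
  are preserved by the whole algebra.\<close>

lemma nact_central:
  assumes v: "v \<in> carrier NM"
  shows "nact (central l s) v = (s * k) \<odot>\<^bsub>NM\<^esub> v"
proof -
  note lin = linear_onD[OF nact_linear]
  let ?W = "{v \<in> carrier NM. nact (central l 1) v = k \<odot>\<^bsub>NM\<^esub> v}"
  have "?W = carrier NM"
  proof (rule nact_generated)
    have "nact (central l 1) \<zero>\<^bsub>NM\<^esub> = \<zero>\<^bsub>NM\<^esub>"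
      using lin(3)[OF central_closed, of "\<zero>\<^bsub>NM\<^esub>" 1 0] lin(1)[OF central_closed, of "\<zero>\<^bsub>NM\<^esub>" 1] by simp
    then show "submodule ?W CC NM"
      by (intro NM.submodule_CC_I)
        (auto simp: lin(2,3)[OF central_closed] NM.smult_add NM.smult_smult mult.commute)
    have "central l 1 \<in> affine_nonneg (sl l) (trace_form l)"
      by (auto simp: affine_nonneg_def central_def affine_simps)
    then show "nvac \<in> ?W" using nact_vac nvac_closed by (auto simp: central_def)
    fix z w assume z: "z \<in> carrier (ahat l)" and w: "w \<in> ?W"
    have wN: "w \<in> carrier NM" using w by simp
    have "nact z (nact (central l 1) w) = nact (central l 1) (nact z w) \<oplus>\<^bsub>NM\<^esub> nact (central l 0) w"
      using nact_bracket[OF z central_closed wN] by (simp add: bracket_central[OF z])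
    then have "nact (central l 1) (nact z w) = nact z (k \<odot>\<^bsub>NM\<^esub> w)"
      using w lin(1)[OF central_closed] lin(1)[OF z] by (simp add: nact_central_0)
    then show "nact z w \<in> ?W"
      using w lin(1,3)[OF z] by simp
  qed
  then have "nact (central l 1) v = k \<odot>\<^bsub>NM\<^esub> v" using v by blast
  then show ?thesis
    unfolding central_smult[of l s] nact_smult[OF central_closed v] using v by (simp add: NM.smult_smult)
qed

lemma cur_comm:
  assumes x: "x \<in> carrier (sl l)" and y: "y \<in> carrier (sl l)" and v: "v \<in> carrier NM"
  shows "cur x m (cur y n v) = cur y n (cur x m v) \<oplus>\<^bsub>NM\<^esub> cur (x * y - y * x) (m + n) v
    \<oplus>\<^bsub>NM\<^esub> ((if m + n = 0 then of_int m * trace_form l x y else 0) * k) \<odot>\<^bsub>NM\<^esub> v"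
  unfolding cur_def nact_bracket[OF loop_closed[OF x] loop_closed[OF y] v] bracket_loop[OF x y]
  using nact_add[OF loop_closed[OF sl_closed(3)[OF x y]] central_closed v] nact_central[OF v]
    linear_onD(1)[OF nact_linear[OF loop_closed]] sl_closed(3)[OF x y] x y v
  by (simp add: NM.a_assoc)

lemma cur_vac:
  assumes "x \<in> carrier (sl l)" "0 \<le> n"
  shows "cur x n nvac = \<zero>\<^bsub>NM\<^esub>"
proof -
  have "loop (sl l) x n \<in> affine_nonneg (sl l) (trace_form l)"
    using loop_closed[OF assms(1), of n] assms(2) by (auto simp: affine_nonneg_def loop_def)
  then show ?thesis
    unfolding cur_def using nact_vac nvac_closed by (auto simp: loop_def)
qed

text \<open>Induction on the support: an element of the affine algebra is central up to finitely
  many loop elements, and central ones act by scalars.\<close>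

lemma stable_under_nact:
  assumes W: "submodule W CC NM" and c: "\<And>x n w. x \<in> carrier (sl l) \<Longrightarrow> w \<in> W \<Longrightarrow> cur x n w \<in> W"
    and z: "z \<in> carrier (ahat l)" and w: "w \<in> W"
  shows "nact z w \<in> W"
proof -
  note E = NM.submodule_CC_E[OF W]
  have wN: "w \<in> carrier NM" using w E(1) by blast
  have main: "nact (f, a) w \<in> W"
    if "finite S" "(f, a) \<in> carrier (ahat l)" "{n. f n \<noteq> \<zero>\<^bsub>sl l\<^esub>} \<subseteq> S" for S f a
    using that
  proof (induction S arbitrary: f)
    case empty
    then have "(f, a) = central l a" by (auto simp: central_def)
    then show ?case using nact_central[OF wN] E(4)[OF w] by simp
  next
    case (insert n S)
    let ?f = "f(n := \<zero>\<^bsub>sl l\<^esub>)"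
    have fn: "f n \<in> carrier (sl l)" using insert.prems by (simp add: affine_simps)
    have "{m. ?f m \<noteq> \<zero>\<^bsub>sl l\<^esub>} \<subseteq> {m. f m \<noteq> \<zero>\<^bsub>sl l\<^esub>}" by auto
    then have fc: "(?f, a) \<in> carrier (ahat l)"
      using insert.prems(1) finite_subset[OF \<open>{m. ?f m \<noteq> \<zero>\<^bsub>sl l\<^esub>} \<subseteq> {m. f m \<noteq> \<zero>\<^bsub>sl l\<^esub>}\<close>]
      by (simp add: affine_simps del: fun_upd_apply) (simp add: sl_simps(4) zero_sl)
    have "{m. ?f m \<noteq> \<zero>\<^bsub>sl l\<^esub>} \<subseteq> S" using insert.prems(2) by auto
    then have "nact (?f, a) w \<in> W" by (rule insert.IH[OF fc])
    moreover have "nact (loop (sl l) (f n) n) w \<in> W" using c[OF fn w] by (simp add: cur_def)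
    ultimately show ?case
      unfolding affine_split[OF insert.prems(1), of n]
      using nact_add[OF fc loop_closed[OF fn] wN] E(3) by simp
  qed
  obtain f a where z': "z = (f, a)" by (cases z)
  then show ?thesis using main[of "{n. f n \<noteq> \<zero>\<^bsub>sl l\<^esub>}" f a] z by (auto simp: affine_simps)
qed

lemma cur_generated:
  assumes "submodule W CC NM" "nvac \<in> W" "\<And>x n w. x \<in> carrier (sl l) \<Longrightarrow> w \<in> W \<Longrightarrow> cur x n w \<in> W"
  shows "W = carrier NM"
  by (rule nact_generated[OF assms(1,2)]) (rule stable_under_nact[OF assms(1,3)])

definition gen :: "complex mat \<Rightarrow> complex mat Ncarr"
  where "gen x = cur x (- 1) nvac"

lemma gen_closed: "x \<in> carrier (sl l) \<Longrightarrow> gen x \<in> carrier NM"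
  unfolding gen_def by (rule cur_closed[OF _ nvac_closed])

text \<open>The operator product of two currents: the bracket at mode 0, the level at mode 1,
  nothing beyond.\<close>

lemma cur_gen:
  assumes x: "x \<in> carrier (sl l)" and y: "y \<in> carrier (sl l)"
  shows "cur x 0 (gen y) = gen (x * y - y * x)"
    "cur x 1 (gen y) = (trace_form l x y * k) \<odot>\<^bsub>NM\<^esub> nvac"
    "2 \<le> n \<Longrightarrow> cur x n (gen y) = \<zero>\<^bsub>NM\<^esub>"
proof -
  have b: "x * y - y * x \<in> carrier (sl l)" by (rule sl_closed(3)[OF x y])
  have "cur x n (gen y) = cur (x * y - y * x) (n - 1) nvac
      \<oplus>\<^bsub>NM\<^esub> ((if n = 1 then of_int n * trace_form l x y else 0) * k) \<odot>\<^bsub>NM\<^esub> nvac" if "0 \<le> n" for n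
    unfolding gen_def cur_comm[OF x y nvac_closed] cur_vac[OF x that] cur_of_zero[OF y]
    using cur_closed[OF b nvac_closed] nvac_closed by simp
  note this[of 0] this[of 1] this[of n]
  then show "cur x 0 (gen y) = gen (x * y - y * x)"
    "cur x 1 (gen y) = (trace_form l x y * k) \<odot>\<^bsub>NM\<^esub> nvac"
    "2 \<le> n \<Longrightarrow> cur x n (gen y) = \<zero>\<^bsub>NM\<^esub>"
    using cur_closed[OF b nvac_closed] nvac_closed by (simp_all add: gen_def cur_vac[OF b])
qed

end

text \<open>Only \<open>j = 1\<close> contributes to the commutator formula, with binomial
  coefficient \<open>r\<close>. For \<open>v\<close> the conformal vector, this is the commutator of
  a mode of \<open>u\<close> with L(0).\<close>

lemma (in weak_vertex_module) primary_commutator: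
  assumes u: "u \<in> carrier V" and v: "v \<in> carrier V" and w: "w \<in> carrier M"
    and p: "Y u 0 v = \<zero>\<^bsub>V\<^esub>" "Y u 1 v = u" "\<And>j. 2 \<le> j \<Longrightarrow> Y u j v = \<zero>\<^bsub>V\<^esub>"
  shows "YM u r (YM v 1 w) \<ominus>\<^bsub>M\<^esub> YM v 1 (YM u r w) = of_int r \<odot>\<^bsub>M\<^esub> YM u r w"
proof -
  let ?f = "\<lambda>j. ((of_int r :: complex) gchoose j) \<odot>\<^bsub>M\<^esub> YM (Y u (int j) v) (r + 1 - int j) w"
  have "fin_supp_sum M ?f = ?f 0 \<oplus>\<^bsub>M\<^esub> ?f 1"
    by (rule M.fin_supp_sum_first_two) (use u v w p in \<open>auto simp: Y_closed YM_zero_left\<close>)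
  then show ?thesis
    using commutator[OF u v w, of r 1] u v w p by (simp add: YM_zero_left)
qed

locale affine_sl_VOA = affine_sl +
  fixes xs :: "complex mat list"
    and Y :: "complex mat Ncarr \<Rightarrow> int \<Rightarrow> complex mat Ncarr \<Rightarrow> complex mat Ncarr"
  assumes even_l: "even l" and level: "k = - (of_nat (l + 1) / 2)"
    and xs: "orthonormal_basis (sl l) (trace_form l) xs"
    and Y: "is_N_vertex_operators (sl l) (trace_form l) (of_nat (l + 1)) k xs Y"
begin

definition conf where "conf = N_conformal (sl l) (trace_form l) (of_nat (l + 1)) k xs"

lemma VOA: "vertex_operator_algebra NM nvac Y conf"
  using Y by (simp add: is_N_vertex_operators_def conf_def)

lemma conf_closed: "conf \<in> carrier NM"
  using VOA by (simp add: vertex_operator_algebra_def)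

lemma Y_gen: "x \<in> carrier (sl l) \<Longrightarrow> v \<in> carrier NM \<Longrightarrow> Y (gen x) n v = cur x n v"
  using Y by (simp add: is_N_vertex_operators_def gen_def cur_def)

lemma weak_N: "weak_module NM nvac Y NM Y"
  using VOA by (simp add: vertex_operator_algebra_def)

sublocale NN: weak_vertex_module NM NM nvac Y Y
proof (intro weak_vertex_module.intro weak_vertex_module_axioms.intro)
  have "linear_on NM NM (Y u n)" if "u \<in> carrier NM" for u n
    using weak_N that by (simp add: weak_module_def)
  from linear_onD(1)[OF this]
  show "Y u n v \<in> carrier NM" if "u \<in> carrier NM" "v \<in> carrier NM" for u n v
    using that by simp
qed (rule NM.complex_module_axioms weak_N nvac_closed)+

lemma xs_sl: "a < length xs \<Longrightarrow> xs ! a \<in> carrier (sl l)"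
  using xs by (auto simp: orthonormal_basis_def)

lemma gens_generate:
  assumes "submodule S CC NM" "nvac \<in> S" "\<And>g n s. g \<in> gen ` carrier (sl l) \<Longrightarrow> s \<in> S \<Longrightarrow> Y g n s \<in> S"
  shows "S = carrier NM"
proof (rule cur_generated[OF assms(1,2)])
  fix x n w assume x: "x \<in> carrier (sl l)" and w: "w \<in> S"
  have "w \<in> carrier NM" using w NM.submodule_CC_E(1)[OF assms(1)] by blast
  then show "cur x n w \<in> S" using assms(3)[OF imageI[OF x] w, of n] Y_gen[OF x] by simp
qed

end

locale affine_sl_embedded = affine_sl_VOA l k xs Y + embedded_module scale NM emb ev
  for l k xs Y and scale :: "complex \<Rightarrow> 'v::ab_group_add \<Rightarrow> 'v"  (infixr \<open>*c\<close> 75) and emb ev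
begin

text \<open>Zero for indices out of range, so that linearity and the inclusion in the image hold for
  all indices.\<close>

definition a :: "nat \<Rightarrow> nat \<Rightarrow> int \<Rightarrow> 'v \<Rightarrow> 'v"
  where "a i j n = (if i < l + 1 \<and> j < l + 1 then lift (cur (munit l i j) n) else (\<lambda>_. 0))"

lemma sl_linear_cur: "v \<in> carrier NM \<Longrightarrow> sl_linear scale l (\<lambda>x. emb (cur x n v))"
  by unfold_locales (simp_all add: cur_add cur_smult cur_closed emb_add emb_smult)

lemma a_emb: "i < l + 1 \<Longrightarrow> j < l + 1 \<Longrightarrow> v \<in> carrier NM \<Longrightarrow> a i j n (emb v) = emb (cur (munit l i j) n v)"
  by (simp add: a_def)

lemma emb_cur_bracket:
  assumes "i < l + 1" "j < l + 1" "p < l + 1" "q < l + 1" "v \<in> carrier NM"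
  shows "emb (cur (munit l i j * munit l p q - munit l p q * munit l i j) n v)
    = (if j = p then a i q n (emb v) else 0) - (if q = i then a p j n (emb v) else 0)"
proof -
  interpret sl_linear scale l "\<lambda>x. emb (cur x n v)" by (rule sl_linear_cur[OF assms(5)])
  have 1: "(if j = p then munit l i q else 0\<^sub>m (l + 1) (l + 1)) \<in> carrier (sl l)"
    "(if q = i then munit l p j else 0\<^sub>m (l + 1) (l + 1)) \<in> carrier (sl l)"
    using assms munit_closed zero_sl by auto
  show ?thesis
    unfolding bracket_munit[OF assms(1-4)] f_add[OF 1(1) sl_closed(2)[OF 1(2)]] f_scale[OF 1(2)]
    using assms f_zero by (auto simp: a_emb)
qed

sublocale vacuum_rep scale image_space "l + 1" k a "emb nvac"
proof
  show "subspace image_space" by (rule subspace_image_space)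
  fix i j n u v c
  have endo: "endo (a i j n)"
    using endo_lift[OF cur_linear[OF munit_closed]] by (auto simp: a_def intro: endoI)
  show "a i j n (u + v) = a i j n u + a i j n v" "a i j n (c *c v) = c *c a i j n v"
    by (rule endo_add[OF endo] endo_scale[OF endo])+
  show "a i j n v \<in> image_space"
    using lift_image[of "cur (munit l i j) n"] cur_closed[OF munit_closed] subspace_0[OF subspace_image_space]
    by (auto simp: a_def)
  have "(\<Sum>i<l + 1. a i i n v) = (\<Sum>i<l + 1. emb (cur (munit l i i) n (ev v)))"
    by (rule sum.cong) (auto simp: a_def lift_def)
  then show "(\<Sum>i<l + 1. a i i n v) = 0"
    using sl_linear.trace_munit[OF sl_linear_cur[of "ev v" n]] by simp
next
  fix i j p q m n v assume ijpq: "i < l + 1" "j < l + 1" "p < l + 1" "q < l + 1" and "v \<in> image_space"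
  then obtain w where w: "w \<in> carrier NM" "v = emb w" by blast
  note c = munit_closed[OF ijpq(1,2)] munit_closed[OF ijpq(3,4)]
  show "a i j m (a p q n v) = a p q n (a i j m v)
        + (if j = p then a i q (m + n) v else 0) - (if q = i then a p j (m + n) v else 0)
        + (if m + n = 0 then of_int m * k *
            ((if j = p \<and> i = q then 1 else 0) - (if i = j \<and> p = q then 1 / of_nat (l + 1) else 0)) else 0) *c v"
    using ijpq w c
    by (simp add: a_emb cur_closed cur_comm[OF c w(1)] emb_add emb_smult sl_closed emb_cur_bracket
        trace_form_munit_munit mult_ac del: of_nat_add of_nat_Suc)
next
  show "emb nvac \<in> image_space" using nvac_closed by blast
  show "a i j n (emb nvac) = 0" if "i < l + 1" "j < l + 1" "0 \<le> n" for i j n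
    using that nvac_closed by (simp add: a_emb cur_vac munit_closed)
  show "k = - (of_nat (l + 1) / 2)" by (rule level)
qed simp

text \<open>Both sides are Casimir sums, in different dual bases. The Sugawara factor agrees with
  the trace average because \<open>2 * (k + of_nat (l + 1))\<close> equals \<open>l + 1\<close> at
  this level.\<close>

lemma emb_conf: "emb conf = \<omega>"
proof -
  let ?B = "\<lambda>x y. emb (cur x (- 1) (cur y (- 1) nvac))"
  have closed: "cur x (- 1) (cur x (- 1) nvac) \<in> carrier NM" if "x \<in> carrier (sl l)" for x
    using that by (simp add: cur_closed nvac_closed)
  have "emb conf = (1 / (2 * (k + of_nat (l + 1)))) *c (\<Sum>i<length xs. ?B (xs ! i) (xs ! i))"
    unfolding conf_def N_conformal_def cur_def[symmetric]
    by (subst emb_smult, rule NM.finsum_closed)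
      (use closed xs_sl in \<open>auto simp: emb_finsum\<close>)
  also have "(\<Sum>i<length xs. ?B (xs ! i) (xs ! i)) = (\<Sum>i<l + 1. \<Sum>j<l + 1. ?B (munit l i j) (munit l j i))"
  proof (rule casimir_independent[OF xs])
    show "sl_linear scale l (\<lambda>x. ?B x y)" if "y \<in> carrier (sl l)" for y
      by (rule sl_linear_cur) (use that in \<open>simp add: cur_closed nvac_closed\<close>)
    show "sl_linear scale l (\<lambda>y. ?B x y)" if "x \<in> carrier (sl l)" for x
      by unfold_locales
        (use that nvac_closed in \<open>simp_all add: cur_add cur_smult cur_closed linear_onD[OF cur_linear] emb_add emb_smult\<close>)
  qed
  also have "\<dots> = (\<Sum>i<l + 1. s i i)"
    unfolding s_def by (intro sum.cong refl) (simp add: a_emb nvac_closed cur_closed munit_closed)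
  also have "1 / (2 * (k + of_nat (l + 1))) = (1 / of_nat (l + 1) :: complex)"
    unfolding level by (simp add: field_simps)
  finally show ?thesis by (simp only: \<omega>_def)
qed

lemma munit_conf:
  assumes "i < l + 1" "j < l + 1"
  shows "cur (munit l i j) 0 conf = \<zero>\<^bsub>NM\<^esub>" "cur (munit l i j) 1 conf = gen (munit l i j)"
    "2 \<le> n \<Longrightarrow> cur (munit l i j) n conf = \<zero>\<^bsub>NM\<^esub>"
proof -
  have e: "emb (cur (munit l i j) n conf) = a i j n \<omega>" for n
    using a_emb[OF assms conf_closed, of n] by (simp add: emb_conf)
  note c = cur_closed[OF munit_closed[OF assms] conf_closed]
  show "cur (munit l i j) 0 conf = \<zero>\<^bsub>NM\<^esub>"
    using e[of 0] a0_\<omega>[OF assms] emb_inj[OF c NM.zero_closed] by simp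
  show "2 \<le> n \<Longrightarrow> cur (munit l i j) n conf = \<zero>\<^bsub>NM\<^esub>"
    using e[of n] a2_\<omega>[OF assms] emb_inj[OF c NM.zero_closed] by simp
  have "emb (cur (munit l i j) 1 conf) = emb (gen (munit l i j))"
    using e[of 1] a1_\<omega>[OF assms] assms by (simp add: a_emb nvac_closed gen_def)
  then show "cur (munit l i j) 1 conf = gen (munit l i j)"
    using emb_inj[OF c gen_closed[OF munit_closed[OF assms]]] by simp
qed

lemma munit_conf_commutator:
  assumes "i < l + 1" "j < l + 1" and M: "weak_vertex_module NM M nvac Y YM" and w: "w \<in> carrier M"
  shows "YM (gen (munit l i j)) r (YM conf 1 w) \<ominus>\<^bsub>M\<^esub> YM conf 1 (YM (gen (munit l i j)) r w)
    = of_int r \<odot>\<^bsub>M\<^esub> YM (gen (munit l i j)) r w"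
  by (rule weak_vertex_module.primary_commutator[OF M _ conf_closed w])
    (simp_all add: assms gen_closed munit_closed Y_gen conf_closed munit_conf)

lemma sl_cur_mem:
  assumes W: "submodule W CC NM" and c: "\<And>i j n w. i < l + 1 \<Longrightarrow> j < l + 1 \<Longrightarrow> w \<in> W \<Longrightarrow> cur (munit l i j) n w \<in> W"
    and x: "x \<in> carrier (sl l)" and w: "w \<in> W"
  shows "cur x n w \<in> W"
proof -
  have wN: "w \<in> carrier NM" using w NM.submodule_CC_E(1)[OF W] by blast
  have "emb (cur x n w) = (\<Sum>i<l + 1. \<Sum>j<l + 1. x $$ (i, j) *c emb (cur (munit l i j) n w))"
    by (rule sl_linear.expand_munit[OF sl_linear_cur[OF wN] x])
  also have "\<dots> \<in> emb ` W"
    by (intro subspace_sum[OF subspace_emb[OF W]] subspace_scale[OF subspace_emb[OF W]] imageI c w) auto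
  finally obtain w' where w': "w' \<in> W" "emb (cur x n w) = emb w'" by blast
  then have "w' \<in> carrier NM" using NM.submodule_CC_E(1)[OF W] by blast
  then show ?thesis using emb_inj[OF cur_closed[OF x wN]] w' by simp
qed

text \<open>The projected matrix units span \<open>sl\<close> and the central element acts by a
  scalar, so stability under their modes already means being an affine submodule.\<close>

lemma stable_emb_iff:
  assumes W: "W \<subseteq> carrier NM"
  shows "stable (emb ` W) \<longleftrightarrow> stable_submodule NM (nact ` carrier (ahat l)) W"
proof
  assume st: "stable (emb ` W)"
  have sW: "submodule W CC NM"
    using st submodule_pullback[of "emb ` W"] pullback_emb[OF W] by (simp add: stable_def)
  have c: "cur (munit l i j) n w \<in> W" if "i < l + 1" "j < l + 1" "w \<in> W" for i j n w
  proof -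
    have wN: "w \<in> carrier NM" using that W by blast
    have "emb (cur (munit l i j) n w) \<in> emb ` W"
      using st that a_emb[OF that(1,2) wN, of n] unfolding stable_def by (metis imageI)
    then obtain w' where w': "w' \<in> W" "emb (cur (munit l i j) n w) = emb w'" by blast
    then have "w' \<in> carrier NM" using W by blast
    then show ?thesis using emb_inj[OF cur_closed[OF munit_closed[OF that(1,2)] wN]] w' by simp
  qed
  then show "stable_submodule NM (nact ` carrier (ahat l)) W"
    using sW stable_under_nact[OF sW sl_cur_mem[OF sW c]] by (auto simp: stable_submodule_def)
next
  assume st: "stable_submodule NM (nact ` carrier (ahat l)) W"
  have "cur (munit l i j) n w \<in> W" if "i < l + 1" "j < l + 1" "w \<in> W" for i j n w
    using st that loop_closed[OF munit_closed[OF that(1,2)]] by (auto simp: stable_submodule_def cur_def)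
  then show "stable (emb ` W)"
    using st W subspace_emb[of W] by (auto simp: stable_def stable_submodule_def a_emb subset_iff)
qed

text \<open>The currents generate the vertex algebra. In particular affine submodules are stable
  under L(0), a mode of the conformal vector.\<close>

lemma stable_Y:
  assumes W: "stable_submodule NM (nact ` carrier (ahat l)) W" and v: "v \<in> carrier NM" and w: "w \<in> W"
  shows "Y v n w \<in> W"
proof (rule NN.stable_under_generated[of W "gen ` carrier (sl l)"])
  show sW: "submodule W CC NM" using W by (simp add: stable_submodule_def)
  show "gen ` carrier (sl l) \<subseteq> carrier NM" using gen_closed by blast
  fix g n w assume "g \<in> gen ` carrier (sl l)" and w: "w \<in> W"
  then obtain x where x: "x \<in> carrier (sl l)" "g = gen x" by blast
  have "cur x n w \<in> W"
    using W w loop_closed[OF x(1)] by (auto simp: stable_submodule_def cur_def)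
  then show "Y g n w \<in> W" using x w NM.submodule_CC_E(1)[OF sW] Y_gen by auto
qed (use gens_generate v w in auto)

abbreviation Nmax where "Nmax \<equiv> N_max (sl l) (trace_form l) k"

text \<open>A submodule is proper exactly when it misses the vacuum, so
  \<open>greatest_proper_stable\<close> produces the one object satisfying the definite description
  behind \<open>N_max\<close>.\<close>

theorem N_max_properties:
  assumes "nvac \<noteq> \<zero>\<^bsub>NM\<^esub>"
  shows "stable_submodule NM (nact ` carrier (ahat l)) Nmax"
    and "\<And>i j. i < l + 1 \<Longrightarrow> j < l + 1 \<Longrightarrow> ev (b i j) \<in> Nmax"
proof -
  let ?st = "stable_submodule NM (nact ` carrier (ahat l))"
  let ?D = "lift (Y conf 1)"
  interpret conformal_vacuum_rep scale image_space "l + 1" k a "emb nvac" ?D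
  proof
    have endo: "endo ?D" by (rule endo_lift[OF NN.YM_linear[OF conf_closed]])
    show "?D (u + v) = ?D u + ?D v" "?D (c *c v) = c *c ?D v" for u v c
      by (rule endo_add[OF endo] endo_scale[OF endo])+
    have "Y conf 1 nvac = \<zero>\<^bsub>NM\<^esub>"
      using VOA conf_closed by (simp add: vertex_operator_algebra_def)
    then show "?D (emb nvac) = 0" using nvac_closed by simp
    fix i j n v assume ij: "i < l + 1" "j < l + 1" and "v \<in> image_space"
    then obtain w where w: "w \<in> carrier NM" "v = emb w" by blast
    let ?g = "gen (munit l i j)"
    have g: "?g \<in> carrier NM" by (rule gen_closed[OF munit_closed[OF ij]])
    have "emb (Y ?g n (Y conf 1 w)) - emb (Y conf 1 (Y ?g n w)) = of_int n *c emb (Y ?g n w)"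
      using munit_conf_commutator[OF ij NN.weak_vertex_module_axioms w(1), of n] w(1) g conf_closed
      by (simp flip: emb_minus emb_smult)
    then show "?D (a i j n v) = a i j n (?D v) - of_int n *c a i j n v"
      using ij w g conf_closed
      by (simp add: a_emb Y_gen munit_closed cur_closed algebra_simps)
  next
    fix W w assume W: "stable W" and w: "w \<in> W"
    have WV: "W \<subseteq> image_space" using W by (simp add: stable_def)
    have "?st (pullback W)"
      using stable_emb_iff[of "pullback W"] W emb_pullback[OF WV] by (simp add: pullback_def)
    then have "Y conf 1 (ev w) \<in> pullback W"
      using w WV by (intro stable_Y) (auto simp: conf_closed pullback_def)
    then show "?D w \<in> W" by (simp add: pullback_def lift_def)
  next
    fix W assume W: "stable W" and v: "emb nvac \<in> W"
    have WV: "W \<subseteq> image_space" using W by (simp add: stable_def)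
    have "?st (pullback W)"
      using stable_emb_iff[of "pullback W"] W emb_pullback[OF WV] by (simp add: pullback_def)
    then have "pullback W = carrier NM"
      using v nvac_closed by (intro nact_generated) (auto simp: stable_submodule_def pullback_def)
    then show "W = image_space" using emb_pullback[OF WV] by simp
  next
    show "emb nvac \<noteq> 0" using assms emb_inj[OF nvac_closed NM.zero_closed] by simp
  qed
  obtain J where J: "stable J" "emb nvac \<notin> J" "\<And>W. stable W \<Longrightarrow> emb nvac \<notin> W \<Longrightarrow> W \<subseteq> J"
    "\<And>i j. i < l + 1 \<Longrightarrow> j < l + 1 \<Longrightarrow> b i j \<in> J"
    by (rule greatest_proper_stable) (rule that)
  have JV: "J \<subseteq> image_space" using J(1) by (simp add: stable_def)
  let ?J = "pullback J"
  have Jc: "?J \<subseteq> carrier NM" by (auto simp: pullback_def)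
  have J1: "?st ?J" using stable_emb_iff[OF Jc] J(1) emb_pullback[OF JV] by simp
  have J2: "?J \<noteq> carrier NM" using J(2) nvac_closed by (auto simp: pullback_def)
  have J3: "W \<subseteq> ?J" if W: "?st W" "W \<noteq> carrier NM" for W
  proof -
    have Wc: "W \<subseteq> carrier NM" using W NM.submodule_CC_E(1) by (auto simp: stable_submodule_def)
    have "nvac \<notin> W"
      using W nact_generated[of W] by (auto simp: stable_submodule_def)
    then have "emb nvac \<notin> emb ` W" using Wc emb_inj[OF nvac_closed] by (auto simp: subset_iff)
    then have "emb ` W \<subseteq> J" using J(3) stable_emb_iff[OF Wc] W by blast
    then show ?thesis using Wc by (auto simp: pullback_def)
  qed
  have "Nmax = ?J"
    unfolding N_max_def max_proper_submodule_def
  proof (rule the_equality)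
    show "?st ?J \<and> ?J \<noteq> carrier NM \<and> (\<forall>W. ?st W \<longrightarrow> W \<noteq> carrier NM \<longrightarrow> W \<subseteq> ?J)"
      using J1 J2 J3 by blast
    fix J' assume "?st J' \<and> J' \<noteq> carrier NM \<and> (\<forall>W. ?st W \<longrightarrow> W \<noteq> carrier NM \<longrightarrow> W \<subseteq> J')"
    then show "J' = ?J" using J1 J2 J3 by blast
  qed
  then show "?st Nmax" "\<And>i j. i < l + 1 \<Longrightarrow> j < l + 1 \<Longrightarrow> ev (b i j) \<in> Nmax"
    using J1 J(4) JV by (auto simp: pullback_def emb_ev subset_iff)
qed

end


section \<open>Weak N(k,0)-modules from category O\<close>

text \<open>A weak module over the quotient, regarded as one over N(k,0) on which the singular
  vectors \<open>b i j\<close> act as zero. There are two embeddings, one for N(k,0) and one for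
  \<open>M\<close>.\<close>

locale weak_N_module = affine_sl_embedded l k xs Y scale emb ev +
  weak_vertex_module NM M nvac Y YM + E: embedded_module scaleM M embM evM
  for l k xs Y and scale :: "complex \<Rightarrow> 'v::ab_group_add \<Rightarrow> 'v" and emb ev
    and M :: "(complex, 'w, 'q) module_scheme" and YM
    and scaleM :: "complex \<Rightarrow> 'x::ab_group_add \<Rightarrow> 'x"  (infixr \<open>*m\<close> 75) and embM evM +
  assumes annihilated: "\<lbrakk>i < l + 1; j < l + 1; w \<in> carrier M\<rbrakk> \<Longrightarrow> YM (ev (b i j)) n w = \<zero>\<^bsub>M\<^esub>"
    and category_O: "category_O l M (\<lambda>(H, a, b) w.
      YM (gen H) 0 w \<oplus>\<^bsub>M\<^esub> (a * k) \<odot>\<^bsub>M\<^esub> w \<ominus>\<^bsub>M\<^esub> b \<odot>\<^bsub>M\<^esub> YM conf 1 w)"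
begin

definition aM :: "nat \<Rightarrow> nat \<Rightarrow> int \<Rightarrow> 'x \<Rightarrow> 'x"
  where "aM i j n = (if i < l + 1 \<and> j < l + 1 then E.lift (YM (gen (munit l i j)) n) else (\<lambda>_. 0))"

lemma gen_add: "x \<in> carrier (sl l) \<Longrightarrow> y \<in> carrier (sl l) \<Longrightarrow> gen (x + y) = gen x \<oplus>\<^bsub>NM\<^esub> gen y"
  unfolding gen_def by (rule cur_add[OF _ _ nvac_closed])

lemma gen_smult: "x \<in> carrier (sl l) \<Longrightarrow> gen (c \<cdot>\<^sub>m x) = c \<odot>\<^bsub>NM\<^esub> gen x"
  unfolding gen_def by (rule cur_smult[OF _ nvac_closed])

lemma gen_zero: "gen (0\<^sub>m (l + 1) (l + 1)) = \<zero>\<^bsub>NM\<^esub>"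
  unfolding gen_def by (rule cur_zero[OF nvac_closed])

lemma sl_linear_YM: "w \<in> carrier M \<Longrightarrow> sl_linear scaleM l (\<lambda>x. embM (YM (gen x) n w))"
  by unfold_locales
    (simp_all add: gen_add gen_smult gen_closed linear_onD[OF YM_linear_left] E.emb_add E.emb_smult)

lemma aM_emb: "i < l + 1 \<Longrightarrow> j < l + 1 \<Longrightarrow> w \<in> carrier M \<Longrightarrow> aM i j n (embM w) = embM (YM (gen (munit l i j)) n w)"
  by (simp add: aM_def)

lemma embM_gen_bracket:
  assumes "i < l + 1" "j < l + 1" "p < l + 1" "q < l + 1" "w \<in> carrier M"
  shows "embM (YM (gen (munit l i j * munit l p q - munit l p q * munit l i j)) n w)
    = (if j = p then aM i q n (embM w) else 0) - (if q = i then aM p j n (embM w) else 0)"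
proof -
  interpret sl_linear scaleM l "\<lambda>x. embM (YM (gen x) n w)" by (rule sl_linear_YM[OF assms(5)])
  have 1: "(if j = p then munit l i q else 0\<^sub>m (l + 1) (l + 1)) \<in> carrier (sl l)"
    "(if q = i then munit l p j else 0\<^sub>m (l + 1) (l + 1)) \<in> carrier (sl l)"
    using assms munit_closed zero_sl by auto
  show ?thesis
    unfolding bracket_munit[OF assms(1-4)] f_add[OF 1(1) sl_closed(2)[OF 1(2)]] f_scale[OF 1(2)]
    using assms f_zero by (auto simp: aM_emb)
qed

lemma current_commutator:
  assumes x: "x \<in> carrier (sl l)" and y: "y \<in> carrier (sl l)" and w: "w \<in> carrier M"
  shows "YM (gen x) r (YM (gen y) q w) \<ominus>\<^bsub>M\<^esub> YM (gen y) q (YM (gen x) r w)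
    = YM (gen (x * y - y * x)) (r + q) w
      \<oplus>\<^bsub>M\<^esub> (if r + q = 0 then of_int r * k * trace_form l x y else 0) \<odot>\<^bsub>M\<^esub> w"
proof -
  let ?f = "\<lambda>j. ((of_int r :: complex) gchoose j) \<odot>\<^bsub>M\<^esub> YM (Y (gen x) (int j) (gen y)) (r + q - int j) w"
  note g = gen_closed[OF x] gen_closed[OF y] gen_closed[OF sl_closed(3)[OF x y]]
  have Yg: "Y (gen x) n (gen y) = cur x n (gen y)" for n by (rule Y_gen[OF x g(2)])
  have "fin_supp_sum M ?f = ?f 0 \<oplus>\<^bsub>M\<^esub> ?f 1"
    by (rule M.fin_supp_sum_first_two)
      (use g w in \<open>auto simp: NN.Y_closed Yg cur_gen[OF x y] cur_closed[OF x] YM_zero_left\<close>)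
  moreover have "?f 0 = YM (gen (x * y - y * x)) (r + q) w"
    using g w by (simp add: Yg cur_gen[OF x y])
  moreover have "?f 1 = (if r + q = 0 then of_int r * k * trace_form l x y else 0) \<odot>\<^bsub>M\<^esub> w"
    using w nvac_closed
    by (auto simp: Yg cur_gen[OF x y] linear_onD(3)[OF YM_linear_left] YM_vac M.smult_smult mult_ac)
  ultimately show ?thesis using commutator[OF g(1,2) w, of r q] by simp
qed

lemma current_commutator':
  assumes x: "x \<in> carrier (sl l)" and y: "y \<in> carrier (sl l)" and w: "w \<in> carrier M"
  shows "embM (YM (gen x) r (YM (gen y) q w)) = embM (YM (gen y) q (YM (gen x) r w))
    + embM (YM (gen (x * y - y * x)) (r + q) w)
    + (if r + q = 0 then of_int r * k * trace_form l x y else 0) *m embM w"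
proof -
  note g = gen_closed[OF x] gen_closed[OF y] gen_closed[OF sl_closed(3)[OF x y]]
  have "embM (YM (gen x) r (YM (gen y) q w) \<ominus>\<^bsub>M\<^esub> YM (gen y) q (YM (gen x) r w))
      = embM (YM (gen (x * y - y * x)) (r + q) w
        \<oplus>\<^bsub>M\<^esub> (if r + q = 0 then of_int r * k * trace_form l x y else 0) \<odot>\<^bsub>M\<^esub> w)"
    unfolding current_commutator[OF assms] ..
  then show ?thesis
    using g w by (simp only: E.emb_minus E.emb_add E.emb_smult YM_closed M.smult_closed') (simp add: algebra_simps)
qed

sublocale LM: loop_rep scaleM E.image_space "l + 1" k aM
proof
  show "E.subspace E.image_space" by (rule E.subspace_image_space)
  fix i j n u v c
  have endo: "E.endo (aM i j n)"
    using E.endo_lift[OF YM_linear[OF gen_closed[OF munit_closed]]] by (auto simp: aM_def intro: E.endoI)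
  show "aM i j n (u + v) = aM i j n u + aM i j n v" "aM i j n (c *m v) = c *m aM i j n v"
    by (rule E.endo_add[OF endo] E.endo_scale[OF endo])+
  show "aM i j n v \<in> E.image_space"
    using E.lift_image[of "YM (gen (munit l i j)) n"] gen_closed[OF munit_closed] E.subspace_0[OF E.subspace_image_space]
    by (auto simp: aM_def)
  have "(\<Sum>i<l + 1. aM i i n v) = (\<Sum>i<l + 1. embM (YM (gen (munit l i i)) n (evM v)))"
    by (rule sum.cong) (auto simp: aM_def E.lift_def)
  then show "(\<Sum>i<l + 1. aM i i n v) = 0"
    using sl_linear.trace_munit[OF sl_linear_YM[of "evM v" n]] by simp
next
  fix i j p q m n v assume ijpq: "i < l + 1" "j < l + 1" "p < l + 1" "q < l + 1" and "v \<in> E.image_space"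
  then obtain w where w: "w \<in> carrier M" "v = embM w" by blast
  note c = munit_closed[OF ijpq(1,2)] munit_closed[OF ijpq(3,4)]
  show "aM i j m (aM p q n v) = aM p q n (aM i j m v)
        + (if j = p then aM i q (m + n) v else 0) - (if q = i then aM p j (m + n) v else 0)
        + (if m + n = 0 then of_int m * k *
            ((if j = p \<and> i = q then 1 else 0) - (if i = j \<and> p = q then 1 / of_nat (l + 1) else 0)) else 0) *m v"
    using ijpq w c gen_closed
    by (simp add: aM_emb current_commutator'[OF c w(1)] embM_gen_bracket
        trace_form_munit_munit mult_ac del: of_nat_add of_nat_Suc)
qed

lemma aM_mem_gen:
  assumes W: "LM.stable W" and x: "x \<in> carrier (sl l)" and w: "w \<in> carrier M" "embM w \<in> W"
  shows "embM (YM (gen x) n w) \<in> W"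
proof -
  have sW: "E.subspace W" using W by (simp add: LM.stable_def)
  have "embM (YM (gen x) n w) = (\<Sum>i<l + 1. \<Sum>j<l + 1. x $$ (i, j) *m embM (YM (gen (munit l i j)) n w))"
    by (rule sl_linear.expand_munit[OF sl_linear_YM[OF w(1)] x])
  also have "\<dots> = (\<Sum>i<l + 1. \<Sum>j<l + 1. x $$ (i, j) *m aM i j n (embM w))"
    by (intro sum.cong refl) (simp add: aM_emb w(1))
  also have "\<dots> \<in> W"
    by (intro E.subspace_sum[OF sW] E.subspace_scale[OF sW]) (use W w(2) in \<open>auto simp: LM.stable_def\<close>)
  finally show ?thesis .
qed

lemma stable_YM:
  assumes W: "LM.stable W" and v: "v \<in> carrier NM" and w: "w \<in> carrier M" "embM w \<in> W"
  shows "embM (YM v n w) \<in> W"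
proof -
  let ?W = "E.pullback W"
  have "YM v n w \<in> ?W"
  proof (rule stable_under_generated[of ?W "gen ` carrier (sl l)"])
    show "submodule ?W CC M" by (rule E.submodule_pullback) (use W in \<open>simp add: LM.stable_def\<close>)
    show "gen ` carrier (sl l) \<subseteq> carrier NM" using gen_closed by blast
    fix g n w assume "g \<in> gen ` carrier (sl l)" "w \<in> ?W"
    then show "YM g n w \<in> ?W" using aM_mem_gen[OF W] gen_closed by (auto simp: E.pullback_def)
  qed (use v w gens_generate in \<open>auto simp: E.pullback_def\<close>)
  then show ?thesis by (simp add: E.pullback_def)
qed

lemma stable_iff:
  assumes W: "W \<subseteq> carrier M"
  shows "stable_submodule M {YM v n | v n. v \<in> carrier NM} W \<longleftrightarrow> LM.stable (embM ` W)"
proof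
  assume st: "stable_submodule M {YM v n | v n. v \<in> carrier NM} W"
  then have sW: "submodule W CC M" and YW: "\<And>v n w. v \<in> carrier NM \<Longrightarrow> w \<in> W \<Longrightarrow> YM v n w \<in> W"
    unfolding stable_submodule_def by blast+
  show "LM.stable (embM ` W)"
    unfolding LM.stable_def
  proof (intro conjI allI impI ballI)
    fix i j n u assume ij: "i < l + 1" "j < l + 1" and "u \<in> embM ` W"
    then obtain w where w: "w \<in> W" "u = embM w" by blast
    then have "aM i j n u = embM (YM (gen (munit l i j)) n w)" using W ij by (auto simp: aM_emb)
    then show "aM i j n u \<in> embM ` W" using YW[OF gen_closed[OF munit_closed[OF ij]] w(1)] by blast
  qed (use W E.subspace_emb[OF sW] in auto)
next
  assume st: "LM.stable (embM ` W)"
  have "submodule W CC M"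
    using st E.submodule_pullback[of "embM ` W"] E.pullback_emb[OF W] by (simp add: LM.stable_def)
  moreover have "YM v n w \<in> W" if "v \<in> carrier NM" "w \<in> W" for v n w
  proof -
    have w: "w \<in> carrier M" using that W by blast
    have "embM (YM v n w) \<in> embM ` W" by (rule stable_YM[OF st that(1) w]) (use that in blast)
    then obtain w' where "w' \<in> W" "embM (YM v n w) = embM w'" by blast
    moreover have "w' \<in> carrier M" using \<open>w' \<in> W\<close> W by blast
    ultimately show ?thesis using E.emb_inj[of "YM v n w" w'] that(1) w by simp
  qed
  ultimately show "stable_submodule M {YM v n | v n. v \<in> carrier NM} W"
    by (auto simp: stable_submodule_def)
qed

abbreviation DM :: "'x \<Rightarrow> 'x" where "DM \<equiv> E.lift (YM conf 1)"

text \<open>Mode 1 of \<open>b i i\<close> is zero on \<open>M\<close>. Expanded modulo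
  \<open>T\<close>, it retains only zero modes of the currents and L(0).\<close>

lemma relation:
  assumes T: "LM.stable T" and u: "u \<in> E.image_space"
    and pos: "\<And>i j n. i < l + 1 \<Longrightarrow> j < l + 1 \<Longrightarrow> 1 \<le> n \<Longrightarrow> aM i j n u \<in> T" and i: "i < l + 1"
  shows "(\<Sum>m<l + 1. aM m i 0 (aM i m 0 u)) + (of_nat (l + 1) / 2) *m aM i i 0 u - DM u \<in> T"
proof -
  obtain w where w: "w \<in> carrier M" "u = embM w" using u by blast
  have sT: "E.subspace T" and TV: "T \<subseteq> E.image_space" using T by (auto simp: LM.stable_def)
  \<comment> \<open>Mode 1 is the degree-preserving mode of a vector of conformal weight 2.\<close>
  define Z where "Z p = embM (YM (ev p) 1 w)" for p
  have Z_add: "Z (p + p') = Z p + Z p'" for p p'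
    using w by (simp add: Z_def ev_add linear_onD(2)[OF YM_linear_left] E.emb_add)
  have Z_scale: "Z (scale c p) = c *m Z p" for c p
    using w by (simp add: Z_def ev_scale linear_onD(3)[OF YM_linear_left] E.emb_smult)
  have Z_diff: "Z (p - p') = Z p - Z p'" for p p'
    using Z_add[of "p - p'" p'] by simp
  have Z_0: "Z 0 = 0" using Z_scale[of 0 0] by simp
  have Z_sum: "Z (sum g A) = (\<Sum>m\<in>A. Z (g m))" for g and A :: "nat set"
    by (induction A rule: infinite_finite_induct) (simp_all add: Z_0 Z_add)
  have "Z (b i i) = 0" using annihilated[OF i i w(1)] by (simp add: Z_def)
  then have eq: "(\<Sum>m<l + 1. Z (a i m (- 1) (a m i (- 1) (emb nvac))))
      - (of_nat (l + 1) / 2) *m Z (a i i (- 2) (emb nvac)) - Z \<omega> = 0"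
    by (simp add: b_def s_def Z_diff Z_scale Z_sum)
  have Z\<omega>: "Z \<omega> = DM u"
    using w conf_closed by (simp add: Z_def flip: emb_conf)
  \<comment> \<open>The minus sign here turns the \<open>- N / 2\<close> of \<open>b\<close> into
    the \<open>+ N / 2\<close> of the claim.\<close>
  have "YM (Y (gen (munit l i i)) (- 2) nvac) 1 w = (- 1) \<odot>\<^bsub>M\<^esub> YM (gen (munit l i i)) 0 w"
    by (rule derivative_mode[OF gen_closed[OF munit_closed[OF i i]] w(1)])
  then have Z2: "Z (a i i (- 2) (emb nvac)) = - aM i i 0 u"
    using i w nvac_closed munit_closed[OF i i] gen_closed[OF munit_closed[OF i i]]
    by (simp add: Z_def a_emb Y_gen cur_closed aM_emb E.emb_smult)
  \<comment> \<open>The order of the factors is reversed: in \<open>iterate_congruent\<close> the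
    zero mode of the left factor acts first.\<close>
  have Z1: "Z (a i m (- 1) (a m i (- 1) (emb nvac))) - aM m i 0 (aM i m 0 u) \<in> T" if m: "m < l + 1" for m
  proof -
    let ?W = "E.pullback T"
    note c = munit_closed[OF i m] munit_closed[OF m i]
    note g = gen_closed[OF c(1)] gen_closed[OF c(2)]
    have "YM (Y (gen (munit l i m)) (- 1) (gen (munit l m i))) 1 w
        \<ominus>\<^bsub>M\<^esub> YM (gen (munit l m i)) 0 (YM (gen (munit l i m)) 0 w) \<in> ?W"
    proof (rule iterate_congruent[OF E.submodule_pullback[OF sT] g w(1)])
      show "YM (gen (munit l i m)) n w' \<in> ?W" "YM (gen (munit l m i)) n w' \<in> ?W" if "w' \<in> ?W" for n w'
        using that aM_mem_gen[OF T c(1)] aM_mem_gen[OF T c(2)] g by (auto simp: E.pullback_def)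
      show "YM (gen (munit l i m)) n w \<in> ?W" "YM (gen (munit l m i)) n w \<in> ?W" if "1 \<le> n" for n
        using pos[OF i m that] pos[OF m i that] i m w g by (simp_all add: E.pullback_def aM_emb)
    qed
    then have "embM (YM (Y (gen (munit l i m)) (- 1) (gen (munit l m i))) 1 w)
        - embM (YM (gen (munit l m i)) 0 (YM (gen (munit l i m)) 0 w)) \<in> T"
      using g w NN.Y_closed[OF g] by (simp add: E.pullback_def E.emb_minus)
    moreover have "Z (a i m (- 1) (a m i (- 1) (emb nvac))) = embM (YM (Y (gen (munit l i m)) (- 1) (gen (munit l m i))) 1 w)"
      using i m c nvac_closed g by (simp add: Z_def a_emb cur_closed Y_gen flip: gen_def)
    ultimately show ?thesis using i m w g by (simp add: aM_emb)
  qed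
  have "(\<Sum>m<l + 1. Z (a i m (- 1) (a m i (- 1) (emb nvac))) - aM m i 0 (aM i m 0 u)) \<in> T"
    by (rule E.subspace_sum[OF sT]) (use Z1 in auto)
  then have "- (\<Sum>m<l + 1. Z (a i m (- 1) (a m i (- 1) (emb nvac))) - aM m i 0 (aM i m 0 u)) \<in> T"
    by (rule E.subspace_neg[OF sT])
  moreover have "- (\<Sum>m<l + 1. Z (a i m (- 1) (a m i (- 1) (emb nvac))) - aM m i 0 (aM i m 0 u))
    = (\<Sum>m<l + 1. aM m i 0 (aM i m 0 u)) + (of_nat (l + 1) / 2) *m aM i i 0 u - DM u"
    using eq unfolding sum_subtractf Z2 Z\<omega> by (simp add: algebra_simps)
  ultimately show ?thesis by simp
qed

section \<open>Weights and heights of a module from category O\<close>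

abbreviation CM :: "nat \<Rightarrow> 'x \<Rightarrow> 'x"
  where "CM \<equiv> \<lambda>h. if h < l + 1 then aM h h 0 else DM"

abbreviation \<rho> :: "ext \<Rightarrow> 'w \<Rightarrow> 'w"
  where "\<rho> \<equiv> \<lambda>(H, a, b) w. YM (gen H) 0 w \<oplus>\<^bsub>M\<^esub> (a * k) \<odot>\<^bsub>M\<^esub> w \<ominus>\<^bsub>M\<^esub> b \<odot>\<^bsub>M\<^esub> YM conf 1 w"

lemma emb_\<rho>:
  assumes "H \<in> carrier (sl l)" "w \<in> carrier M"
  shows "embM (\<rho> (H, c, d) w) = embM (YM (gen H) 0 w) + (c * k) *m embM w - d *m DM (embM w)"
  using assms gen_closed conf_closed
  by (simp add: E.emb_minus E.emb_add E.emb_smult)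

lemma munit_ext: "h < l + 1 \<Longrightarrow> (munit l h h, 0, 0) \<in> ext_cartan l"
  using munit_closed[of h l h] by (auto simp: ext_cartan_def diagonal_mat_def munit_def)

lemma d_ext: "(0\<^sub>m (l + 1) (l + 1), 0, 1) \<in> ext_cartan l"
  using zero_sl by (auto simp: ext_cartan_def diagonal_mat_def)

text \<open>As \<open>d\<close> acts by \<open>- L(0)\<close>, the conformal weight is minus the
  value of the weight at \<open>d\<close>.\<close>

lemma weight_space_eigen:
  assumes w: "w \<in> weight_space l M \<rho> \<nu>"
  shows "embM w \<in> E.eigen CM (\<lambda>h. if h < l + 1 then \<nu> (munit l h h, 0, 0) else - \<nu> (0\<^sub>m (l + 1) (l + 1), 0, 1))"
  unfolding E.eigen_def
proof (intro CollectI allI)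
  fix h
  have wM: "w \<in> carrier M" and wt: "\<And>h. h \<in> ext_cartan l \<Longrightarrow> embM (\<rho> h w) = \<nu> h *m embM w"
    using w by (auto simp: weight_space_def E.emb_smult)
  show "CM h (embM w) = (if h < l + 1 then \<nu> (munit l h h, 0, 0) else - \<nu> (0\<^sub>m (l + 1) (l + 1), 0, 1)) *m embM w"
  proof (cases "h < l + 1")
    case True
    then show ?thesis
      using wt[OF munit_ext[OF True]] emb_\<rho>[OF munit_closed[OF True True] wM, of 0 0]
      by (simp add: aM_emb wM)
  next
    case False
    have "- DM (embM w) = \<nu> (0\<^sub>m (l + 1) (l + 1), 0, 1) *m embM w"
      using wt[OF d_ext] emb_\<rho>[OF zero_sl wM, of 0 1] by (simp add: gen_zero YM_zero_left wM)
    from arg_cong[OF this, of uminus] show ?thesis using False by simp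
  qed
qed

lemma M_weights: "E.image_space \<subseteq> E.span (E.image_space \<inter> (\<Union>\<nu>. E.eigen CM \<nu>))"
proof -
  have c: "(\<Union>\<nu>. weight_space l M \<rho> \<nu>) \<subseteq> carrier M" by (auto simp: weight_space_def)
  have "embM ` span_in M (\<Union>\<nu>. weight_space l M \<rho> \<nu>) = E.image_space"
    using category_O by (simp add: category_O_def)
  then have "E.image_space = E.span (embM ` (\<Union>\<nu>. weight_space l M \<rho> \<nu>))"
    using E.emb_span_in[OF c] by simp
  also have "\<dots> \<subseteq> E.span (E.image_space \<inter> (\<Union>\<nu>. E.eigen CM \<nu>))"
    by (rule E.span_mono) (use weight_space_eigen c in blast)
  finally show ?thesis .
qed

text \<open>For a linear functional, its value at the element of the extended Cartan subalgebra
  where all simple roots equal 1. It matches \<open>height\<close> when the conformal weight is read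
  as minus the value at \<open>d\<close>.\<close>

definition coheight :: "(ext \<Rightarrow> complex) \<Rightarrow> complex"
  where "coheight \<nu> = - (\<Sum>j<l + 1. of_nat j * \<nu> (munit l j j, 0, 0)) + of_nat (l + 1) * \<nu> (0\<^sub>m (l + 1) (l + 1), 0, 1)"

text \<open>For \<open>i = 0\<close> the finite part contributes \<open>- l\<close> and
  \<open>d\<close> contributes \<open>l + 1\<close>; for the other roots only the finite part
  contributes.\<close>

lemma coheight_simple_root:
  assumes "i \<le> l"
  shows "coheight (simple_root l i) = 1"
proof (cases "i = 0")
  case True
  have "(\<Sum>j<l + 1. of_nat j * simple_root l i (munit l j j, 0, 0))
      = (\<Sum>j<l + 1. (if j = l then of_nat j else 0) - (if j = 0 then of_nat j else 0) :: complex)"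
    by (rule sum.cong) (use True in \<open>auto simp: simple_root_def munit_entry\<close>)
  also have "\<dots> = of_nat l" by (simp add: sum_subtractf del: sum.lessThan_Suc)
  finally show ?thesis using True by (simp add: coheight_def simple_root_def)
next
  case False
  have "(\<Sum>j<l + 1. of_nat j * simple_root l i (munit l j j, 0, 0))
      = (\<Sum>j<l + 1. (if j = i - 1 then of_nat j else 0) - (if j = i then of_nat j else 0) :: complex)"
    by (rule sum.cong) (use False assms in \<open>auto simp: simple_root_def munit_entry\<close>)
  also have "\<dots> = of_nat (i - 1) - of_nat i"
    using assms by (simp add: sum_subtractf del: sum.lessThan_Suc)
  also have "\<dots> = - 1" using False by (simp add: of_nat_diff)
  finally show ?thesis using False assms by (simp add: coheight_def simple_root_def)
qed

lemma coheight_Q_plus: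
  assumes "\<beta> \<in> Q_plus l"
  obtains n :: nat where "coheight \<beta> = of_nat n"
proof -
  obtain m :: "nat \<Rightarrow> nat" where \<beta>: "\<beta> = (\<lambda>h. \<Sum>i\<le>l. of_nat (m i) * simple_root l i h)"
    using assms by (auto simp: Q_plus_def)
  have "coheight \<beta> = (\<Sum>i\<le>l. of_nat (m i) * coheight (simple_root l i))"
  proof -
    have "(\<Sum>j<l + 1. of_nat j * (\<Sum>i\<le>l. of_nat (m i) * simple_root l i (munit l j j, 0, 0)))
        = (\<Sum>i\<le>l. of_nat (m i) * (\<Sum>j<l + 1. of_nat j * simple_root l i (munit l j j, 0, 0)))"
      unfolding sum_distrib_left by (subst sum.swap) (simp only: mult.left_commute)
    moreover have "of_nat (l + 1) * (\<Sum>i\<le>l. of_nat (m i) * simple_root l i (0\<^sub>m (l + 1) (l + 1), 0, 1))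
        = (\<Sum>i\<le>l. of_nat (m i) * (of_nat (l + 1) * simple_root l i (0\<^sub>m (l + 1) (l + 1), 0, 1)))"
      unfolding sum_distrib_left by (simp only: mult.left_commute)
    ultimately show ?thesis
      unfolding coheight_def \<beta> by (simp only: distrib_left sum.distrib mult_minus_right sum_negf)
  qed
  also have "\<dots> = of_nat (\<Sum>i\<le>l. m i)" by (simp add: coheight_simple_root)
  finally show ?thesis by (rule that)
qed

text \<open>Rebuilds a functional on the extended Cartan subalgebra from joint eigenvalues, so that
  the condition of category O on weights applies to them.\<close>

lemma eigen_weight_space:
  assumes w: "w \<in> carrier M" and e: "embM w \<in> E.eigen CM \<nu>"
  shows "w \<in> weight_space l M \<rho> (\<lambda>(H, c, d). (\<Sum>i<l + 1. H $$ (i, i) * \<nu> i) + c * k - d * \<nu> (l + 1))"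
  unfolding weight_space_def
proof (intro CollectI conjI ballI w)
  fix x assume "x \<in> ext_cartan l"
  then obtain H c d where x: "x = (H, c, d)" "H \<in> carrier (sl l)" "diagonal_mat H"
    by (auto simp: ext_cartan_def)
  have C: "CM h (embM w) = \<nu> h *m embM w" for h using e by (simp add: E.eigen_def)
  have a: "embM (YM (gen (munit l i i)) 0 w) = \<nu> i *m embM w" if "i < l + 1" for i
    using C[of i] that w by (simp add: aM_emb)
  have "embM (YM (gen H) 0 w) = (\<Sum>i<l + 1. \<Sum>j<l + 1. H $$ (i, j) *m embM (YM (gen (munit l i j)) 0 w))"
    by (rule sl_linear.expand_munit[OF sl_linear_YM[OF w] x(2)])
  also have "\<dots> = (\<Sum>i<l + 1. \<Sum>j<l + 1. if j = i then (H $$ (i, i) * \<nu> i) *m embM w else 0)"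
    by (intro sum.cong refl) (use x sl_mat[OF x(2)] a in \<open>auto simp: diagonal_mat_def\<close>)
  also have "\<dots> = (\<Sum>i<l + 1. H $$ (i, i) * \<nu> i) *m embM w"
    by (simp add: E.scale_sum_left del: sum.lessThan_Suc)
  finally have "embM (\<rho> x w) = ((\<Sum>i<l + 1. H $$ (i, i) * \<nu> i) + c * k - d * \<nu> (l + 1)) *m embM w"
    unfolding x(1) emb_\<rho>[OF x(2) w] using C[of "l + 1"]
    by (simp add: E.scale_left_distrib E.scale_left_diff_distrib)
  then have eq: "embM (\<rho> x w) = embM (((\<Sum>i<l + 1. H $$ (i, i) * \<nu> i) + c * k - d * \<nu> (l + 1)) \<odot>\<^bsub>M\<^esub> w)"
    using w by (simp add: E.emb_smult)
  have closed: "\<rho> x w \<in> carrier M"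
    using x w gen_closed[OF x(2)] conf_closed by (simp add: minus_closed_M)
  show "\<rho> x w = (case x of (H, c, d) \<Rightarrow> (\<Sum>i<l + 1. H $$ (i, i) * \<nu> i) + c * k - d * \<nu> (l + 1)) \<odot>\<^bsub>M\<^esub> w"
    using iffD1[OF E.emb_inj[OF closed M.smult_closed'[OF w]] eq] x(1) by simp
qed

text \<open>Every weight is an element of the finite set \<open>S\<close> minus an element of
  \<open>Q_plus l\<close>, and the latter has a nonnegative integer as its height.\<close>

lemma M_bounded:
  obtains B where "\<And>v \<nu>. v \<in> E.image_space \<Longrightarrow> v \<noteq> 0 \<Longrightarrow> v \<in> E.eigen CM \<nu> \<Longrightarrow>
    Re (- (\<Sum>j<l + 1. of_nat j * \<nu> j) - of_nat (l + 1) * \<nu> (l + 1)) \<le> B"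
proof -
  obtain S where S: "finite S" "\<And>\<nu>. weight_space l M \<rho> \<nu> \<noteq> {\<zero>\<^bsub>M\<^esub>} \<Longrightarrow>
      \<exists>\<nu>0\<in>S. \<exists>\<beta>\<in>Q_plus l. \<forall>h\<in>ext_cartan l. \<nu> h = \<nu>0 h - \<beta> h"
    using category_O unfolding category_O_def by blast
  \<comment> \<open>A sum of absolute values dominates each member and also makes sense for empty
    \<open>S\<close>.\<close>
  let ?B = "\<Sum>\<nu>\<in>S. \<bar>Re (coheight \<nu>)\<bar>"
  have "Re (- (\<Sum>j<l + 1. of_nat j * \<nu> j) - of_nat (l + 1) * \<nu> (l + 1)) \<le> ?B"
    if v: "v \<in> E.image_space" "v \<noteq> 0" "v \<in> E.eigen CM \<nu>" for v \<nu>
  proof -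
    obtain w where w: "w \<in> carrier M" "v = embM w" using v(1) by blast
    define \<mu> where "\<mu> = (\<lambda>(H :: complex mat, c, d). (\<Sum>i<l + 1. H $$ (i, i) * \<nu> i) + c * k - d * \<nu> (l + 1))"
    have "w \<in> weight_space l M \<rho> \<mu>" unfolding \<mu>_def by (rule eigen_weight_space) (use w v(3) in auto)
    moreover have "w \<noteq> \<zero>\<^bsub>M\<^esub>" using v(2) w by auto
    ultimately obtain \<nu>0 \<beta> where \<nu>0: "\<nu>0 \<in> S" and \<beta>: "\<beta> \<in> Q_plus l" and eq: "\<forall>h\<in>ext_cartan l. \<mu> h = \<nu>0 h - \<beta> h"
      using S(2)[of \<mu>] by blast
    \<comment> \<open>The eigenvalues sum to zero, so the multiple of the identity in
      \<open>munit l j j\<close> does not alter the value of \<open>\<mu>\<close> there.\<close>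
    have "(\<Sum>i<l + 1. \<nu> i) *m v = (\<Sum>i<l + 1. aM i i 0 v)"
      using v(3) by (auto simp: E.scale_sum_left E.eigen_def intro!: sum.cong dest: spec split: if_splits) 
    then have tr: "(\<Sum>i<l + 1. \<nu> i) = 0" using LM.trace_a[of 0 v] v(2) by simp
    have \<mu>j: "\<mu> (munit l j j, 0, 0) = \<nu> j" if "j < l + 1" for j
    proof -
      have "\<mu> (munit l j j, 0, 0) = (\<Sum>i<l + 1. (if i = j then \<nu> i else 0) - \<nu> i / of_nat (l + 1))"
        unfolding \<mu>_def by (simp del: sum.lessThan_Suc, rule sum.cong) (auto simp: munit_entry left_diff_distrib)
      also have "\<dots> = \<nu> j - (\<Sum>i<l + 1. \<nu> i) / of_nat (l + 1)"
        using that by (simp add: sum_subtractf sum_divide_distrib del: sum.lessThan_Suc)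
      finally show ?thesis using tr by simp
    qed
    have \<mu>d: "\<mu> (0\<^sub>m (l + 1) (l + 1), 0, 1) = - \<nu> (l + 1)" by (simp add: \<mu>_def del: sum.lessThan_Suc)
    have "- (\<Sum>j<l + 1. of_nat j * \<nu> j) - of_nat (l + 1) * \<nu> (l + 1) = coheight \<mu>"
      unfolding coheight_def \<mu>d by (simp add: \<mu>j del: sum.lessThan_Suc)
    also have "\<dots> = coheight \<nu>0 - coheight \<beta>"
    proof -
      have "(\<Sum>j<l + 1. of_nat j * \<mu> (munit l j j, 0, 0))
          = (\<Sum>j<l + 1. of_nat j * \<nu>0 (munit l j j, 0, 0) - of_nat j * \<beta> (munit l j j, 0, 0))"
        by (rule sum.cong) (use eq munit_ext in \<open>auto simp: right_diff_distrib\<close>)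
      moreover have "\<mu> (0\<^sub>m (l + 1) (l + 1), 0, 1) = \<nu>0 (0\<^sub>m (l + 1) (l + 1), 0, 1) - \<beta> (0\<^sub>m (l + 1) (l + 1), 0, 1)"
        using eq d_ext by blast
      ultimately show ?thesis
        unfolding coheight_def by (simp add: sum_subtractf right_diff_distrib del: sum.lessThan_Suc)
    qed
    finally have "- (\<Sum>j<l + 1. of_nat j * \<nu> j) - of_nat (l + 1) * \<nu> (l + 1) = coheight \<nu>0 - coheight \<beta>" .
    moreover obtain n :: nat where "coheight \<beta> = of_nat n" by (rule coheight_Q_plus[OF \<beta>])
    ultimately have "Re (- (\<Sum>j<l + 1. of_nat j * \<nu> j) - of_nat (l + 1) * \<nu> (l + 1)) \<le> \<bar>Re (coheight \<nu>0)\<bar>"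
      by (simp del: sum.lessThan_Suc)
    also have "\<dots> \<le> ?B" by (rule member_le_sum) (use S(1) \<nu>0 in auto)
    finally show ?thesis .
  qed
  then show ?thesis by (rule that)
qed

theorem completely_reducible_M: "completely_reducible M {YM v n | v n. v \<in> carrier NM}"
proof -
  obtain B where B: "\<And>v \<nu>. v \<in> E.image_space \<Longrightarrow> v \<noteq> 0 \<Longrightarrow> v \<in> E.eigen CM \<nu> \<Longrightarrow>
    Re (- (\<Sum>j<l + 1. of_nat j * \<nu> j) - of_nat (l + 1) * \<nu> (l + 1)) \<le> B"
    by (rule M_bounded) (rule that)
  interpret bounded_weight_rep scaleM E.image_space "l + 1" k aM DM B
  proof
    show "odd (l + 1)" using even_l by simp
    have endo: "E.endo DM" by (rule E.endo_lift[OF YM_linear[OF conf_closed]])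
    show "DM (u + v) = DM u + DM v" "DM (c *m v) = c *m DM v" for u v c
      by (rule E.endo_add[OF endo] E.endo_scale[OF endo])+
    fix i j n v assume ij: "i < l + 1" "j < l + 1" and "v \<in> E.image_space"
    then obtain w where w: "w \<in> carrier M" "v = embM w" by blast
    let ?g = "gen (munit l i j)"
    have g: "?g \<in> carrier NM" by (rule gen_closed[OF munit_closed[OF ij]])
    have "embM (YM ?g n (YM conf 1 w)) - embM (YM conf 1 (YM ?g n w)) = of_int n *m embM (YM ?g n w)"
      using munit_conf_commutator[OF ij weak_vertex_module_axioms w(1), of n] w(1) g conf_closed
      by (simp flip: E.emb_minus E.emb_smult)
    then show "DM (aM i j n v) = aM i j n (DM v) - of_int n *m aM i j n v"
      using ij w g conf_closed by (simp add: aM_emb algebra_simps)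
  next
    fix W w assume W: "LM.stable W" and w: "w \<in> W"
    have "w \<in> E.image_space" using W w by (auto simp: LM.stable_def)
    then have "embM (YM conf 1 (evM w)) \<in> W"
      using w by (intro stable_YM[OF W conf_closed]) auto
    then show "DM w \<in> W" by (simp add: E.lift_def)
  qed (rule relation M_weights B; assumption)+
  show ?thesis
  proof (rule direct_sum_of_hwm)
    fix \<W> assume \<W>: "E.span (\<Union>\<W>) = E.image_space"
      "\<And>W. W \<in> \<W> \<Longrightarrow> LM.stable W \<and> W \<noteq> {0} \<and> (\<forall>W'. LM.stable W' \<longrightarrow> W' \<subseteq> W \<longrightarrow> W' = {0} \<or> W' = W)"
      "\<And>W. W \<in> \<W> \<Longrightarrow> W \<inter> E.span (\<Union>(\<W> - {W})) = {0}"
    show ?thesis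
      by (rule E.completely_reducible_I[OF stable_iff _ \<W>]) (auto simp: LM.stable_def)
  qed
qed

end


section \<open>Weak L(k,0)-modules from category O\<close>

text \<open>If all operators are zero or the identity, every subspace is stable and the irreducible
  ones are the lines. This serves the case of a vanishing vacuum.\<close>

lemma (in embedded_module) completely_reducible_trivial:
  assumes F: "\<And>f w. f \<in> F \<Longrightarrow> w \<in> carrier M \<Longrightarrow> f w = w \<or> f w = \<zero>"
  shows "completely_reducible M F"
proof -
  let ?P = "\<lambda>S. subspace S \<and> S \<subseteq> image_space"
  let ?I = "{span {v} | v. v \<in> image_space \<and> v \<noteq> 0}"
  have P: "stable_submodule M F W \<longleftrightarrow> ?P (emb ` W)" if W: "W \<subseteq> carrier M" for W
  proof
    assume "stable_submodule M F W"
    then show "?P (emb ` W)" using subspace_emb[of W] W by (auto simp: stable_submodule_def)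
  next
    assume "?P (emb ` W)"
    then have sW: "submodule W CC M" using submodule_pullback[of "emb ` W"] pullback_emb[OF W] by simp
    have "f w \<in> W" if f: "f \<in> F" and w: "w \<in> W" for f w
    proof -
      have "w \<in> carrier M" using w W by blast
      then have "f w = w \<or> f w = \<zero>" by (rule F[OF f])
      then show ?thesis using w submodule_CC_E(2)[OF sW] by (elim disjE) simp_all
    qed
    then show "stable_submodule M F W" using sW by (auto simp: stable_submodule_def)
  qed
  have irr: "?P S \<and> S \<noteq> {0} \<and> (\<forall>S'. ?P S' \<longrightarrow> S' \<subseteq> S \<longrightarrow> S' = {0} \<or> S' = S)" if S: "S \<in> ?I" for S
  proof -
    obtain v where v: "v \<in> image_space" "v \<noteq> 0" "S = span {v}" using S by blast
    have "S \<subseteq> image_space" unfolding v(3) by (rule span_minimal) (use v subspace_image_space in auto)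
    moreover have "v \<in> S" using v(3) by (simp add: span_base)
    moreover have "S' = {0} \<or> S' = S" if S': "subspace S'" "S' \<subseteq> S" for S'
    proof (cases "S' = {0}")
      case False
      then obtain u where u: "u \<in> S'" "u \<noteq> 0" using subspace_0[OF S'(1)] by blast
      then obtain c where c: "u = c *c v" using S'(2) v(3) by (auto simp: span_singleton)
      then have "inverse c *c u = v" using u by auto
      then have "v \<in> S'" using subspace_scale[OF S'(1) u(1), of "inverse c"] by simp
      then have "S \<subseteq> S'" unfolding v(3) by (intro span_minimal) (use S' in auto)
      then show ?thesis using S'(2) by blast
    qed simp
    ultimately show ?thesis using v by auto
  qed
  have sub: "subspace S" if "S \<in> ?I" for S using irr[OF that] by blast
  have dich: "S \<inter> span (\<Union>\<W>) = {0} \<or> S \<subseteq> span (\<Union>\<W>)" if "S \<in> ?I" "\<W> \<subseteq> ?I" for S \<W>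
  proof -
    have "subspace (S \<inter> span (\<Union>\<W>))" by (rule subspace_inter[OF sub[OF that(1)] subspace_span])
    moreover have "S \<inter> span (\<Union>\<W>) \<subseteq> image_space" using irr[OF that(1)] by blast
    ultimately have "S \<inter> span (\<Union>\<W>) = {0} \<or> S \<inter> span (\<Union>\<W>) = S" using irr[OF that(1)] by blast
    then show ?thesis by blast
  qed
  have nz: "{0} \<notin> ?I" using irr by blast
  show ?thesis
  proof (rule direct_sum_of_irreducibles[of ?I, OF sub dich nz])
    fix \<W> assume \<W>: "\<W> \<subseteq> ?I" "span (\<Union>\<W>) = span (\<Union>?I)"
      "\<And>W. W \<in> \<W> \<Longrightarrow> W \<inter> span (\<Union>(\<W> - {W})) = {0}"
    have "span (\<Union>?I) = image_space"
    proof
      show "span (\<Union>?I) \<subseteq> image_space"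
        by (rule span_minimal) (use irr subspace_image_space in blast)+
      show "image_space \<subseteq> span (\<Union>?I)"
      proof
        fix v assume v: "v \<in> image_space"
        show "v \<in> span (\<Union>?I)"
        proof (cases "v = 0")
          case False
          then have "span {v} \<in> ?I" using v by blast
          then show ?thesis using span_base[of v "{v}"] by (intro span_base) blast
        qed (simp add: span_zero)
      qed
    qed
    then have s: "span (\<Union>\<W>) = image_space" using \<W>(2) by simp
    show ?thesis
      by (rule completely_reducible_I[OF P _ s irr \<W>(3)]) (use \<W>(1) in auto)
  qed
qed

context affine_sl_VOA
begin

abbreviation LL where "LL \<equiv> L_mod (sl l) (trace_form l) k"
abbreviation proj where "proj \<equiv> L_proj (sl l) (trace_form l) k"

lemma carrier_LL: "carrier LL = proj ` carrier NM"
  by (auto simp: L_mod_def L_proj_def quot_module_def ring.extend_def module.fields_def FactRing_def A_RCOSETS_def')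

lemma operators_eq: "L_module_operators l k YM = {YM (proj v) n | v n. v \<in> carrier NM}"
  by (auto simp: L_module_operators_def carrier_LL)

text \<open>A pullback along \<open>proj\<close>. The induced vertex operators are unions over
  cosets, so the Jacobi identity transfers once \<open>N_max\<close> is known to be a two-sided
  ideal.\<close>

lemma weak_N_of_weak_L:
  assumes st: "stable_submodule NM (nact ` carrier (ahat l)) (N_max (sl l) (trace_form l) k)"
    and stY: "\<And>v n w. v \<in> carrier NM \<Longrightarrow> w \<in> N_max (sl l) (trace_form l) k \<Longrightarrow> Y v n w \<in> N_max (sl l) (trace_form l) k"
    and M: "weak_L_module l k Y M YM"
  shows "weak_vertex_module NM M nvac Y (\<lambda>v. YM (proj v))"
    and "\<And>v n w. v \<in> N_max (sl l) (trace_form l) k \<Longrightarrow> w \<in> carrier M \<Longrightarrow> YM (proj v) n w = \<zero>\<^bsub>M\<^esub>"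
proof -
  let ?J = "N_max (sl l) (trace_form l) k"
  have J: "submodule ?J CC NM" using st by (simp add: stable_submodule_def)
  interpret I: vertex_ideal NM nvac Y conf "gen ` carrier (sl l)" ?J
  proof (intro vertex_ideal.intro vertex_ideal_axioms.intro)
    show "Y g n v \<in> ?J" if "g \<in> gen ` carrier (sl l)" "v \<in> ?J" for g n v
      using that gen_closed by (intro stY) auto
    show "gen ` carrier (sl l) \<subseteq> carrier NM" using gen_closed by blast
    show "Y v (- 1) nvac = v" if "v \<in> carrier NM" for v
      using VOA that by (simp add: vertex_operator_algebra_def)
    show "Y v n nvac = \<zero>\<^bsub>NM\<^esub>" if "v \<in> carrier NM" "0 \<le> n" for v n
      using VOA that by (simp add: vertex_operator_algebra_def)
    show "Y (Y conf 0 u) n v = (- of_int n) \<odot>\<^bsub>NM\<^esub> Y u (n - 1) v" if "u \<in> carrier NM" "v \<in> carrier NM" for u n v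
      using VOA that by (simp add: vertex_operator_algebra_def)
    show "S = carrier NM" if "submodule S CC NM" "nvac \<in> S"
      "\<And>g n s. g \<in> gen ` carrier (sl l) \<Longrightarrow> s \<in> S \<Longrightarrow> Y g n s \<in> S" for S
      by (rule gens_generate[OF that])
  qed (rule conf_closed J NN.weak_vertex_module_axioms)+
  interpret NJ: quotient_space NM ?J
    by (intro quotient_space.intro quotient_space_axioms.intro J NM.complex_module_axioms)
  have proj_def: "proj v = ?J +>\<^bsub>NM\<^esub> v" for v by (simp add: L_proj_def)
  have LQ: "LL = NJ.Q" by (simp add: L_mod_def)
  have proj_add: "proj (u \<oplus>\<^bsub>NM\<^esub> v) = proj u \<oplus>\<^bsub>LL\<^esub> proj v" if "u \<in> carrier NM" "v \<in> carrier NM" for u v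
    using that by (simp add: proj_def LQ NJ.add_coset)
  have proj_smult: "proj (c \<odot>\<^bsub>NM\<^esub> v) = c \<odot>\<^bsub>LL\<^esub> proj v" if "v \<in> carrier NM" for c v
    using that by (simp add: proj_def LQ NJ.smult_coset)
  have proj_closed: "proj v \<in> carrier LL" if "v \<in> carrier NM" for v
    using that by (simp add: carrier_LL)
  have vertex: "L_vertex (sl l) (trace_form l) k Y (proj u) n (proj v) = proj (Y u n v)"
    if "u \<in> carrier NM" "v \<in> carrier NM" for u n v
    unfolding L_vertex_def proj_def by (rule I.vertex_coset[OF that])
  have W: "weak_module LL (proj nvac) (L_vertex (sl l) (trace_form l) k Y) M YM"
    using M by (simp add: weak_L_module_def)
  have lin: "linear_on LL M (\<lambda>v. YM v n w)" if "w \<in> carrier M" for n w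
    using W that by (simp add: weak_module_def)
  have mM: "Module.module CC M" using W by (simp add: weak_module_def)
  interpret M: complex_module M by (rule complex_module.intro[OF mM])
  have "weak_module NM nvac Y M (\<lambda>v. YM (proj v))"
    unfolding weak_module_def
  proof (intro conjI ballI allI)
    show "Module.module CC M" by (rule mM)
    show "linear_on M M (YM (proj v) n)" if "v \<in> carrier NM" for v n
      using W proj_closed[OF that] by (simp add: weak_module_def)
    show "linear_on NM M (\<lambda>v. YM (proj v) n w)" if "w \<in> carrier M" for n w
      unfolding linear_on_def
      using linear_onD[OF lin[OF that]] by (auto simp: proj_add proj_smult proj_closed)
    show "\<exists>n0. \<forall>n\<ge>n0. YM (proj v) n w = \<zero>\<^bsub>M\<^esub>" if "v \<in> carrier NM" "w \<in> carrier M" for v w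
      using W proj_closed[OF that(1)] that(2) by (simp add: weak_module_def)
    show "YM (proj nvac) n w = (if n = - 1 then w else \<zero>\<^bsub>M\<^esub>)" if "w \<in> carrier M" for n w
      using W that by (simp add: weak_module_def)
    show "jacobi_identity NM Y M (\<lambda>v. YM (proj v))"
      unfolding jacobi_identity_def
    proof (intro ballI allI)
      fix u v w p q r assume uvw: "u \<in> carrier NM" "v \<in> carrier NM" "w \<in> carrier M"
      have "jacobi_identity LL (L_vertex (sl l) (trace_form l) k Y) M YM"
        using W by (simp add: weak_module_def)
      from this[unfolded jacobi_identity_def, rule_format,
          OF proj_closed[OF uvw(1)] proj_closed[OF uvw(2)] uvw(3), of r p q]
      show "fin_supp_sum M (\<lambda>j. ((of_int r :: complex) gchoose j) \<odot>\<^bsub>M\<^esub>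
          YM (proj (Y u (p + int j) v)) (r + q - int j) w) =
        fin_supp_sum M (\<lambda>j. ((-1) ^ j * ((of_int p :: complex) gchoose j)) \<odot>\<^bsub>M\<^esub>
          (YM (proj u) (p + r - int j) (YM (proj v) (q + int j) w) \<ominus>\<^bsub>M\<^esub>
           ((-1) powi p) \<odot>\<^bsub>M\<^esub> YM (proj v) (p + q - int j) (YM (proj u) (r + int j) w)))"
        by (simp only: vertex[OF uvw(1,2)])
    qed
  qed
  then show "weak_vertex_module NM M nvac Y (\<lambda>v. YM (proj v))"
    by (intro weak_vertex_module.intro weak_vertex_module_axioms.intro
        NM.complex_module_axioms M.complex_module_axioms NN.Y_closed nvac_closed)
  fix v n w assume v: "v \<in> ?J" and w: "w \<in> carrier M"
  have vN: "v \<in> carrier NM" using v NM.submodule_CC_E(1)[OF J] by blast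
  \<comment> \<open>Zero is written as a multiple of \<open>v\<close>, so that linearity in the
    vertex algebra argument yields the vanishing.\<close>
  have "proj v = proj (0 \<odot>\<^bsub>NM\<^esub> v)"
    using NJ.coset_eq_zero_iff[OF vN] v vN NJ.zero_coset' by (simp add: proj_def)
  also have "\<dots> = 0 \<odot>\<^bsub>LL\<^esub> proj v" by (rule proj_smult[OF vN])
  finally have "YM (proj v) n w = 0 \<odot>\<^bsub>M\<^esub> YM (proj v) n w"
    using linear_onD(3)[OF lin[OF w, of n] proj_closed[OF vN], of 0] by simp
  then show "YM (proj v) n w = \<zero>\<^bsub>M\<^esub>"
    using linear_onD(1)[OF lin[OF w, of n] proj_closed[OF vN]] by simp
qed

theorem completely_reducible_weak_module:
  fixes M :: "(complex, 'w, 'q) module_scheme"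
  assumes M: "weak_L_module l k Y M YM" and O: "from_category_O l k xs M YM"
  shows "completely_reducible M (L_module_operators l k YM)"
proof -
  have "Module.module CC M" using M by (simp add: weak_L_module_def weak_module_def)
  then interpret M: complex_module M by (rule complex_module.intro)
  obtain embM :: "'w \<Rightarrow> 'w \<Rightarrow>\<^sub>0 complex" and evM where "embedded_module poly_scale M embM evM" using M.ex_embedding by blast
  then interpret E: embedded_module poly_scale M embM evM .
  obtain emb :: "complex mat Ncarr \<Rightarrow> complex mat Ncarr \<Rightarrow>\<^sub>0 complex" and ev
    where embN: "embedded_module poly_scale NM emb ev" using NM.ex_embedding by blast
  then interpret N: affine_sl_embedded l k xs Y poly_scale emb ev
    by (intro affine_sl_embedded.intro affine_sl_VOA_axioms)
  show ?thesis
  proof (cases "nvac = \<zero>\<^bsub>NM\<^esub>")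
    case True
    \<comment> \<open>The Poincare-Birkhoff-Witt theorem would exclude this case; without it, note that here every
      operator is zero or the identity.\<close>
    have N0: "{\<zero>\<^bsub>NM\<^esub>} = carrier NM"
      by (rule cur_generated) (auto simp: True cur_of_zero intro!: NM.submodule_CC_I)
    have "proj v = proj nvac" if "v \<in> carrier NM" for v
      using that unfolding N0[symmetric] True by simp
    moreover have "YM (proj nvac) n w = (if n = - 1 then w else \<zero>\<^bsub>M\<^esub>)" if "w \<in> carrier M" for n w
      using M that by (simp add: weak_L_module_def weak_module_def)
    ultimately show ?thesis
      by (intro E.completely_reducible_trivial) (auto simp: operators_eq)
  next
    case False
    note Nmax = N.N_max_properties[OF False]
    note W = weak_N_of_weak_L[OF Nmax(1) N.stable_Y[OF Nmax(1)] M]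
    have "category_O l M (\<lambda>(H, a, b) w. YM (proj (gen H)) 0 w \<oplus>\<^bsub>M\<^esub> (a * k) \<odot>\<^bsub>M\<^esub> w
        \<ominus>\<^bsub>M\<^esub> b \<odot>\<^bsub>M\<^esub> YM (proj conf) 1 w)"
      using O by (simp add: from_category_O_def ext_cartan_act_def current_mode_def L_conformal_def
          conf_def gen_def cur_def)
    then interpret weak_N_module l k xs Y poly_scale emb ev M "\<lambda>v. YM (proj v)" poly_scale embM evM
      by (intro weak_N_module.intro weak_N_module_axioms.intro N.affine_sl_embedded_axioms
          W(1) E.embedded_module_axioms W(2) Nmax(2))
    show ?thesis unfolding operators_eq by (rule completely_reducible_M)
  qed
qed

end

theorem theorem6p2:
  fixes l :: nat and k :: complex
    and xs :: "complex mat list"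
    and Y :: "complex mat Ncarr \<Rightarrow> int \<Rightarrow> complex mat Ncarr \<Rightarrow> complex mat Ncarr"
    and M :: "(complex, 'w) module"
    and YM :: "complex mat Lcarr \<Rightarrow> int \<Rightarrow> 'w \<Rightarrow> 'w"
  assumes "l \<ge> 2" and "even l"
    and "k = - (of_nat (l + 1) / 2)"
    and "orthonormal_basis (sl l) (trace_form l) xs"
    and "is_N_vertex_operators (sl l) (trace_form l) (of_nat (l + 1)) k xs Y"
    and "weak_L_module l k Y M YM"
    and "from_category_O l k xs M YM"
  shows "completely_reducible M (L_module_operators l k YM)"
proof -
  interpret affine_sl_VOA l k xs Y
    by unfold_locales (use assms in auto)
  show ?thesis by (rule completely_reducible_weak_module[OF assms(6,7)])
qed

end
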